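(* The following three statements are equivalent. (a) There is a universal constant $K$ such that for every $N$ and every subset $T$ of $\mathbb R^N$ one can find $U\subset\mathbb R^N$ such that $T\subset U+Kb(T)B_1$ and $\gamma_{1/2}(U)\le Kb(T)$. (b) There is a universal constant $K$ such that for every $N$ and every subset $T$ of $\mathbb R^N$ one can find $U\subset\mathbb R^N$ such that $T\subset U+Kb(T)B_1$ and $$\gamma_{1/2}(U)\le Kb(T),\qquad \gamma_1(U,\|\cdot\|_\infty)\le Kb(T).$$ (c) There is a universal constant $K$ such that for every $N$ and every subset $T$ of $\mathbb R^N$ one can find $U\subset\mathbb R^N$ such that $T\subset U+Kb(T)B_1$ and $\gamma_1(U,\|\cdot\|_\infty)\le Kb(T)$.
   Context: $B_1=\{t\in\mathbb R^N:\sum_{i\le N}|t_i|\le1\}$. With $(\varepsilon_i)_{i\le N}$ independent, $P(\varepsilon_i=\pm1)=1/2$, $b(T)=\sup\{E\sup_{t\in S}\sum_{i\le N}\varepsilon_it_i:\ S\subset T,\ S\text{ finite}\}$; sets $T$ are nonempty, and the conditions are vacuous when $b(T)=\infty$. For a metric space $(U,d)$ and $\alpha>0$, $$\gamma_{\alpha}(U,d)=\inf_\mu\sup_{x\in U}\int_0^\infty\Big(\log\frac1{\mu(B(x,\varepsilon))}\Big)^{\alpha}d\varepsilon ,$$ with $B(x,\varepsilon)$ the closed ball for $d$ and the infimum over probability measures on $U$ (equivalently, supported by a countable set); $\gamma_{1/2}(U)$ is $\gamma_{1/2}(U,\|\cdot\|_2)$. *)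

theory Defs
  imports "HOL-Probability.Probability" "HOL-Analysis.Abstract_Metric_Spaces"
begin

text \<open>
  The dimension \<open>N\<close> is quantified inside the formulas, after the universal constant,
  so a vector of \<open>\<real>\<^sup>N\<close> is a function on \<open>nat\<close> vanishing outside \<open>{..<N}\<close> (this makes equality
  of vectors agree with equality of functions).
\<close>

definition RN :: "nat \<Rightarrow> (nat \<Rightarrow> real) set" where
  "RN N = {t. \<forall>i\<ge>N. t i = 0}"

definition B1 :: "nat \<Rightarrow> (nat \<Rightarrow> real) set" where
  "B1 N = {t \<in> RN N. (\<Sum>i<N. \<bar>t i\<bar>) \<le> 1}"

definition dist_2 :: "nat \<Rightarrow> (nat \<Rightarrow> real) \<Rightarrow> (nat \<Rightarrow> real) \<Rightarrow> real" where
  "dist_2 N s t = L2_set (\<lambda>i. s i - t i) {..<N}"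

text \<open>Inserting \<open>0\<close> only matters for \<open>N = 0\<close>, where the maximum would range over the empty set.\<close>

definition dist_inf :: "nat \<Rightarrow> (nat \<Rightarrow> real) \<Rightarrow> (nat \<Rightarrow> real) \<Rightarrow> real" where
  "dist_inf N s t = Max (insert 0 ((\<lambda>i. \<bar>s i - t i\<bar>) ` {..<N}))"

lemma Metric_space_dist_2: "Metric_space (RN N) (dist_2 N)"
proof
  fix x y z :: "nat \<Rightarrow> real"
  show "0 \<le> dist_2 N x y" by (simp add: dist_2_def)
  show "dist_2 N x y = dist_2 N y x"
    by (simp add: dist_2_def L2_set_def power2_commute)
  assume "x \<in> RN N" "y \<in> RN N"
  then show "dist_2 N x y = 0 \<longleftrightarrow> x = y"
    by (simp add: dist_2_def L2_set_eq_0_iff RN_def fun_eq_iff) (metis not_le lessThan_iff)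
  have "dist_2 N x z = L2_set (\<lambda>i. (x i - y i) + (y i - z i)) {..<N}"
    by (simp add: dist_2_def)
  also have "\<dots> \<le> dist_2 N x y + dist_2 N y z"
    unfolding dist_2_def by (rule L2_set_triangle_ineq)
  finally show "dist_2 N x z \<le> dist_2 N x y + dist_2 N y z" .
qed

lemma Metric_space_dist_inf: "Metric_space (RN N) (dist_inf N)"
proof
  fix x y z :: "nat \<Rightarrow> real"
  have ub: "\<bar>s i - t i\<bar> \<le> dist_inf N s t" if "i < N" for s t i
    unfolding dist_inf_def using that by (intro Max_ge) auto
  have nonneg: "0 \<le> dist_inf N s t" for s t
    unfolding dist_inf_def by (intro Max_ge) auto
  show "0 \<le> dist_inf N x y" by (rule nonneg)
  show "dist_inf N x y = dist_inf N y x"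
    by (simp add: dist_inf_def abs_minus_commute)
  assume "x \<in> RN N" "y \<in> RN N"
  show "dist_inf N x y = 0 \<longleftrightarrow> x = y"
  proof
    assume *: "dist_inf N x y = 0"
    have "x i = y i" if "i < N" for i using ub[OF that, of x y] * by simp
    with \<open>x \<in> RN N\<close> \<open>y \<in> RN N\<close> show "x = y"
      by (auto simp: RN_def fun_eq_iff) (metis not_le)
  next
    assume "x = y"
    then have *: "insert 0 ((\<lambda>i. \<bar>x i - y i\<bar>) ` {..<N}) = {0}" by auto
    show "dist_inf N x y = 0" unfolding dist_inf_def * by simp
  qed
  have "\<bar>x i - z i\<bar> \<le> dist_inf N x y + dist_inf N y z" if "i < N" for i
    using ub[OF that, of x y] ub[OF that, of y z] by linarith
  then show "dist_inf N x z \<le> dist_inf N x y + dist_inf N y z"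
    using nonneg[of x y] nonneg[of y z]
    by (subst dist_inf_def, subst Max_le_iff) auto
qed

definition rademacher :: "nat \<Rightarrow> (nat \<Rightarrow> real) pmf" where
  "rademacher N = Pi_pmf {..<N} 0 (\<lambda>_. pmf_of_set {-1, 1})"

text \<open>
  \<open>S = {}\<close> is left out: its supremum is \<open>-\<infinity>\<close>, so it does not contribute for nonempty \<open>T\<close>,
  while \<open>Max {}\<close> is unspecified.
\<close>

definition bern :: "nat \<Rightarrow> (nat \<Rightarrow> real) set \<Rightarrow> ereal" where
  "bern N T = (SUP S \<in> {S. S \<subseteq> T \<and> finite S \<and> S \<noteq> {}}.
     ereal (measure_pmf.expectation (rademacher N) (\<lambda>\<epsilon>. Max ((\<lambda>t. \<Sum>i<N. \<epsilon> i * t i) ` S))))"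

definition prob_measures_on :: "'a set \<Rightarrow> ('a \<Rightarrow> 'a \<Rightarrow> real) \<Rightarrow> 'a measure set" where
  "prob_measures_on U d = {\<mu>. prob_space \<mu> \<and> space \<mu> = U \<and>
     sets \<mu> = sigma_sets U {V. openin (Metric_space.mtopology U d) V}}"

text \<open>\<open>(log (1 / p))\<^sup>\<alpha>\<close> for \<open>0 \<le> p \<le> 1\<close> and \<open>\<alpha> > 0\<close>, with value \<open>\<infinity>\<close> at \<open>p = 0\<close>.\<close>

definition log_inv_pow :: "real \<Rightarrow> real \<Rightarrow> ennreal" where
  "log_inv_pow \<alpha> p = (if p = 0 then \<infinity> else ennreal (ln (1 / p) powr \<alpha>))"

definition gamma_fun :: "real \<Rightarrow> 'a set \<Rightarrow> ('a \<Rightarrow> 'a \<Rightarrow> real) \<Rightarrow> ennreal" where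
  "gamma_fun \<alpha> U d = (INF \<mu> \<in> prob_measures_on U d. SUP x \<in> U.
     \<integral>\<^sup>+\<epsilon>\<in>{0<..}. log_inv_pow \<alpha> (measure \<mu> (Metric_space.mcball U d x \<epsilon>)) \<partial>lborel)"

definition plus_B1 :: "nat \<Rightarrow> (nat \<Rightarrow> real) set \<Rightarrow> real \<Rightarrow> (nat \<Rightarrow> real) set" where
  "plus_B1 N U r = {(\<lambda>i. u i + r * v i) | u v. u \<in> U \<and> v \<in> B1 N}"

end

theory Submission
  imports Defs
begin

text \<open>
  Write \<open>d\<^sub>2\<close> and \<open>d\<^sub>\<infinity>\<close> for the Euclidean and the supremum distance. Statement (b) contains (a)
  and (c), so the content lies in the implications from (a) and from (c) to (b). Apart
  from a common reduction to nets in finite sets these two are unrelated.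

  A set \<open>T\<close> with \<open>b(T) < \<infinity>\<close> is bounded, and a single point if \<open>b(T) = 0\<close>. Up to
  \<open>b(T) B\<^sub>1\<close> it may therefore be replaced by a finite subset \<open>F\<close>, and the set \<open>U\<close> furnished by
  (a) or (c) for \<open>F\<close> may be replaced by one point of \<open>U\<close> for every point of \<open>F\<close>. Shifting \<open>F\<close> by vectors of \<open>K b(T) B\<^sub>1\<close> raises \<open>b\<close> by at most
  \<open>K b(T)\<close>, so the new set still has \<open>b \<le> (K + 1) b(T)\<close> (lemma \<open>finite_decomposition\<close>). On
  finite sets, a measure with small \<open>\<gamma>\<^sub>\<alpha>\<close> integral amounts to nets of at most \<open>2 ^ 2 ^ n\<close> points,
  \<open>n = 0, 1, \<dots>\<close>, for which the sum over \<open>n\<close> of \<open>2 powr (\<alpha> n)\<close> times the distance to the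
  \<open>n\<close>-th net is uniformly small: lemmas \<open>has_nets_of_measure\<close> (disjoint balls of mass
  \<open>2 ^ -2 ^ n\<close>, chosen smallest first) and \<open>gamma_fun_le_of_nets\<close> (weighted point masses on the
  nets). All further work is on nets.

  From (a) to (b): join each point to its chain of \<open>d\<^sub>2\<close>-approximations and cut the \<open>k\<close>-th link
  \<open>v\<close> at height \<open>2 powr (-k/2) \<parallel>v\<parallel>\<^sub>2\<close>. The coordinates above it have \<open>\<ell>\<^sub>1\<close>-norm at most
  \<open>2 powr (k/2) \<parallel>v\<parallel>\<^sub>2\<close>, and these numbers are summable along the chain, so what is removed
  lies in a multiple of \<open>b(T) B\<^sub>1\<close>. The coordinates below it satisfy
  \<open>2 ^ k \<parallel>v\<parallel>\<^sub>\<infinity> \<le> 2 powr (k/2) \<parallel>v\<parallel>\<^sub>2\<close>, so the truncated chains control \<open>\<gamma>\<^sub>1\<close> for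
  \<open>d\<^sub>\<infinity>\<close> and \<open>\<gamma>\<^sub>1\<^sub>/\<^sub>2\<close> for \<open>d\<^sub>2\<close> at the same time (lemma \<open>truncated_chains\<close>).

  From (c) to (b): one has to bound \<open>\<gamma>\<^sub>1\<^sub>/\<^sub>2\<close> for \<open>d\<^sub>2\<close> by \<open>b\<close> plus \<open>\<gamma>\<^sub>1\<close> for \<open>d\<^sub>\<infinity>\<close>
  (theorem \<open>nets_2_of_nets_inf\<close>). This rests on a growth condition (lemma \<open>growth\<close>): if \<open>m\<close>
  points are \<open>a\<close>-separated in \<open>d\<^sub>2\<close> and within \<open>a / sqrt (ln m)\<close> of each other in \<open>d\<^sub>\<infinity>\<close>,
  then the union of sets lying close to them has a Bernoulli supremum exceeding the smallest of
  the individual ones by a multiple of \<open>a sqrt (ln m)\<close>. It combines Sudakov minoration for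
  Bernoulli processes, proved by following a Gibbs measure on the points, with a Gaussian lower tail
  for Bernoulli suprema, proved by an infimum convolution inequality on the cube. The
  \<open>d\<^sub>\<infinity>\<close>-hypothesis of the growth condition holds inside the cells of the \<open>d\<^sub>\<infinity>\<close>-nets except at
  radii that \<open>\<gamma>\<^sub>1\<close> already pays for. The passage from growth to chaining follows van Handel's
  contraction principle: for every point and every scale take the radius \<open>s\<^sub>n(x)\<close> minimizing
  \<open>\<kappa> 2 powr (n/2) s - b(F \<inter> B(x, s))\<close>; the weighted sum of these radii telescopes to at most
  a multiple of \<open>b(F)\<close> (lemma \<open>sum_optimal_radii_le\<close>), and by growth they control the entropy
  numbers of small pieces of \<open>F\<close> up to a small multiple of the diameter of the piece. Hence a
  chaining bound \<open>V\<close> improves to \<open>V / 2 + C S\<close> (lemma \<open>contraction_step\<close>), and iteration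
  gives \<open>3 C S\<close>.
\<close>

section \<open>Averages over the discrete cube\<close>

definition signs :: "nat \<Rightarrow> (nat \<Rightarrow> real) set" where
  "signs N = PiE_dflt {..<N} 0 (\<lambda>_. {-1, 1})"

text \<open>
  A plain finite sum: it makes linearity, flipping a sign and induction on the dimension elementary.
  Lemma \<open>expectation_rademacher\<close> ties it to the probability measure.
\<close>

definition avg :: "nat \<Rightarrow> ((nat \<Rightarrow> real) \<Rightarrow> real) \<Rightarrow> real" where
  "avg N f = (\<Sum>e\<in>signs N. f e) / 2 ^ N"

lemma finite_signs [simp]: "finite (signs N)"
  unfolding signs_def by (intro finite_PiE_dflt) auto

lemma card_signs: "card (signs N) = 2 ^ N"
  unfolding signs_def by (subst card_PiE_dflt) (auto simp: numeral_2_eq_2)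

lemma signs_nonempty: "signs N \<noteq> {}"
  using card_signs[of N] by force

lemma signs_iff: "e \<in> signs N \<longleftrightarrow> (\<forall>i<N. e i = 1 \<or> e i = -1) \<and> (\<forall>i\<ge>N. e i = 0)"
  unfolding signs_def PiE_dflt_def by (auto simp: not_less)

lemma expectation_rademacher: "measure_pmf.expectation (rademacher N) f = avg N f"
proof -
  have "rademacher N = pmf_of_set (signs N)"
    unfolding rademacher_def signs_def by (rule Pi_pmf_of_set) auto
  then show ?thesis
    by (simp add: integral_pmf_of_set signs_nonempty avg_def card_signs)
qed

lemma avg_mono: "(\<And>e. e \<in> signs N \<Longrightarrow> f e \<le> g e) \<Longrightarrow> avg N f \<le> avg N g"
  unfolding avg_def by (intro divide_right_mono sum_mono) auto

lemma avg_cong: "(\<And>e. e \<in> signs N \<Longrightarrow> f e = g e) \<Longrightarrow> avg N f = avg N g"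
  unfolding avg_def by (simp cong: sum.cong)

lemma avg_const [simp]: "avg N (\<lambda>_. c) = c"
  by (simp add: avg_def card_signs)

lemma avg_add: "avg N (\<lambda>e. f e + g e) = avg N f + avg N g"
  by (simp add: avg_def sum.distrib add_divide_distrib)

lemma avg_diff: "avg N (\<lambda>e. f e - g e) = avg N f - avg N g"
  by (simp add: avg_def sum_subtractf diff_divide_distrib)

lemma avg_cmult: "avg N (\<lambda>e. c * f e) = c * avg N f"
  by (simp add: avg_def sum_distrib_left)

lemma avg_sum: "avg N (\<lambda>e. \<Sum>x\<in>A. f x e) = (\<Sum>x\<in>A. avg N (f x))"
  unfolding avg_def by (subst sum.swap) (simp add: sum_divide_distrib)

lemma avg_pos: "(\<And>e. e \<in> signs N \<Longrightarrow> 0 < f e) \<Longrightarrow> 0 < avg N f"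
  unfolding avg_def by (intro divide_pos_pos sum_pos) (auto simp: signs_nonempty)

lemma avg_nonneg: "(\<And>e. e \<in> signs N \<Longrightarrow> 0 \<le> f e) \<Longrightarrow> 0 \<le> avg N f"
  unfolding avg_def by (intro divide_nonneg_pos sum_nonneg) auto

lemma avg_flip:
  assumes "i < N"
  shows "avg N (\<lambda>e. f (e(i := - e i))) = avg N f"
proof -
  have "(\<Sum>e\<in>signs N. f (e(i := - e i))) = (\<Sum>e\<in>signs N. f e)"
    by (rule sum.reindex_bij_witness[of _ "\<lambda>e. e(i := - e i)" "\<lambda>e. e(i := - e i)"])
      (use assms in \<open>auto simp: signs_iff\<close>)
  then show ?thesis by (simp add: avg_def)
qed

text \<open>
  Integration by parts on the cube: \<open>e i * f e\<close> and its value after flipping the \<open>i\<close>-th sign are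
  averaged, which turns the factor \<open>e i\<close> into a discrete derivative of \<open>f\<close>.
\<close>

lemma avg_sign_times:
  assumes "i < N"
  shows "avg N (\<lambda>e. e i * f e) = avg N (\<lambda>e. e i * (f e - f (e(i := - e i)))) / 2"
proof -
  have "avg N (\<lambda>e. e i * f e) = avg N (\<lambda>e. - (e i) * f (e(i := - e i)))"
    using avg_flip[OF assms, of "\<lambda>e. e i * f e"] by simp
  moreover have "avg N (\<lambda>e. e i * (f e - f (e(i := - e i))))
      = avg N (\<lambda>e. e i * f e) + avg N (\<lambda>e. - (e i) * f (e(i := - e i)))"
    by (subst avg_add[symmetric]) (simp add: algebra_simps)
  ultimately show ?thesis by simp
qed

lemma avg_sign: "i < N \<Longrightarrow> avg N (\<lambda>e. e i) = 0"
  using avg_sign_times[of i N "\<lambda>_. 1"] by simp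

lemma avg_0: "avg 0 f = f (\<lambda>_. 0)"
proof -
  have "signs 0 = {\<lambda>_. 0}" by (auto simp: signs_iff)
  then show ?thesis by (simp add: avg_def)
qed

lemma avg_Suc:
  "avg (Suc N) f = (avg N (\<lambda>e. f (e(N := 1))) + avg N (\<lambda>e. f (e(N := -1)))) / 2"
proof -
  let ?p = "(\<lambda>e. e(N := (1::real)))" and ?m = "(\<lambda>e. e(N := (-1::real)))"
  have split: "signs (Suc N) = ?p ` signs N \<union> ?m ` signs N"
  proof (intro equalityI subsetI)
    fix e assume e: "e \<in> signs (Suc N)"
    have "e(N := 0) \<in> signs N" using e by (auto simp: signs_iff)
    moreover have "e = ?p (e(N := 0)) \<or> e = ?m (e(N := 0))"
    proof -
      have "e N = 1 \<or> e N = -1" using e by (auto simp: signs_iff)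
      then show ?thesis by (auto simp: fun_eq_iff)
    qed
    ultimately show "e \<in> ?p ` signs N \<union> ?m ` signs N" by blast
  next
    fix e assume "e \<in> ?p ` signs N \<union> ?m ` signs N"
    then show "e \<in> signs (Suc N)" by (auto simp: signs_iff less_Suc_eq)
  qed
  have inj: "inj_on (\<lambda>e. e(N := c)) (signs N)" for c :: real
    by (rule inj_on_inverseI[of _ "\<lambda>e. e(N := 0)"]) (auto simp: signs_iff)
  have disj: "?p ` signs N \<inter> ?m ` signs N = {}"
  proof -
    have "f N = 1" if "f \<in> ?p ` signs N" for f using that by auto
    moreover have "f N = -1" if "f \<in> ?m ` signs N" for f using that by auto
    ultimately show ?thesis by fastforce
  qed
  have "(\<Sum>e\<in>signs (Suc N). f e)
      = (\<Sum>e\<in>signs N. f (e(N := 1))) + (\<Sum>e\<in>signs N. f (e(N := -1)))"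
    unfolding split by (subst sum.union_disjoint) (auto simp: sum.reindex[OF inj] disj)
  then show ?thesis by (simp add: avg_def field_simps)
qed

text \<open>
  Jensen's inequality, from the tangent of \<open>exp\<close> at the mean.
\<close>

lemma exp_avg_le: "exp (avg N f) \<le> avg N (\<lambda>e. exp (f e))"
proof -
  have "exp (avg N f) * (1 + (f e - avg N f)) \<le> exp (f e)" for e
    using mult_left_mono[OF exp_ge_add_one_self[of "f e - avg N f"], of "exp (avg N f)"]
    by (simp add: exp_add[symmetric])
  then have "avg N (\<lambda>e. exp (avg N f) * (1 + (f e - avg N f))) \<le> avg N (\<lambda>e. exp (f e))"
    by (intro avg_mono)
  then show ?thesis by (simp add: avg_cmult avg_add avg_diff)
qed

section \<open>Suprema of Bernoulli processes\<close>

definition ip :: "nat \<Rightarrow> (nat \<Rightarrow> real) \<Rightarrow> (nat \<Rightarrow> real) \<Rightarrow> real" where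
  "ip N e t = (\<Sum>i<N. e i * t i)"

definition sup_ip :: "nat \<Rightarrow> (nat \<Rightarrow> real) set \<Rightarrow> (nat \<Rightarrow> real) \<Rightarrow> real" where
  "sup_ip N S e = Max (ip N e ` S)"

lemma ip_diff: "ip N e (\<lambda>i. s i - t i) = ip N e s - ip N e t"
  by (simp add: ip_def sum_subtractf algebra_simps)

lemma avg_ip: "avg N (\<lambda>e. ip N e t) = 0"
proof -
  have "avg N (\<lambda>e. ip N e t) = (\<Sum>i<N. t i * avg N (\<lambda>e. e i))"
    unfolding ip_def by (simp add: avg_sum avg_cmult[symmetric] mult.commute)
  then show ?thesis by (simp add: avg_sign)
qed

lemma sup_ip_ge: "finite S \<Longrightarrow> t \<in> S \<Longrightarrow> ip N e t \<le> sup_ip N S e"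
  unfolding sup_ip_def by (intro Max_ge) auto

lemma sup_ip_le: "finite S \<Longrightarrow> S \<noteq> {} \<Longrightarrow> (\<And>t. t \<in> S \<Longrightarrow> ip N e t \<le> c) \<Longrightarrow> sup_ip N S e \<le> c"
  unfolding sup_ip_def by (subst Max_le_iff) auto

lemma sup_ip_attained: "finite S \<Longrightarrow> S \<noteq> {} \<Longrightarrow> \<exists>t\<in>S. sup_ip N S e = ip N e t"
proof -
  assume "finite S" "S \<noteq> {}"
  then have "Max (ip N e ` S) \<in> ip N e ` S" by (intro Max_in) auto
  then show ?thesis unfolding sup_ip_def by blast
qed

lemma sup_ip_mono: "finite S \<Longrightarrow> A \<noteq> {} \<Longrightarrow> A \<subseteq> S \<Longrightarrow> sup_ip N A e \<le> sup_ip N S e"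
  unfolding sup_ip_def by (intro Max_mono) auto

lemma sup_ip_translate:
  assumes "finite S" "S \<noteq> {}"
  shows "sup_ip N ((\<lambda>t i. t i - x i) ` S) e = sup_ip N S e - ip N e x"
proof (rule antisym)
  obtain t where "t \<in> S" "sup_ip N S e = ip N e t" using sup_ip_attained[OF assms] by blast
  then show "sup_ip N S e - ip N e x \<le> sup_ip N ((\<lambda>t i. t i - x i) ` S) e"
    using sup_ip_ge[of "(\<lambda>t i. t i - x i) ` S" "\<lambda>i. t i - x i" N e] assms by (simp add: ip_diff)
  show "sup_ip N ((\<lambda>t i. t i - x i) ` S) e \<le> sup_ip N S e - ip N e x"
    using assms by (intro sup_ip_le) (auto simp: ip_diff sup_ip_ge)
qed

lemma avg_sup_ip_mono:
  "finite S \<Longrightarrow> A \<noteq> {} \<Longrightarrow> A \<subseteq> S \<Longrightarrow> avg N (sup_ip N A) \<le> avg N (sup_ip N S)"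
  by (intro avg_mono sup_ip_mono)

lemma avg_sup_ip_singleton [simp]: "avg N (sup_ip N {t}) = 0"
proof -
  have "sup_ip N {t} = (\<lambda>e. ip N e t)" by (rule ext) (simp add: sup_ip_def)
  then show ?thesis by (simp add: avg_ip)
qed

lemma avg_sup_ip_nonneg: "finite S \<Longrightarrow> S \<noteq> {} \<Longrightarrow> 0 \<le> avg N (sup_ip N S)"
  using avg_sup_ip_mono[of S _ N] avg_sup_ip_singleton by (metis all_not_in_conv empty_subsetI insert_not_empty insert_subset)

lemma bern_eq: "bern N T = (SUP S \<in> {S. S \<subseteq> T \<and> finite S \<and> S \<noteq> {}}. ereal (avg N (sup_ip N S)))"
  unfolding bern_def expectation_rademacher sup_ip_def ip_def by simp

lemma avg_sup_ip_le_bern: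
  "finite S \<Longrightarrow> S \<noteq> {} \<Longrightarrow> S \<subseteq> T \<Longrightarrow> ereal (avg N (sup_ip N S)) \<le> bern N T"
  unfolding bern_eq by (rule SUP_upper) auto

lemma bern_mono: "A \<subseteq> T \<Longrightarrow> bern N A \<le> bern N T"
  unfolding bern_eq by (rule SUP_subset_mono) auto

lemma bern_nonneg: "T \<noteq> {} \<Longrightarrow> 0 \<le> bern N T"
  using avg_sup_ip_le_bern[of "{_}" T N] by (metis avg_sup_ip_singleton all_not_in_conv empty_subsetI finite.emptyI finite_insert insert_not_empty insert_subset zero_ereal_def)

text \<open>
  Both linear functionals have mean zero, and twice the maximum of two numbers is their sum plus the
  absolute value of their difference. This is how distances in a set are bounded by its Bernoulli
  supremum.
\<close>

lemma avg_abs_ip_le: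
  assumes "finite S" "s \<in> S" "t \<in> S"
  shows "avg N (\<lambda>e. \<bar>ip N e (\<lambda>i. s i - t i)\<bar>) \<le> 2 * avg N (sup_ip N S)"
proof -
  have "\<bar>ip N e (\<lambda>i. s i - t i)\<bar> \<le> 2 * sup_ip N S e - ip N e s - ip N e t" for e
    using sup_ip_ge[OF assms(1,2), of N e] sup_ip_ge[OF assms(1,3), of N e]
    unfolding ip_diff by linarith
  then have "avg N (\<lambda>e. \<bar>ip N e (\<lambda>i. s i - t i)\<bar>)
      \<le> avg N (\<lambda>e. 2 * sup_ip N S e - ip N e s - ip N e t)"
    by (intro avg_mono)
  then show ?thesis by (simp add: avg_diff avg_cmult avg_ip)
qed

lemma ip_flip_sign:
  assumes "j < N"
  shows "ip N (e(j := - e j)) v = ip N e v - 2 * (e j * v j)"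
proof -
  have "ip N e v = e j * v j + (\<Sum>i\<in>{..<N}-{j}. e i * v i)" for e
    unfolding ip_def using assms by (intro sum.remove) auto
  note this[of "e(j := - e j)"] this[of e]
  moreover have "(\<Sum>i\<in>{..<N}-{j}. (e(j := - e j)) i * v i) = (\<Sum>i\<in>{..<N}-{j}. e i * v i)"
    by (intro sum.cong) auto
  ultimately show ?thesis by simp
qed

lemma abs_coord_le_avg_abs_ip:
  assumes "j < N"
  shows "\<bar>v j\<bar> \<le> avg N (\<lambda>e. \<bar>ip N e v\<bar>)"
proof -
  note flip = ip_flip_sign[OF assms]
  have "2 * \<bar>v j\<bar> \<le> \<bar>ip N e v\<bar> + \<bar>ip N (e(j := - e j)) v\<bar>" if "e \<in> signs N" for e
    using that assms unfolding flip by (auto simp: signs_iff dest!: spec[of _ j])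
  then have "avg N (\<lambda>_. 2 * \<bar>v j\<bar>) \<le> avg N (\<lambda>e. \<bar>ip N e v\<bar> + \<bar>ip N (e(j := - e j)) v\<bar>)"
    by (intro avg_mono)
  then show ?thesis
    using avg_flip[OF assms, of "\<lambda>e. \<bar>ip N e v\<bar>"] by (simp add: avg_add)
qed

section \<open>Lower-tail concentration of Bernoulli suprema\<close>

text \<open>
  \<open>cosh x \<le> exp (x\<^sup>2 / 2)\<close>, which is Hoeffding's lemma for a fair sign.
\<close>

lemma exp_plus_exp_minus_le: "exp (x::real) + exp (-x) \<le> 2 * exp (x\<^sup>2 / 2)"
proof -
  have *: "exp x + exp (-x) \<le> 2 * exp (x\<^sup>2 / 2)" if "0 \<le> x" for x :: real
  proof -
    have "- (2 * x) * (1/2) + ln (1 + (1/2) * (exp (2 * x) - 1)) \<le> (2 * x)\<^sup>2 / 8"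
      by (rule Hoeffdings_lemma_aux) (use that in auto)
    then have "ln ((1 + exp (2 * x)) / 2) \<le> x\<^sup>2 / 2 + x"
      by (simp add: field_simps power2_eq_square)
    moreover have "0 < (1 + exp (2 * x)) / 2" by (simp add: add_pos_pos)
    ultimately have "(1 + exp (2 * x)) / 2 \<le> exp (x\<^sup>2 / 2 + x)"
      by (metis exp_le_cancel_iff exp_ln)
    then have "exp (-x) * (1 + exp (2 * x)) \<le> exp (-x) * (2 * exp (x\<^sup>2 / 2 + x))"
      by (intro mult_left_mono) auto
    then show ?thesis by (simp add: exp_add[symmetric] distrib_left mult.left_commute)
  qed
  show ?thesis using *[of x] *[of "-x"] by (cases "0 \<le> x") auto
qed

text \<open>
  The one-dimensional case of the infimum convolution inequality, with \<open>u\<close> and \<open>v\<close> standing for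
  minus the logarithm of the mean of \<open>exp (- f)\<close> on the two faces of the cube. With \<open>D = u - v\<close>, the choice
  \<open>\<theta> = D\<close> (or \<open>\<theta> = 1\<close> for large \<open>D\<close>) minimizes the exponent; for \<open>D \<le> 1\<close> the product is
  \<open>4 exp (- D\<^sup>2/4) cosh (D/2 - D\<^sup>2/4) cosh (D/2)\<close>.
\<close>

lemma two_point_ineq:
  assumes "v \<le> (u::real)"
  shows "\<exists>\<theta>\<in>{0..1}. (exp ((1 - \<theta>) * u + \<theta> * v + \<theta>\<^sup>2 / 2) + exp v) * (exp (-u) + exp (-v)) \<le> 4"
proof (cases "u - v \<le> 1")
  case True
  define D where "D = u - v"
  have D: "0 \<le> D" "D \<le> 1" using assms True by (auto simp: D_def)
  have e1: "exp ((1 - D) * u + D * v + D\<^sup>2 / 2) + exp v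
      = exp (v + D/2 - D\<^sup>2/4) * (exp (D/2 - D\<^sup>2/4) + exp (-(D/2 - D\<^sup>2/4)))"
    by (simp add: D_def algebra_simps power2_eq_square exp_add[symmetric] add_divide_distrib diff_divide_distrib)
  have e2: "exp (-u) + exp (-v) = exp (- v - D/2) * (exp (D/2) + exp (-(D/2)))"
    by (simp add: D_def algebra_simps exp_add[symmetric] add_divide_distrib diff_divide_distrib)
  have e3: "exp (v + D/2 - D\<^sup>2/4) * exp (- v - D/2) = exp (- (D\<^sup>2/4))"
    by (simp add: exp_add[symmetric])
  have "(exp ((1 - D) * u + D * v + D\<^sup>2 / 2) + exp v) * (exp (-u) + exp (-v))
      = exp (- (D\<^sup>2/4)) * ((exp (D/2 - D\<^sup>2/4) + exp (-(D/2 - D\<^sup>2/4))) * (exp (D/2) + exp (-(D/2))))"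
    unfolding e1 e2 e3[symmetric] by (simp only: mult_ac)
  also have "\<dots> \<le> exp (- (D\<^sup>2/4)) * ((2 * exp ((D/2 - D\<^sup>2/4)\<^sup>2/2)) * (2 * exp ((D/2)\<^sup>2/2)))"
    by (intro mult_left_mono mult_mono exp_plus_exp_minus_le) (auto intro: add_nonneg_nonneg)
  also have "\<dots> = 4 * exp (- (D\<^sup>2/4) + (D/2 - D\<^sup>2/4)\<^sup>2/2 + (D/2)\<^sup>2/2)"
    by (simp add: exp_add[symmetric])
  also have "\<dots> \<le> 4 * exp 0"
  proof -
    have "D/2 - D\<^sup>2/4 \<le> D/2" by simp
    moreover have "0 \<le> D/2 - D\<^sup>2/4"
    proof -
      have "D * D \<le> D * 1" using D by (intro mult_left_mono) auto
      then show ?thesis using D by (simp add: power2_eq_square)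
    qed
    ultimately have "(D/2 - D\<^sup>2/4)\<^sup>2 \<le> (D/2)\<^sup>2" by (intro power_mono)
    then show ?thesis by (simp add: power2_eq_square)
  qed
  finally show ?thesis using D by (intro bexI[of _ D]) auto
next
  case False
  define D where "D = u - v"
  have D: "1 \<le> D" using False by (simp add: D_def)
  have e: "exp (1/2::real) \<le> 7/4" "exp (-1::real) \<le> 2/5"
  proof -
    show "exp (1/2::real) \<le> 7/4"
      using exp_bound[of "1/2::real"] by (simp add: power2_eq_square)
    have "(5/2::real) \<le> exp 1"
      using exp_lower_Taylor_quadratic[of "1::real"] by simp
    then show "exp (-1::real) \<le> 2/5"
      by (simp add: exp_minus field_simps)
  qed
  have "(exp ((1 - 1) * u + 1 * v + 1\<^sup>2 / 2) + exp v) * (exp (-u) + exp (-v))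
     = (1 + exp (1/2)) * (1 + exp (- D))"
  proof -
    have "exp ((1 - 1) * u + 1 * v + 1\<^sup>2 / 2) = exp v * exp (1/2)"
      by (simp add: exp_add[symmetric])
    moreover have "exp (-u) = exp (-v) * exp (-D)" by (simp add: exp_add[symmetric] D_def)
    moreover have "(exp v * a + exp v) * (exp (-v) * b + exp (-v)) = (1 + a) * (1 + b)" for a b
    proof -
      have "(exp v * a + exp v) * (exp (-v) * b + exp (-v)) = (exp v * exp (-v)) * ((1 + a) * (1 + b))"
        by (simp only: algebra_simps)
      then show ?thesis by (simp add: exp_minus)
    qed
    ultimately show ?thesis by simp
  qed
  also have "\<dots> \<le> (1 + 7/4) * (1 + 2/5)"
  proof (intro mult_mono add_left_mono)
    show "exp (-D) \<le> 2/5" using e(2) D by (meson exp_le_cancel_iff neg_le_iff_le order_trans)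
  qed (use e in auto)
  also have "\<dots> \<le> (4::real)" by simp
  finally show ?thesis by (intro bexI[of _ 1]) auto
qed

text \<open>
  Hoelder's inequality with exponents \<open>1 / (1 - \<theta>)\<close> and \<open>1 / \<theta>\<close>; after normalization it is
  convexity of \<open>exp\<close>.
\<close>

lemma avg_exp_Hoelder:
  assumes "0 \<le> \<theta>" "\<theta> \<le> 1"
    and f: "avg N (\<lambda>e. exp (f e)) \<le> exp u" and g: "avg N (\<lambda>e. exp (g e)) \<le> exp v"
  shows "avg N (\<lambda>e. exp ((1 - \<theta>) * f e + \<theta> * g e)) \<le> exp ((1 - \<theta>) * u + \<theta> * v)"
proof -
  have young: "exp ((1 - \<theta>) * f e + \<theta> * g e)
      \<le> exp ((1 - \<theta>) * u + \<theta> * v) * ((1 - \<theta>) * (exp (-u) * exp (f e)) + \<theta> * (exp (-v) * exp (g e)))" for e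
  proof -
    have "exp ((1 - \<theta>) *\<^sub>R (f e - u) + \<theta> *\<^sub>R (g e - v)) \<le> (1 - \<theta>) * exp (f e - u) + \<theta> * exp (g e - v)"
      using convex_onD[OF exp_convex, of \<theta> "f e - u" "g e - v"] assms by auto
    then have "exp ((1 - \<theta>) * u + \<theta> * v) * exp ((1 - \<theta>) *\<^sub>R (f e - u) + \<theta> *\<^sub>R (g e - v))
        \<le> exp ((1 - \<theta>) * u + \<theta> * v) * ((1 - \<theta>) * exp (f e - u) + \<theta> * exp (g e - v))"
      by (intro mult_left_mono) auto
    then show ?thesis
      by (simp add: exp_add[symmetric] algebra_simps)
        
  qed
  have "avg N (\<lambda>e. exp ((1 - \<theta>) * f e + \<theta> * g e))
     \<le> exp ((1 - \<theta>) * u + \<theta> * v) * ((1 - \<theta>) * (exp (-u) * avg N (\<lambda>e. exp (f e)))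
          + \<theta> * (exp (-v) * avg N (\<lambda>e. exp (g e))))"
    using avg_mono[OF young, of N] by (simp only: avg_cmult avg_add)
  also have "\<dots> \<le> exp ((1 - \<theta>) * u + \<theta> * v) * ((1 - \<theta>) * (exp (-u) * exp u) + \<theta> * (exp (-v) * exp v))"
    using assms by (intro mult_left_mono add_mono) auto
  also have "\<dots> = exp ((1 - \<theta>) * u + \<theta> * v)"
    by (simp add: exp_minus)
  finally show ?thesis .
qed

definition sq_norm :: "nat \<Rightarrow> (nat \<Rightarrow> real) \<Rightarrow> real" where
  "sq_norm N t = (\<Sum>i<N. (t i)\<^sup>2)"

lemma ip_upd_Suc: "ip (Suc N) (e(N := x)) t = ip N e t + x * t N"
  by (simp add: ip_def)

text \<open>
  A form of Maurey's property (\<open>\<tau>\<close>) for the convex functions that occur here, maxima of affine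
  functions: the penalized maximum in the first factor is the infimum convolution of the second
  maximum with a quadratic cost, restricted to vertices of the dual problem. The offsets
  \<open>a h\<close> absorb the last coordinate, which makes an induction on the dimension possible. For the
  face \<open>x\<close>, the penalized maximum is compared with the interpolation, with weights
  \<open>1 - \<theta>\<close> and \<open>\<theta>\<close>, between the penalized maxima of the face \<open>x\<close> and of the opposite
  face: moving the affine function by \<open>\<theta>\<close> costs \<open>2 \<theta> x (h N)\<close>, and the penalty
  \<open>2 (h N)\<^sup>2\<close> reduces this to \<open>\<theta>\<^sup>2 / 2\<close>. Hoelder's inequality then reduces the claim to the
  two-point inequality.
\<close>

lemma inf_convolution_sup:
  fixes a :: "(nat \<Rightarrow> real) \<Rightarrow> real"
  assumes H: "finite H" "H \<noteq> {}"
  shows "avg N (\<lambda>e. exp (MAX h\<in>H. a h + ip N e h - 2 * sq_norm N h))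
       * avg N (\<lambda>e. exp (- (MAX h\<in>H. a h + ip N e h))) \<le> 1"
proof (induction N arbitrary: a)
  case 0
  show ?case by (simp add: avg_0 ip_def sq_norm_def exp_minus)
next
  case (Suc N)
  \<comment> \<open>Fixing the last sign to \<open>x\<close> leaves suprema of dimension \<open>N\<close> with the new offsets
    \<open>a h + x * h N\<close>, to which the induction hypothesis applies.\<close>
  define F where "F x e = (MAX h\<in>H. (a h + x * h N) + ip N e h)" for x e
  define Q where "Q x e = (MAX h\<in>H. (a h + x * h N) + ip N e h - 2 * sq_norm N h)" for x e
  define w where "w x = - ln (avg N (\<lambda>e. exp (- F x e)))" for x
  have wpos: "0 < avg N (\<lambda>e. exp (- F x e))" for x by (intro avg_pos) simp
  have expw: "avg N (\<lambda>e. exp (- F x e)) = exp (- w x)" for x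
    using wpos[of x] by (simp add: w_def)
  have IH: "avg N (\<lambda>e. exp (Q x e)) \<le> exp (w x)" for x
  proof -
    have "avg N (\<lambda>e. exp (Q x e)) * exp (- w x) \<le> 1"
      using Suc.IH[of "\<lambda>h. a h + x * h N"]
      unfolding Q_def[symmetric] F_def[symmetric] expw .
    then show ?thesis by (simp add: exp_minus field_simps)
  qed
  define QQ where "QQ e = (MAX h\<in>H. a h + ip (Suc N) e h - 2 * sq_norm (Suc N) h)" for e
  have interp: "QQ (e(N := x)) \<le> (1 - \<theta>) * Q x e + \<theta> * Q (-x) e + \<theta>\<^sup>2 / 2"
    if "\<theta> \<in> {0..1}" "x = 1 \<or> x = -1" for \<theta> x e
  proof -
    have "a h + ip (Suc N) (e(N := x)) h - 2 * sq_norm (Suc N) h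
        \<le> (1 - \<theta>) * Q x e + \<theta> * Q (-x) e + \<theta>\<^sup>2 / 2" if "h \<in> H" for h
    proof -
      have Qge: "(a h + y * h N) + ip N e h - 2 * sq_norm N h \<le> Q y e" for y
        unfolding Q_def using H \<open>h \<in> H\<close> by (intro Max_ge) auto
      then have "(1 - \<theta>) * ((a h + x * h N) + ip N e h - 2 * sq_norm N h)
          + \<theta> * ((a h + (-x) * h N) + ip N e h - 2 * sq_norm N h)
          \<le> (1 - \<theta>) * Q x e + \<theta> * Q (-x) e"
        using \<open>\<theta> \<in> _\<close> by (intro add_mono mult_left_mono Qge) auto
      moreover have "2 * \<theta> * (x * h N) - 2 * (h N)\<^sup>2 \<le> \<theta>\<^sup>2 / 2"
      proof -
        have "0 \<le> (\<theta> - 2 * (x * h N))\<^sup>2 / 2" by simp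
        also have "(\<theta> - 2 * (x * h N))\<^sup>2 / 2 = \<theta>\<^sup>2/2 - 2 * \<theta> * (x * h N) + 2 * (h N)\<^sup>2"
          using \<open>x = 1 \<or> x = -1\<close> by (auto simp: power2_eq_square field_simps)
        finally show ?thesis by simp
      qed
      ultimately show ?thesis
        by (simp add: ip_upd_Suc sq_norm_def algebra_simps)
    qed
    then show ?thesis unfolding QQ_def using H by (subst Max_le_iff) auto
  qed
  have half: "avg N (\<lambda>e. exp (QQ (e(N := x)))) \<le> exp ((1 - \<theta>) * w x + \<theta> * w (-x) + \<theta>\<^sup>2 / 2)"
    if "\<theta> \<in> {0..1}" "x = 1 \<or> x = -1" for \<theta> x
  proof -
    have "avg N (\<lambda>e. exp (QQ (e(N := x))))
        \<le> avg N (\<lambda>e. exp (\<theta>\<^sup>2 / 2) * exp ((1 - \<theta>) * Q x e + \<theta> * Q (-x) e))"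
      using interp[OF that] by (intro avg_mono) (simp add: exp_add[symmetric] add.commute)
    also have "\<dots> \<le> exp (\<theta>\<^sup>2 / 2) * exp ((1 - \<theta>) * w x + \<theta> * w (-x))"
      unfolding avg_cmult using that IH by (intro mult_left_mono avg_exp_Hoelder) auto
    finally show ?thesis by (simp add: exp_add[symmetric] add.commute)
  qed
  have final: "(avg N (\<lambda>e. exp (QQ (e(N := x)))) + avg N (\<lambda>e. exp (QQ (e(N := -x)))))
      * (exp (- w x) + exp (- w (-x))) \<le> 4"
    if le: "w (-x) \<le> w x" and x: "x = 1 \<or> x = -1" for x
  proof -
    obtain \<theta> where \<theta>: "\<theta> \<in> {0..1}"
      "(exp ((1 - \<theta>) * w x + \<theta> * w (-x) + \<theta>\<^sup>2 / 2) + exp (w (-x))) * (exp (- w x) + exp (- w (-x))) \<le> 4"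
      using two_point_ineq[OF le] by auto
    have "avg N (\<lambda>e. exp (QQ (e(N := -x)))) \<le> exp (w (-x))"
      using half[of 0 "-x"] x by auto
    then have "(avg N (\<lambda>e. exp (QQ (e(N := x)))) + avg N (\<lambda>e. exp (QQ (e(N := -x)))))
      * (exp (- w x) + exp (- w (-x)))
      \<le> (exp ((1 - \<theta>) * w x + \<theta> * w (-x) + \<theta>\<^sup>2 / 2) + exp (w (-x))) * (exp (- w x) + exp (- w (-x)))"
      using half[OF \<theta>(1) x] by (intro mult_right_mono add_mono) (auto intro: add_nonneg_nonneg)
    with \<theta>(2) show ?thesis by linarith
  qed
  have "(avg N (\<lambda>e. exp (QQ (e(N := 1)))) + avg N (\<lambda>e. exp (QQ (e(N := -1)))))
      * (exp (- w 1) + exp (- w (-1))) \<le> 4"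
    using final[of 1] final[of "-1"] by (cases "w (-1) \<le> w 1") (auto simp: add.commute)
  moreover have e1: "avg (Suc N) (\<lambda>e. exp (- (MAX h\<in>H. a h + ip (Suc N) e h)))
      = (exp (- w 1) + exp (- w (-1))) / 2"
    unfolding avg_Suc expw[symmetric] F_def ip_upd_Suc by (simp add: algebra_simps)
  moreover have e2: "avg (Suc N) (\<lambda>e. exp (QQ e))
      = (avg N (\<lambda>e. exp (QQ (e(N := 1)))) + avg N (\<lambda>e. exp (QQ (e(N := -1))))) / 2"
    by (rule avg_Suc)
  ultimately show ?case unfolding QQ_def[symmetric] e1 e2 by simp
qed

text \<open>
  Concentration below the mean, with a variance proxy that only sees the Euclidean norms. The
  penalty in the infimum convolution inequality is at most \<open>2 \<kappa>\<^sup>2 \<sigma>\<^sup>2\<close> after scaling by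
  \<open>\<kappa>\<close>, and Jensen's inequality bounds the remaining exponential moment from below.
\<close>

lemma sup_ip_lower_tail:
  assumes H: "finite H" "H \<noteq> {}" and \<sigma>: "\<And>h. h \<in> H \<Longrightarrow> sq_norm N h \<le> \<sigma>\<^sup>2" and \<kappa>: "0 \<le> \<kappa>"
  shows "avg N (\<lambda>e. exp (\<kappa> * (avg N (sup_ip N H) - sup_ip N H e))) \<le> exp (2 * \<kappa>\<^sup>2 * \<sigma>\<^sup>2)"
proof -
  define g where "g h = (\<lambda>i. \<kappa> * h i)" for h :: "nat \<Rightarrow> real"
  have ipg: "ip N e (g h) = \<kappa> * ip N e h" for e h
    by (simp add: ip_def g_def sum_distrib_left mult_ac)
  have sq: "sq_norm N (g h) = \<kappa>\<^sup>2 * sq_norm N h" for h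
    by (simp add: sq_norm_def g_def sum_distrib_left power_mult_distrib)
  have Mx: "(MAX h\<in>g ` H. ip N e h) = \<kappa> * sup_ip N H e" for e
  proof -
    have "\<kappa> * Max (ip N e ` H) = Max ((*) \<kappa> ` (ip N e ` H))"
      using H \<kappa> by (intro mono_Max_commute) (auto simp: mono_def mult_left_mono)
    then show ?thesis by (simp add: sup_ip_def image_image ipg)
  qed
  have low: "\<kappa> * sup_ip N H e - 2 * \<kappa>\<^sup>2 * \<sigma>\<^sup>2 \<le> (MAX h\<in>g ` H. 0 + ip N e h - 2 * sq_norm N h)" for e
  proof -
    obtain h where h: "h \<in> H" "sup_ip N H e = ip N e h" using sup_ip_attained[OF H] by blast
    have "\<kappa> * sup_ip N H e - 2 * \<kappa>\<^sup>2 * \<sigma>\<^sup>2 \<le> 0 + ip N e (g h) - 2 * sq_norm N (g h)"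
      using mult_left_mono[OF \<sigma>[OF h(1)], of "\<kappa>\<^sup>2"] by (simp add: h ipg sq)
    also have "\<dots> \<le> (MAX h\<in>g ` H. 0 + ip N e h - 2 * sq_norm N h)"
      using H h by (intro Max_ge) auto
    finally show ?thesis .
  qed
  have prod: "avg N (\<lambda>e. exp (MAX h\<in>g ` H. 0 + ip N e h - 2 * sq_norm N h))
       * avg N (\<lambda>e. exp (- (\<kappa> * sup_ip N H e))) \<le> 1"
    using inf_convolution_sup[of "g ` H" N "\<lambda>_. 0"] H by (simp add: Mx)
  have "exp (\<kappa> * avg N (sup_ip N H) - 2 * \<kappa>\<^sup>2 * \<sigma>\<^sup>2)
      = exp (avg N (\<lambda>e. \<kappa> * sup_ip N H e - 2 * \<kappa>\<^sup>2 * \<sigma>\<^sup>2))"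
    by (simp add: avg_diff avg_cmult)
  also have "\<dots> \<le> avg N (\<lambda>e. exp (\<kappa> * sup_ip N H e - 2 * \<kappa>\<^sup>2 * \<sigma>\<^sup>2))"
    by (rule exp_avg_le)
  also have "\<dots> \<le> avg N (\<lambda>e. exp (MAX h\<in>g ` H. 0 + ip N e h - 2 * sq_norm N h))"
    using low by (intro avg_mono) simp
  finally have "exp (\<kappa> * avg N (sup_ip N H) - 2 * \<kappa>\<^sup>2 * \<sigma>\<^sup>2) * avg N (\<lambda>e. exp (- (\<kappa> * sup_ip N H e)))
      \<le> avg N (\<lambda>e. exp (MAX h\<in>g ` H. 0 + ip N e h - 2 * sq_norm N h))
       * avg N (\<lambda>e. exp (- (\<kappa> * sup_ip N H e)))"
    by (intro mult_right_mono avg_nonneg) auto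
  also note prod
  finally have "avg N (\<lambda>e. exp (\<kappa> * avg N (sup_ip N H)) * exp (- (\<kappa> * sup_ip N H e))) \<le> exp (2 * \<kappa>\<^sup>2 * \<sigma>\<^sup>2)"
    unfolding avg_cmult by (simp add: exp_diff field_simps)
  then show ?thesis by (simp add: exp_add[symmetric] right_diff_distrib)
qed

section \<open>Sudakov minoration and the growth condition\<close>

lemma sq_norm_nonneg [simp]: "0 \<le> sq_norm N t"
  by (simp add: sq_norm_def sum_nonneg)

lemma dist_2_eq_sqrt: "dist_2 N s t = sqrt (sq_norm N (\<lambda>i. s i - t i))"
  by (simp add: dist_2_def L2_set_def sq_norm_def)

lemma dist_2_sq: "(dist_2 N s t)\<^sup>2 = sq_norm N (\<lambda>i. s i - t i)"
  by (simp add: dist_2_eq_sqrt)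

text \<open>
  Second and fourth moments, by induction on the dimension: odd powers of the last sign cancel.
\<close>

lemma avg_ip_power4: "avg N (\<lambda>e. (ip N e v) ^ 4) \<le> 3 * (sq_norm N v)\<^sup>2"
  and avg_ip_power2: "avg N (\<lambda>e. (ip N e v)\<^sup>2) = sq_norm N v"
proof (induction N)
  case 0
  show "avg 0 (\<lambda>e. (ip 0 e v) ^ 4) \<le> 3 * (sq_norm 0 v)\<^sup>2"
    and "avg 0 (\<lambda>e. (ip 0 e v)\<^sup>2) = sq_norm 0 v"
    by (simp_all add: avg_0 ip_def sq_norm_def)
next
  case (Suc N)
  have "avg (Suc N) (\<lambda>e. (ip (Suc N) e v)\<^sup>2)
      = avg N (\<lambda>e. ((ip N e v + v N)\<^sup>2 + (ip N e v - v N)\<^sup>2) / 2)"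
    unfolding avg_Suc avg_add[symmetric] ip_upd_Suc
    using avg_cmult[of N "1/2"] by (simp add: avg_add)
  also have "\<dots> = avg N (\<lambda>e. (ip N e v)\<^sup>2 + (v N)\<^sup>2)"
    by (intro avg_cong) (simp add: power2_eq_square algebra_simps)
  finally show 2: "avg (Suc N) (\<lambda>e. (ip (Suc N) e v)\<^sup>2) = sq_norm (Suc N) v"
    using Suc.IH(2) by (simp add: avg_add sq_norm_def)
  have "avg (Suc N) (\<lambda>e. (ip (Suc N) e v)^4)
      = avg N (\<lambda>e. ((ip N e v + v N)^4 + (ip N e v - v N)^4) / 2)"
    unfolding avg_Suc avg_add[symmetric] ip_upd_Suc
    using avg_cmult[of N "1/2"] by (simp add: avg_add)
  also have "\<dots> = avg N (\<lambda>e. (ip N e v)^4 + 6 * (v N)\<^sup>2 * (ip N e v)\<^sup>2 + (v N)^4)"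
    by (intro avg_cong) (simp add: power4_eq_xxxx power2_eq_square algebra_simps)
  also have "\<dots> \<le> 3 * (sq_norm N v)\<^sup>2 + 6 * (v N)\<^sup>2 * sq_norm N v + 3 * ((v N)\<^sup>2)\<^sup>2"
  proof -
    have "(v N) ^ 4 \<le> 3 * ((v N)\<^sup>2)\<^sup>2" by simp
    then show ?thesis unfolding avg_add avg_cmult avg_const Suc.IH(2) using Suc.IH(1) by linarith
  qed
  also have "\<dots> = 3 * (sq_norm (Suc N) v)\<^sup>2"
    by (simp add: sq_norm_def power2_eq_square algebra_simps)
  finally show "avg (Suc N) (\<lambda>e. (ip (Suc N) e v)^4) \<le> 3 * (sq_norm (Suc N) v)\<^sup>2" .
qed

text \<open>
  Khinchine's inequality between the first and the second moment. The polynomial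
  \<open>4/5 y\<^sup>2 - y\<^sup>4/10\<close> lies below \<open>y\<close> for \<open>y \<ge> 0\<close>; its mean is at least \<open>4/5 - 3/10\<close> when
  \<open>y\<close> has second moment 1 and fourth moment at most 3.
\<close>

lemma khinchine: "sqrt (sq_norm N v) \<le> 2 * avg N (\<lambda>e. \<bar>ip N e v\<bar>)"
proof (cases "sq_norm N v = 0")
  case True
  then show ?thesis by (simp add: avg_nonneg)
next
  case False
  define r where "r = sqrt (sq_norm N v)"
  have "0 < sq_norm N v" using False sq_norm_nonneg[of N v] by linarith
  then have r: "r > 0" "r\<^sup>2 = sq_norm N v" by (auto simp: r_def)
  \<comment> \<open>Dividing by \<open>y\<close> leaves a cubic, which is nonnegative because it is bounded below by its
    tangent at \<open>5/3\<close>.\<close>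
  have poly: "(4/5) * y\<^sup>2 - y ^ 4 / 10 \<le> y" if "0 \<le> y" for y :: real
  proof -
    have "0 \<le> (y - 5/3)\<^sup>2 * (y + 10/3)" using that by simp
    also have "(y - 5/3)\<^sup>2 * (y + 10/3) = y ^ 3 - (25/3) * y + 250/27"
      by (simp add: power2_eq_square power3_eq_cube field_simps)
    finally have "(4/5) * y - y ^ 3 / 10 \<le> 1" using that by simp
    then have "y * ((4/5) * y - y ^ 3 / 10) \<le> y * 1" using that by (intro mult_left_mono)
    then show ?thesis by (simp add: power2_eq_square power3_eq_cube power4_eq_xxxx algebra_simps)
  qed
  have "(4/5) * (ip N e v)\<^sup>2 * (1/r\<^sup>2) - (ip N e v)^4 * (1 / r^4) / 10 \<le> \<bar>ip N e v\<bar> / r" for e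
    using poly[of "\<bar>ip N e v\<bar> / r"] r(1) by (simp add: power_divide)
  then have "avg N (\<lambda>e. (4/5 * (1/r\<^sup>2)) * (ip N e v)\<^sup>2 - (1 / (10 * r^4)) * (ip N e v)^4)
      \<le> avg N (\<lambda>e. (1/r) * \<bar>ip N e v\<bar>)"
    by (intro avg_mono) (simp add: mult.commute)
  then have "(4/5 * (1/r\<^sup>2)) * sq_norm N v - (1 / (10 * r^4)) * avg N (\<lambda>e. (ip N e v)^4)
      \<le> (1/r) * avg N (\<lambda>e. \<bar>ip N e v\<bar>)"
    by (simp only: avg_diff avg_cmult avg_ip_power2)
  moreover have "(1 / (10 * r^4)) * avg N (\<lambda>e. (ip N e v)^4) \<le> (1 / (10 * r^4)) * (3 * (r\<^sup>2)\<^sup>2)"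
    using avg_ip_power4[of N v] r by (intro mult_left_mono) auto
  moreover have "(1 / (10 * r^4)) * (3 * (r\<^sup>2)\<^sup>2) = 3/10" "(4/5 * (1/r\<^sup>2)) * sq_norm N v = 4/5"
    using r(1) unfolding r(2)[symmetric] by simp_all
  ultimately have "1/2 \<le> (1/r) * avg N (\<lambda>e. \<bar>ip N e v\<bar>)" by linarith
  then show ?thesis using r(1) unfolding r_def[symmetric] by (simp add: field_simps)
qed

text \<open>
  The derivative of \<open>- exp (- 2 s t)\<close> in \<open>t\<close> is at least \<open>2 s exp (-2)\<close> where \<open>\<bar>s t\<bar> \<le> 1\<close>.
\<close>

lemma exp_difference_lower:
  assumes "\<bar>s * x\<bar> \<le> (1::real)" "\<bar>s * y\<bar> \<le> 1" "0 \<le> s"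
  shows "2 * s * exp (-2) * (x - y)\<^sup>2 \<le> (x - y) * (exp (- 2 * s * y) - exp (- 2 * s * x))"
proof -
  have *: "2 * s * exp (-2) * (x - y) \<le> exp (- 2 * s * y) - exp (- 2 * s * x)"
    if "\<bar>s * x\<bar> \<le> (1::real)" "\<bar>s * y\<bar> \<le> 1" "y \<le> x" for x y
  proof -
    have "exp (- 2 * s * x) * (1 + 2 * s * (x - y)) \<le> exp (- 2 * s * x) * exp (2 * s * (x - y))"
      by (intro mult_left_mono exp_ge_add_one_self) auto
    also have "\<dots> = exp (- 2 * s * y)" by (simp add: exp_add[symmetric] algebra_simps)
    finally have "exp (- 2 * s * x) * (2 * s * (x - y)) \<le> exp (- 2 * s * y) - exp (- 2 * s * x)"
      by (simp only: distrib_left mult_1_right)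
    moreover have "exp (-2) * (2 * s * (x - y)) \<le> exp (-2 * s * x) * (2 * s * (x - y))"
      using that assms(3) by (intro mult_right_mono) (auto simp: abs_le_iff)
    moreover have "exp (-2) * (2 * s * (x - y)) = 2 * s * exp (-2) * (x - y)"
      by (simp only: mult_ac)
    ultimately show ?thesis by linarith
  qed
  show ?thesis
  proof (cases "y \<le> x")
    case True
    then have "(x - y) * (2 * s * exp (-2) * (x - y)) \<le> (x - y) * (exp (- 2 * s * y) - exp (- 2 * s * x))"
      using *[OF assms(1,2)] by (intro mult_left_mono) auto
    then show ?thesis by (simp add: power2_eq_square mult_ac)
  next
    case False
    then have "(y - x) * (2 * s * exp (-2) * (y - x)) \<le> (y - x) * (exp (- 2 * s * x) - exp (- 2 * s * y))"
      using *[OF assms(2,1)] by (intro mult_left_mono) auto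
    then show ?thesis by (simp add: power2_eq_square algebra_simps)
  qed
qed

text \<open>
  The weights \<open>w'\<close> arise from \<open>w\<close> by lowering the field in direction \<open>y\<close>. The derivative of a
  Gibbs mean with respect to the field is the variance; since \<open>\<bar>s y\<bar> \<le> 1\<close>, the Gibbs measures
  along the way are comparable up to constants, and the finite difference is bounded below by the
  variance at the starting point (written as a double sum over pairs).
\<close>

lemma gibbs_mean_response:
  fixes w y :: "'a \<Rightarrow> real"
  assumes X: "finite X" "X \<noteq> {}" and w: "\<And>x. x \<in> X \<Longrightarrow> 0 < w x"
    and y: "\<And>x. x \<in> X \<Longrightarrow> \<bar>s * y x\<bar> \<le> 1" and s: "0 \<le> s"
  defines "W \<equiv> (\<Sum>x\<in>X. w x)"
  defines "w' \<equiv> \<lambda>x. w x * exp (- 2 * s * y x)"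
  shows "s * exp (-4) * (\<Sum>x\<in>X. \<Sum>z\<in>X. (w x / W) * (w z / W) * (y x - y z)\<^sup>2)
    \<le> (\<Sum>x\<in>X. w x * y x) / W - (\<Sum>x\<in>X. w' x * y x) / (\<Sum>x\<in>X. w' x)"
proof -
  define W' where "W' = (\<Sum>x\<in>X. w' x)"
  have w0: "0 \<le> w x" if "x \<in> X" for x using w[OF that] by simp
  have W: "0 < W" unfolding W_def using X w by (intro sum_pos) auto
  have W': "0 < W'" unfolding W'_def using X w by (intro sum_pos) (auto simp: w'_def)
  have W'le: "W' \<le> exp 2 * W"
    unfolding W'_def W_def sum_distrib_left
  proof (rule sum_mono)
    fix x assume "x \<in> X"
    then have "exp (- 2 * s * y x) \<le> exp 2" using y[of x] by (auto simp: abs_le_iff)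
    then show "w' x \<le> exp 2 * w x" using w[OF \<open>x \<in> X\<close>] by (simp add: w'_def mult.commute)
  qed
  have "2 * ((\<Sum>x\<in>X. w x * y x) * W' - (\<Sum>x\<in>X. w' x * y x) * W)
      = (\<Sum>x\<in>X. \<Sum>z\<in>X. w x * y x * w' z) - (\<Sum>x\<in>X. \<Sum>z\<in>X. w' x * y x * w z)
      + ((\<Sum>x\<in>X. \<Sum>z\<in>X. w z * y z * w' x) - (\<Sum>x\<in>X. \<Sum>z\<in>X. w' z * y z * w x))"
  proof -
    have "(\<Sum>x\<in>X. \<Sum>z\<in>X. w z * y z * w' x) = (\<Sum>x\<in>X. \<Sum>z\<in>X. w x * y x * w' z)"
      "(\<Sum>x\<in>X. \<Sum>z\<in>X. w' z * y z * w x) = (\<Sum>x\<in>X. \<Sum>z\<in>X. w' x * y x * w z)"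
      by (rule sum.swap)+
    then show ?thesis
      unfolding W'_def W_def by (simp add: sum_product)
  qed
  also have "\<dots> = (\<Sum>x\<in>X. \<Sum>z\<in>X. w x * w z * ((y x - y z) * (exp (- 2 * s * y z) - exp (- 2 * s * y x))))"
    by (simp add: sum_subtractf[symmetric] sum.distrib[symmetric] w'_def algebra_simps)
  also have "\<dots> \<ge> (\<Sum>x\<in>X. \<Sum>z\<in>X. w x * w z * (2 * s * exp (-2) * (y x - y z)\<^sup>2))"
    using y s w by (intro sum_mono mult_left_mono exp_difference_lower mult_nonneg_nonneg w0) auto
  finally have "(\<Sum>x\<in>X. \<Sum>z\<in>X. w x * w z * (2 * s * exp (-2) * (y x - y z)\<^sup>2))
      \<le> 2 * ((\<Sum>x\<in>X. w x * y x) * W' - (\<Sum>x\<in>X. w' x * y x) * W)" .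
  also have "(\<Sum>x\<in>X. \<Sum>z\<in>X. w x * w z * (2 * s * exp (-2) * (y x - y z)\<^sup>2))
      = 2 * (s * exp (-2) * (\<Sum>x\<in>X. \<Sum>z\<in>X. w x * w z * (y x - y z)\<^sup>2))"
    by (simp add: sum_distrib_left mult_ac)
  finally have main: "s * exp (-2) * (\<Sum>x\<in>X. \<Sum>z\<in>X. w x * w z * (y x - y z)\<^sup>2)
      \<le> (\<Sum>x\<in>X. w x * y x) * W' - (\<Sum>x\<in>X. w' x * y x) * W" by simp
  define V where "V = (\<Sum>x\<in>X. \<Sum>z\<in>X. w x * w z * (y x - y z)\<^sup>2)"
  have V: "0 \<le> V" unfolding V_def using w0 by (intro sum_nonneg mult_nonneg_nonneg) auto
  have "(\<Sum>x\<in>X. \<Sum>z\<in>X. (w x / W) * (w z / W) * (y x - y z)\<^sup>2) = V / W\<^sup>2"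
    by (simp add: V_def sum_divide_distrib power2_eq_square)
  then have "s * exp (-4) * (\<Sum>x\<in>X. \<Sum>z\<in>X. (w x / W) * (w z / W) * (y x - y z)\<^sup>2)
      = s * exp (-2) * V / (W * (exp 2 * W))"
    by (simp add: power2_eq_square exp_minus field_simps exp_add[symmetric])
  also have "\<dots> \<le> s * exp (-2) * V / (W * W')"
    using W W' W'le V s by (intro divide_left_mono mult_left_mono) auto
  also have "\<dots> \<le> ((\<Sum>x\<in>X. w x * y x) * W' - (\<Sum>x\<in>X. w' x * y x) * W) / (W * W')"
    using main W W' unfolding V_def by (intro divide_right_mono) auto
  also have "\<dots> = (\<Sum>x\<in>X. w x * y x) / W - (\<Sum>x\<in>X. w' x * y x) / W'"
    using W W' by (simp add: field_simps)
  finally show ?thesis unfolding W'_def .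
qed

text \<open>
  The mean energy of the Gibbs measure \<open>p e\<close> at inverse temperature \<open>s\<close> is at most the supremum.
  Integrating by parts in each sign bounds it below by a multiple of the Gibbs variances of the
  coordinates, whose sum is at least \<open>a\<^sup>2 / 2\<close> times the probability that two independent samples from \<open>p e\<close>
  differ.
\<close>

lemma gibbs_energy_lower:
  assumes X: "finite X" "X \<noteq> {}" and s: "0 \<le> s"
    and bd: "\<And>x i. x \<in> X \<Longrightarrow> i < N \<Longrightarrow> \<bar>s * x i\<bar> \<le> 1"
    and sep: "\<And>x z. x \<in> X \<Longrightarrow> z \<in> X \<Longrightarrow> x \<noteq> z \<Longrightarrow> a\<^sup>2 \<le> sq_norm N (\<lambda>i. x i - z i)"
  defines "p \<equiv> \<lambda>e x. exp (s * ip N e x) / (\<Sum>z\<in>X. exp (s * ip N e z))"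
  shows "s * exp (-4) * a\<^sup>2 / 2 * avg N (\<lambda>e. 1 - (\<Sum>x\<in>X. (p e x)\<^sup>2)) \<le> avg N (sup_ip N X)"
proof -
  define w where "w e x = exp (s * ip N e x)" for e x
  define W where "W e = (\<Sum>x\<in>X. w e x)" for e
  have wpos: "0 < w e x" for e x by (simp add: w_def)
  have Wpos: "0 < W e" for e unfolding W_def using X wpos by (intro sum_pos) auto
  have p: "p e x = w e x / W e" for e x by (simp add: p_def w_def W_def)
  have p_nonneg: "0 \<le> p e x" for e x unfolding p using wpos[of e x] Wpos[of e] by simp
  have p_sum: "(\<Sum>x\<in>X. p e x) = 1" for e
    using Wpos[of e] unfolding p by (simp add: sum_divide_distrib[symmetric] W_def[symmetric])
  define m where "m i e = (\<Sum>x\<in>X. p e x * x i)" for i e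
  define D where "D i e = (\<Sum>x\<in>X. \<Sum>z\<in>X. p e x * p e z * (x i - z i)\<^sup>2)" for i e
  have pt: "s * exp (-4) * D i e \<le> e i * (m i e - m i (e(i := - e i)))"
    if i: "i < N" and e: "e \<in> signs N" for i e
  proof -
    have ei: "e i = 1 \<or> e i = -1" using i e by (auto simp: signs_iff)
    have ip_flip: "ip N (e(i := - e i)) x = ip N e x - 2 * (e i * x i)" for x
      using i by (rule ip_flip_sign)
    define w' where "w' x = w e x * exp (- 2 * s * (e i * x i))" for x
    have w': "w (e(i := - e i)) x = w' x" for x
      by (simp add: w'_def w_def ip_flip exp_add[symmetric] algebra_simps)
    have "s * exp (-4) * (\<Sum>x\<in>X. \<Sum>z\<in>X. (w e x / W e) * (w e z / W e) * (e i * x i - e i * z i)\<^sup>2)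
        \<le> (\<Sum>x\<in>X. w e x * (e i * x i)) / W e - (\<Sum>x\<in>X. w' x * (e i * x i)) / (\<Sum>x\<in>X. w' x)"
      unfolding W_def w'_def
    proof (rule gibbs_mean_response[OF X wpos _ s])
      fix x assume "x \<in> X"
      then show "\<bar>s * (e i * x i)\<bar> \<le> 1" using bd[of x i] i ei by (auto simp: abs_mult)
    qed
    moreover have "(e i * x i - e i * z i)\<^sup>2 = (x i - z i)\<^sup>2" for x z
      using ei by (auto simp: power2_eq_square algebra_simps)
    moreover have "(\<Sum>x\<in>X. w e x * (e i * x i)) / W e = e i * m i e"
      by (simp add: m_def p sum_distrib_left sum_divide_distrib mult_ac)
    moreover have "(\<Sum>x\<in>X. w' x * (e i * x i)) / (\<Sum>x\<in>X. w' x) = e i * m i (e(i := - e i))"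
      by (simp add: m_def p W_def w' sum_distrib_left sum_divide_distrib mult_ac)
    ultimately show ?thesis by (simp add: D_def p right_diff_distrib)
  qed
  have coord: "s * exp (-4) / 2 * avg N (D i) \<le> avg N (\<lambda>e. e i * m i e)" if "i < N" for i
  proof -
    have "avg N (\<lambda>e. s * exp (-4) * D i e) \<le> avg N (\<lambda>e. e i * (m i e - m i (e(i := - e i))))"
      by (intro avg_mono pt that)
    then show ?thesis
      using avg_sign_times[OF that, of "m i"] by (simp only: avg_cmult) simp
  qed
  have sumD: "a\<^sup>2 * (1 - (\<Sum>x\<in>X. (p e x)\<^sup>2)) \<le> (\<Sum>i<N. D i e)" for e
  proof -
    have "1 = (\<Sum>x\<in>X. p e x) * (\<Sum>z\<in>X. p e z)" by (simp add: p_sum)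
    also have "\<dots> = (\<Sum>x\<in>X. \<Sum>z\<in>X. p e x * p e z)" by (rule sum_product)
    also have "\<dots> = (\<Sum>x\<in>X. (p e x)\<^sup>2 + (\<Sum>z\<in>X-{x}. p e x * p e z))"
      using X by (intro sum.cong refl) (simp add: sum.remove power2_eq_square)
    finally have "1 - (\<Sum>x\<in>X. (p e x)\<^sup>2) = (\<Sum>x\<in>X. \<Sum>z\<in>X-{x}. p e x * p e z)"
      by (simp add: sum.distrib)
    then have "a\<^sup>2 * (1 - (\<Sum>x\<in>X. (p e x)\<^sup>2)) = (\<Sum>x\<in>X. \<Sum>z\<in>X-{x}. p e x * p e z * a\<^sup>2)"
      by (simp add: sum_distrib_left mult_ac)
    also have "\<dots> \<le> (\<Sum>x\<in>X. \<Sum>z\<in>X-{x}. p e x * p e z * sq_norm N (\<lambda>i. x i - z i))"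
      using sep p_nonneg by (intro sum_mono mult_left_mono) auto
    also have "\<dots> \<le> (\<Sum>x\<in>X. \<Sum>z\<in>X. p e x * p e z * sq_norm N (\<lambda>i. x i - z i))"
      using X p_nonneg by (intro sum_mono sum_mono2) auto
    also have "\<dots> = (\<Sum>x\<in>X. \<Sum>z\<in>X. \<Sum>i<N. p e x * p e z * (x i - z i)\<^sup>2)"
      by (simp add: sq_norm_def sum_distrib_left)
    also have "\<dots> = (\<Sum>x\<in>X. \<Sum>i<N. \<Sum>z\<in>X. p e x * p e z * (x i - z i)\<^sup>2)"
      by (intro sum.cong refl sum.swap)
    also have "\<dots> = (\<Sum>i<N. D i e)" unfolding D_def by (rule sum.swap)
    finally show ?thesis .
  qed
  have "s * exp (-4) * a\<^sup>2 / 2 * avg N (\<lambda>e. 1 - (\<Sum>x\<in>X. (p e x)\<^sup>2))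
      = s * exp (-4) / 2 * avg N (\<lambda>e. a\<^sup>2 * (1 - (\<Sum>x\<in>X. (p e x)\<^sup>2)))"
    by (simp only: avg_cmult) simp
  also have "\<dots> \<le> s * exp (-4) / 2 * avg N (\<lambda>e. \<Sum>i<N. D i e)"
    using s by (intro mult_left_mono avg_mono sumD) auto
  also have "\<dots> \<le> (\<Sum>i<N. avg N (\<lambda>e. e i * m i e))"
    unfolding avg_sum sum_distrib_left by (intro sum_mono coord) auto
  also have "\<dots> = avg N (\<lambda>e. \<Sum>x\<in>X. p e x * ip N e x)"
    unfolding avg_sum[symmetric] m_def ip_def sum_distrib_left
    by (subst sum.swap) (simp add: mult_ac)
  also have "\<dots> \<le> avg N (sup_ip N X)"
  proof (rule avg_mono)
    fix e
    have "(\<Sum>x\<in>X. p e x * ip N e x) \<le> (\<Sum>x\<in>X. p e x * sup_ip N X e)"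
      using X p_nonneg by (intro sum_mono mult_left_mono sup_ip_ge) auto
    then show "(\<Sum>x\<in>X. p e x * ip N e x) \<le> sup_ip N X e"
      by (simp add: sum_distrib_right[symmetric] p_sum)
  qed
  finally show ?thesis .
qed

text \<open>
  Sudakov minoration. Take inverse temperature \<open>s = sqrt L / a\<close> with \<open>L = ln (card X)\<close>. By Jensen's
  inequality the mean log-partition function is at least \<open>L\<close>; on the other hand it is
  \<open>s\<close> times the supremum plus \<open>ln (1 / q)\<close>, where \<open>q\<close> is the largest Gibbs weight. Either the Gibbs
  measure is concentrated, \<open>q \<ge> 1/2\<close>, so that \<open>ln (1 / q)\<close> is negligible and the supremum is at
  least of order \<open>L / s\<close>; or it is spread out, and then lemma \<open>gibbs_energy_lower\<close> makes the supremum at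
  least of order \<open>s a\<^sup>2\<close>. Both orders are \<open>a sqrt L\<close>. The two cases are combined through
  \<open>ln (1 / q) \<le> ln 2 + 2 L (1 - q)\<close>.
\<close>

lemma sudakov_bounded:
  assumes X: "finite X" "2 \<le> card X" and a: "0 < a"
    and bd: "\<And>x i. x \<in> X \<Longrightarrow> i < N \<Longrightarrow> sqrt (ln (card X)) * \<bar>x i\<bar> \<le> a"
    and sep: "\<And>x z. x \<in> X \<Longrightarrow> z \<in> X \<Longrightarrow> x \<noteq> z \<Longrightarrow> a \<le> dist_2 N x z"
  shows "a * (ln (card X) - ln 2) \<le> (1 + 4 * exp 4) * sqrt (ln (card X)) * avg N (sup_ip N X)"
proof -
  define L where "L = ln (real (card X))"
  define s where "s = sqrt L / a"
  have L: "0 < L" using X by (simp add: L_def)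
  have s: "0 < s" using L a by (simp add: s_def)
  have s2: "s\<^sup>2 * a\<^sup>2 = L" using L a by (simp add: s_def power_divide)
  have X0: "X \<noteq> {}" using X by auto
  define p where "p e x = exp (s * ip N e x) / (\<Sum>z\<in>X. exp (s * ip N e z))" for e x
  define P where "P = avg N (\<lambda>e. 1 - (\<Sum>x\<in>X. (p e x)\<^sup>2))"
  define E where "E = avg N (sup_ip N X)"
  have en: "s * exp (-4) * a\<^sup>2 / 2 * P \<le> E"
    unfolding P_def p_def E_def
  proof (rule gibbs_energy_lower[OF X(1) X0])
    show "0 \<le> s" using s by simp
    show "\<bar>s * x i\<bar> \<le> 1" if "x \<in> X" "i < N" for x i
      using bd[OF that] a L by (simp add: s_def abs_mult L_def field_simps)
    show "a\<^sup>2 \<le> sq_norm N (\<lambda>i. x i - z i)" if "x \<in> X" "z \<in> X" "x \<noteq> z" for x z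
      using power_mono[OF sep[OF that], of 2] a by (simp add: dist_2_sq)
  qed
  have pt: "L + (\<Sum>x\<in>X. s / card X * ip N e x) \<le> s * sup_ip N X e + ln 2 + 2 * L * (1 - (\<Sum>x\<in>X. (p e x)\<^sup>2))" for e
  proof -
    define W where "W = (\<Sum>z\<in>X. exp (s * ip N e z))"
    have Wpos: "0 < W" unfolding W_def using X X0 by (intro sum_pos) auto
    have p_nonneg: "0 \<le> p e x" for x using Wpos by (simp add: p_def W_def[symmetric])
    have p_sum: "(\<Sum>x\<in>X. p e x) = 1"
      using Wpos unfolding p_def W_def[symmetric] by (simp add: sum_divide_distrib[symmetric] W_def[symmetric])
    obtain t where t: "t \<in> X" "sup_ip N X e = ip N e t" using sup_ip_attained[OF X(1) X0] by blast
    define q where "q = p e t"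
    have q: "0 < q" using Wpos by (simp add: q_def p_def W_def[symmetric])
    have pq: "p e x \<le> q" if "x \<in> X" for x
      unfolding q_def p_def W_def[symmetric] using Wpos s sup_ip_ge[OF X(1) that, of N e] t
      by (intro divide_right_mono) auto
    have q1: "q \<le> 1" unfolding p_sum[symmetric] q_def
      using X t p_nonneg by (intro member_le_sum) auto
    have qm: "1 \<le> card X * q"
    proof -
      have "(\<Sum>x\<in>X. p e x) \<le> (\<Sum>x\<in>X. q)" by (intro sum_mono pq)
      then show ?thesis by (simp add: p_sum)
    qed
    have sq: "(\<Sum>x\<in>X. (p e x)\<^sup>2) \<le> q"
    proof -
      have "(\<Sum>x\<in>X. (p e x)\<^sup>2) \<le> (\<Sum>x\<in>X. q * p e x)"
        unfolding power2_eq_square using pq p_nonneg by (intro sum_mono mult_right_mono) auto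
      then show ?thesis by (simp add: sum_distrib_left[symmetric] p_sum)
    qed
    have "ln (1 / q) \<le> ln 2 + 2 * L * (1 - q)"
    proof (cases "1/2 \<le> q")
      case True
      then have "ln (1 / q) \<le> ln 2" using q by (subst ln_le_cancel_iff) (auto simp: field_simps)
      moreover have "0 \<le> 2 * L * (1 - q)" using L q1 by simp
      ultimately show ?thesis by linarith
    next
      case False
      have "ln (1 / q) \<le> L" unfolding L_def using q qm X
        by (subst ln_le_cancel_iff) (auto simp: field_simps)
      moreover have "L * 1 \<le> L * (2 * (1 - q))" using False L by (intro mult_left_mono) auto
      moreover have "0 < ln (2::real)" by simp
      ultimately show ?thesis by linarith
    qed
    also have "\<dots> \<le> ln 2 + 2 * L * (1 - (\<Sum>x\<in>X. (p e x)\<^sup>2))"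
      using sq L by (intro add_left_mono mult_left_mono) auto
    finally have 1: "ln (1 / q) \<le> ln 2 + 2 * L * (1 - (\<Sum>x\<in>X. (p e x)\<^sup>2))" .
    have 2: "ln W = s * sup_ip N X e + ln (1 / q)"
      using Wpos by (simp add: q_def p_def W_def[symmetric] t ln_div)
    have 3: "L + (\<Sum>x\<in>X. s / card X * ip N e x) \<le> ln W"
    proof -
      define c where "c = (\<Sum>x\<in>X. s / card X * ip N e x)"
      have "card X * exp c = (\<Sum>x\<in>X. exp c * (1 + (s * ip N e x - c)))"
      proof -
        have "(\<Sum>x\<in>X. s * ip N e x) = card X * c"
          using X X0 by (simp add: c_def sum_distrib_left)
        then have "(\<Sum>x\<in>X. 1 + (s * ip N e x - c)) = card X"
          by (simp add: sum.distrib sum_subtractf)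
        then show ?thesis by (simp add: sum_distrib_left[symmetric])
      qed
      also have "\<dots> \<le> (\<Sum>x\<in>X. exp c * exp (s * ip N e x - c))"
        by (intro sum_mono mult_left_mono exp_ge_add_one_self) auto
      also have "\<dots> = W" by (simp add: W_def exp_add[symmetric])
      finally have "ln (card X * exp c) \<le> ln W" using Wpos X by (subst ln_le_cancel_iff) auto
      moreover have "ln (card X * exp c) = L + c" using X X0 by (simp add: L_def ln_mult)
      ultimately show ?thesis unfolding c_def[symmetric] by linarith
    qed
    have "ln W \<le> s * sup_ip N X e + (ln 2 + 2 * L * (1 - (\<Sum>x\<in>X. (p e x)\<^sup>2)))"
      unfolding 2 by (rule add_left_mono[OF 1])
    from order_trans[OF 3 this] show ?thesis by (simp only: add.assoc)
  qed
  have "L = avg N (\<lambda>e. L + (\<Sum>x\<in>X. s / card X * ip N e x))"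
  proof -
    have "avg N (\<lambda>e. \<Sum>x\<in>X. s / card X * ip N e x) = 0"
      unfolding avg_sum avg_cmult avg_ip by simp
    then show ?thesis by (simp only: avg_add avg_const)
  qed
  also have "\<dots> \<le> avg N (\<lambda>e. s * sup_ip N X e + ln 2 + 2 * L * (1 - (\<Sum>x\<in>X. (p e x)\<^sup>2)))"
    by (rule avg_mono, rule pt)
  also have "\<dots> = s * E + ln 2 + 2 * L * P"
    unfolding avg_add avg_cmult avg_const E_def P_def ..
  finally have "L \<le> s * E + ln 2 + 2 * L * P" .
  moreover have "2 * L * P \<le> 4 * exp 4 * s * E"
  proof -
    have "s * exp (-4) * a\<^sup>2 / 2 * P * (4 * exp 4 * s) \<le> E * (4 * exp 4 * s)"
      using en s by (intro mult_right_mono) auto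
    moreover have "s * c * a\<^sup>2 / 2 * P * (4 * d * s) = 2 * (s\<^sup>2 * a\<^sup>2) * P * (c * d)" for c d
      by (simp add: power2_eq_square)
    moreover have "exp (-4) * exp 4 = (1::real)" by (simp add: exp_minus)
    ultimately have "2 * L * P \<le> E * (4 * exp 4 * s)" by (simp only: s2 mult_1_right)
    then show ?thesis by (simp only: mult_ac)
  qed
  moreover have "s * E + 4 * exp 4 * s * E = (1 + 4 * exp 4) * s * E"
    by (simp only: distrib_right mult_1_left)
  ultimately have "L - ln 2 \<le> (1 + 4 * exp 4) * s * E" by linarith
  then have "a * (L - ln 2) \<le> a * ((1 + 4 * exp 4) * s * E)" using a by (intro mult_left_mono) auto
  also have "\<dots> = (1 + 4 * exp 4) * sqrt L * E" using a by (simp add: s_def)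
  finally show ?thesis by (simp add: L_def E_def)
qed

lemma dist_2_nonneg [simp]: "0 \<le> dist_2 N s t"
  by (simp add: dist_2_def)

lemma dist_2_commute: "dist_2 N s t = dist_2 N t s"
  by (simp add: dist_2_def L2_set_def power2_commute)

lemma dist_2_same [simp]: "dist_2 N s s = 0"
  by (simp add: dist_2_def L2_set_def)

lemma dist_2_triangle: "dist_2 N x z \<le> dist_2 N x y + dist_2 N y z"
proof -
  have "dist_2 N x z = L2_set (\<lambda>i. (x i - y i) + (y i - z i)) {..<N}"
    by (simp add: dist_2_def)
  also have "\<dots> \<le> dist_2 N x y + dist_2 N y z"
    unfolding dist_2_def by (rule L2_set_triangle_ineq)
  finally show ?thesis .
qed

lemma abs_le_dist_inf: "i < N \<Longrightarrow> \<bar>s i - t i\<bar> \<le> dist_inf N s t"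
  unfolding dist_inf_def by (intro Max_ge) auto

lemma dist_inf_nonneg [simp]: "0 \<le> dist_inf N s t"
  unfolding dist_inf_def by (intro Max_ge) auto

lemma dist_inf_le: "0 \<le> c \<Longrightarrow> (\<And>i. i < N \<Longrightarrow> \<bar>s i - t i\<bar> \<le> c) \<Longrightarrow> dist_inf N s t \<le> c"
  unfolding dist_inf_def by (subst Max_le_iff) auto

lemma dist_inf_same [simp]: "dist_inf N s s = 0"
  using dist_inf_le[of 0 N s s] dist_inf_nonneg[of N s s] by simp

lemma dist_2_le_avg_sup_ip:
  assumes "finite F" "x \<in> F" "y \<in> F"
  shows "dist_2 N x y \<le> 4 * avg N (sup_ip N F)"
  using khinchine[of N "\<lambda>i. x i - y i"] avg_abs_ip_le[OF assms, of N] by (simp add: dist_2_eq_sqrt)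

definition sud_const :: real where "sud_const = 2 * (1 + 4 * exp 4)"

lemma sud_const_ge: "10 \<le> sud_const"
proof -
  have "10 \<le> 2 * (1 + 4 * c)" if "1 \<le> c" for c :: real using that by simp
  from this[of "exp 4"] show ?thesis unfolding sud_const_def by simp
qed

text \<open>
  The form invariant under translation: only differences of the points are required to be small in
  the supremum norm.
\<close>

lemma sudakov:
  assumes X: "finite X" "4 \<le> card X" and a: "0 < a"
    and close: "\<And>x z i. x \<in> X \<Longrightarrow> z \<in> X \<Longrightarrow> i < N \<Longrightarrow> sqrt (ln (card X)) * \<bar>x i - z i\<bar> \<le> a"
    and sep: "\<And>x z. x \<in> X \<Longrightarrow> z \<in> X \<Longrightarrow> x \<noteq> z \<Longrightarrow> a \<le> dist_2 N x z"
  shows "a * sqrt (ln (card X)) \<le> sud_const * avg N (sup_ip N X)"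
proof -
  obtain x0 where x0: "x0 \<in> X" using X by fastforce
  define g where "g x = (\<lambda>i. x i - x0 i)" for x :: "nat \<Rightarrow> real"
  have inj: "inj_on g X"
    by (rule inj_on_inverseI[of _ "\<lambda>y i. y i + x0 i"]) (simp add: g_def)
  have card: "card (g ` X) = card X" by (rule card_image[OF inj])
  define L where "L = sqrt (ln (real (card X)))"
  have L2: "L\<^sup>2 = ln (card X)" using X by (simp add: L_def)
  have L: "0 < L" using X by (simp add: L_def)
  have main: "a * (L\<^sup>2 - ln 2) \<le> (1 + 4 * exp 4) * L * avg N (sup_ip N (g ` X))"
    unfolding L2 unfolding L_def card[symmetric]
  proof (rule sudakov_bounded)
    show "finite (g ` X)" using X by simp
    show "2 \<le> card (g ` X)" using X card by simp
    show "sqrt (ln (card (g ` X))) * \<bar>y i\<bar> \<le> a" if "y \<in> g ` X" "i < N" for y i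
      unfolding card using that close[OF _ x0] by (auto simp: g_def)
    show "a \<le> dist_2 N y z" if "y \<in> g ` X" "z \<in> g ` X" "y \<noteq> z" for y z
    proof -
      note yz = that
      obtain x w where "x \<in> X" "y = g x" "w \<in> X" "z = g w" using yz by auto
      then show ?thesis using sep[of x w] yz by (auto simp: g_def dist_2_def)
    qed
  qed (rule a)
  have sup_shift: "sup_ip N (g ` X) e = sup_ip N X e - ip N e x0" for e
    unfolding g_def by (rule sup_ip_translate) (use X x0 in auto)
  have "avg N (sup_ip N (g ` X)) = avg N (\<lambda>e. sup_ip N X e - ip N e x0)"
    by (intro avg_cong sup_shift)
  then have E: "avg N (sup_ip N (g ` X)) = avg N (sup_ip N X)" by (simp add: avg_diff avg_ip)
  have "2 * ln 2 = ln (2 ^ 2 :: real)" by (subst ln_realpow) auto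
  also have "\<dots> \<le> L\<^sup>2" unfolding L2 using X by (subst ln_le_cancel_iff) auto
  finally have "a * L\<^sup>2 \<le> a * (2 * (L\<^sup>2 - ln 2))" using a by (intro mult_left_mono) auto
  also have "\<dots> \<le> L * (sud_const * avg N (sup_ip N X))"
  proof -
    have "2 * (a * (L\<^sup>2 - ln 2)) \<le> 2 * ((1 + 4 * exp 4) * L * avg N (sup_ip N X))"
      by (rule mult_left_mono[OF main[unfolded E]]) simp
    then show ?thesis unfolding sud_const_def by (simp only: mult_ac)
  qed
  finally have "L * (a * L) \<le> L * (sud_const * avg N (sup_ip N X))"
    by (simp add: power2_eq_square mult_ac)
  then show ?thesis using L by (simp add: L_def)
qed

text \<open>
  The maximum over the union is at least the value at the point \<open>z\<close> maximizing the process over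
  \<open>X\<close>, plus the supremum over \<open>H z\<close> relative to \<open>z\<close>. Sudakov minoration bounds the former, and by
  the lower tail the latter is, simultaneously for all \<open>card X\<close> points, within
  \<open>3 \<sigma> sqrt (ln (card X))\<close> of its mean on average. For \<open>\<sigma>\<close> small compared with \<open>a\<close> this loss
  is at most half of the gain.
\<close>

lemma growth:
  fixes H :: "(nat \<Rightarrow> real) \<Rightarrow> (nat \<Rightarrow> real) set"
  assumes X: "finite X" "4 \<le> card X" and a: "0 < a"
    and close: "\<And>x z i. x \<in> X \<Longrightarrow> z \<in> X \<Longrightarrow> i < N \<Longrightarrow> sqrt (ln (card X)) * \<bar>x i - z i\<bar> \<le> a"
    and sep: "\<And>x z. x \<in> X \<Longrightarrow> z \<in> X \<Longrightarrow> x \<noteq> z \<Longrightarrow> a \<le> dist_2 N x z"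
    and H: "\<And>x. x \<in> X \<Longrightarrow> finite (H x) \<and> H x \<noteq> {}"
    and near: "\<And>x h. x \<in> X \<Longrightarrow> h \<in> H x \<Longrightarrow> dist_2 N x h \<le> \<sigma>"
    and \<sigma>: "0 < \<sigma>" "6 * sud_const * \<sigma> \<le> a"
  shows "\<exists>x\<in>X. avg N (sup_ip N (H x)) + a * sqrt (ln (card X)) / (2 * sud_const)
      \<le> avg N (sup_ip N (\<Union>x\<in>X. H x))"
proof -
  define L where "L = sqrt (ln (real (card X)))"
  have L2: "ln (card X) = L * L" using X by (simp add: L_def)
  have L: "0 < L" using X by (simp add: L_def)
  have X0: "X \<noteq> {}" using X by auto
  define b where "b x = avg N (sup_ip N (H x))" for x
  define Y where "Y x e = sup_ip N (H x) e - ip N e x" for x e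
  define \<kappa> where "\<kappa> = L / \<sigma>"
  have \<kappa>: "0 < \<kappa>" using L \<sigma> by (simp add: \<kappa>_def)
  have tail: "avg N (\<lambda>e. exp (\<kappa> * (b x - Y x e))) \<le> exp (2 * \<kappa>\<^sup>2 * \<sigma>\<^sup>2)" if x: "x \<in> X" for x
  proof -
    define H' where "H' = (\<lambda>h i. h i - x i) ` H x"
    have fin: "finite H'" "H' \<noteq> {}" using H[OF x] by (auto simp: H'_def)
    have sup': "sup_ip N H' e = Y x e" for e
      unfolding H'_def Y_def by (rule sup_ip_translate) (use H[OF x] in auto)
    have "avg N (sup_ip N H') = avg N (\<lambda>e. sup_ip N (H x) e - ip N e x)"
      by (intro avg_cong) (simp add: sup' Y_def)
    then have b': "avg N (sup_ip N H') = b x" by (simp add: avg_diff avg_ip b_def)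
    have "sq_norm N h \<le> \<sigma>\<^sup>2" if "h \<in> H'" for h
      using that power_mono[OF near[OF x], of _ 2]
      by (auto simp: H'_def dist_2_commute[of N x] dist_2_sq)
    then show ?thesis using sup_ip_lower_tail[OF fin, of N \<sigma> \<kappa>] \<kappa> by (simp add: b' sup')
  qed
  define Z where "Z e = (\<Sum>x\<in>X. exp (\<kappa> * (b x - Y x e)))" for e
  have Zpos: "0 < Z e" for e unfolding Z_def using X X0 by (intro sum_pos) auto
  have lnZ: "avg N (\<lambda>e. ln (Z e)) \<le> 3 * L * L"
  proof -
    have "exp (avg N (\<lambda>e. ln (Z e))) \<le> avg N (\<lambda>e. exp (ln (Z e)))" by (rule exp_avg_le)
    also have "\<dots> = (\<Sum>x\<in>X. avg N (\<lambda>e. exp (\<kappa> * (b x - Y x e))))"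
      using Zpos by (simp add: Z_def avg_sum)
    also have "\<dots> \<le> (\<Sum>x\<in>X. exp (2 * \<kappa>\<^sup>2 * \<sigma>\<^sup>2))" by (intro sum_mono tail)
    also have "\<dots> = exp (L * L + 2 * \<kappa>\<^sup>2 * \<sigma>\<^sup>2)"
      using X by (simp add: exp_add L2[symmetric])
    also have "L * L + 2 * \<kappa>\<^sup>2 * \<sigma>\<^sup>2 = 3 * L * L"
      using \<sigma> by (simp add: \<kappa>_def power2_eq_square)
    finally show ?thesis by simp
  qed
  define \<beta> where "\<beta> = Min (b ` X)"
  have \<beta>: "\<beta> \<le> b x" if "x \<in> X" for x unfolding \<beta>_def using X that by (intro Min_le) auto
  have "\<beta> \<in> b ` X" unfolding \<beta>_def using X X0 by (intro Min_in) auto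
  then obtain x where x: "x \<in> X" "b x = \<beta>" by auto
  let ?U = "\<Union>x\<in>X. H x"
  have U: "finite ?U" using X H by auto
  have pt: "sup_ip N X e + \<beta> - (1 / \<kappa>) * ln (Z e) \<le> sup_ip N ?U e" for e
  proof -
    obtain z where z: "z \<in> X" "sup_ip N X e = ip N e z" using sup_ip_attained[OF X(1) X0] by blast
    have "exp (\<kappa> * (b z - Y z e)) \<le> Z e"
      unfolding Z_def using X z by (intro member_le_sum) auto
    then have "\<kappa> * (b z - Y z e) \<le> ln (Z e)" using Zpos[of e] by (simp add: ln_ge_iff)
    then have "b z - Y z e \<le> (1 / \<kappa>) * ln (Z e)" using \<kappa> by (simp add: field_simps)
    moreover have "sup_ip N (H z) e \<le> sup_ip N ?U e"
      using U H z by (intro sup_ip_mono) auto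
    ultimately show ?thesis using \<beta>[OF z(1)] by (simp add: Y_def z)
  qed
  have "avg N (sup_ip N X) + \<beta> - (1 / \<kappa>) * avg N (\<lambda>e. ln (Z e))
      = avg N (\<lambda>e. sup_ip N X e + \<beta> - (1 / \<kappa>) * ln (Z e))"
    by (simp only: avg_diff avg_add avg_cmult avg_const)
  also have "\<dots> \<le> avg N (sup_ip N ?U)" by (rule avg_mono, rule pt)
  finally have 1: "avg N (sup_ip N X) + \<beta> - (1 / \<kappa>) * avg N (\<lambda>e. ln (Z e)) \<le> avg N (sup_ip N ?U)" .
  have "(1 / \<kappa>) * avg N (\<lambda>e. ln (Z e)) \<le> (1 / \<kappa>) * (3 * L * L)"
    using lnZ \<kappa> by (intro mult_left_mono) auto
  also have "\<dots> = 3 * \<sigma> * L" using L \<sigma> by (simp add: \<kappa>_def)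
  finally have 2: "(1 / \<kappa>) * avg N (\<lambda>e. ln (Z e)) \<le> 3 * \<sigma> * L" .
  have 3: "a * L / sud_const \<le> avg N (sup_ip N X)"
  proof -
    have "a * sqrt (ln (card X)) \<le> sud_const * avg N (sup_ip N X)"
      by (rule sudakov) (use X a close sep in auto)
    then show ?thesis using sud_const_ge unfolding L_def by (simp add: field_simps)
  qed
  have "3 * \<sigma> \<le> a / (2 * sud_const)" using \<sigma> sud_const_ge by (simp add: field_simps)
  then have "3 * \<sigma> * L \<le> a / (2 * sud_const) * L" using L by (intro mult_right_mono) auto
  moreover have "a * L / sud_const = a * L / (2 * sud_const) + a / (2 * sud_const) * L"
    using sud_const_ge by (simp add: field_simps)
  ultimately have "b x + a * L / (2 * sud_const) \<le> avg N (sup_ip N ?U)" using 1 2 3 x(2) by linarith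
  then show ?thesis using x(1) unfolding b_def L_def by blast
qed

section \<open>Interpolated radii\<close>

definition ball_sup :: "nat \<Rightarrow> (nat \<Rightarrow> real) set \<Rightarrow> (nat \<Rightarrow> real) \<Rightarrow> real \<Rightarrow> real" where
  "ball_sup N F x u = avg N (sup_ip N {y \<in> F. dist_2 N x y \<le> u})"

lemma ball_sup_bounds:
  assumes "finite F" "x \<in> F" "0 \<le> u"
  shows "0 \<le> ball_sup N F x u" "ball_sup N F x u \<le> avg N (sup_ip N F)"
proof -
  have "{y \<in> F. dist_2 N x y \<le> u} \<noteq> {}" using assms by (auto intro: exI[of _ x])
  then show "0 \<le> ball_sup N F x u" "ball_sup N F x u \<le> avg N (sup_ip N F)"
    unfolding ball_sup_def using assms by (auto intro!: avg_sup_ip_nonneg avg_sup_ip_mono)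
qed

text \<open>
  The ball of radius \<open>u\<close> changes only when \<open>u\<close> passes a distance from \<open>x\<close> to a point of \<open>F\<close>, so the
  minimum may be sought among these finitely many distances.
\<close>

lemma optimal_radius_exists:
  assumes F: "finite F" "x \<in> F" and \<tau>: "0 \<le> \<tau>"
  shows "\<exists>s\<ge>0. \<forall>u\<ge>0. \<tau> * s - ball_sup N F x s \<le> \<tau> * u - ball_sup N F x u"
proof -
  define f where "f u = \<tau> * u - ball_sup N F x u" for u
  define D where "D = dist_2 N x ` F"
  have D: "finite D" "0 \<in> D" using F by (auto simp: D_def intro!: image_eqI[of 0 _ x])
  then obtain s where s: "s \<in> D" "\<And>d. d \<in> D \<Longrightarrow> f s \<le> f d"
    using arg_min_if_finite[of D f] by (metis empty_iff not_less)
  have "f s \<le> f u" if "0 \<le> u" for u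
  proof -
    define d where "d = Max {d \<in> D. d \<le> u}"
    have fin: "finite {d \<in> D. d \<le> u}" "{d \<in> D. d \<le> u} \<noteq> {}" using D that by auto
    have d: "d \<in> D" "d \<le> u" using Max_in[OF fin] by (auto simp: d_def)
    have "dist_2 N x y \<le> d \<longleftrightarrow> dist_2 N x y \<le> u" if "y \<in> F" for y
      using d Max_ge[OF fin(1), of "dist_2 N x y"] that unfolding d_def[symmetric] by (auto simp: D_def)
    then have "ball_sup N F x d = ball_sup N F x u"
      unfolding ball_sup_def by (metis (mono_tags, lifting) Collect_cong)
    then have "f d \<le> f u" using d(2) \<tau> by (simp add: f_def mult_left_mono)
    with s(2)[OF d(1)] show ?thesis by linarith
  qed
  moreover have "0 \<le> s" using s(1) by (auto simp: D_def)
  ultimately show ?thesis unfolding f_def by blast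
qed

lemma sqrt2_ge: "4/3 \<le> sqrt (2::real)"
  by (rule real_le_rsqrt) (simp add: power2_eq_square)

text \<open>
  Let \<open>K n\<close> be the minimum at scale \<open>n\<close>. Using the minimizer of scale \<open>n + 1\<close> as a competitor at
  scale \<open>n\<close> shows that \<open>K\<close> increases by at least \<open>\<kappa> (sqrt 2 ^ (n+1) - sqrt 2 ^ n) s (n+1)\<close> in one
  step, while \<open>K\<close> stays between minus the Bernoulli supremum of \<open>F\<close> and 0.
\<close>

lemma sum_optimal_radii_le:
  assumes F: "finite F" "x \<in> F" and \<kappa>: "0 < \<kappa>"
    and s0: "\<And>n. 0 \<le> s n"
    and opt: "\<And>n u. 0 \<le> u \<Longrightarrow> \<kappa> * sqrt 2 ^ n * s n - ball_sup N F x (s n)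
        \<le> \<kappa> * sqrt 2 ^ n * u - ball_sup N F x u"
  shows "(\<Sum>n<M. sqrt 2 ^ n * s n) \<le> 4 * avg N (sup_ip N F) / \<kappa>"
proof -
  define K where "K n = \<kappa> * sqrt 2 ^ n * s n - ball_sup N F x (s n)" for n
  define G where "G = avg N (sup_ip N F)"
  have low: "\<kappa> / 4 * (\<Sum>k\<le>n. sqrt 2 ^ k * s k) - G \<le> K n" for n
  proof (induction n)
    case 0
    have "\<kappa> * s 0 / 4 \<le> \<kappa> * s 0" using \<kappa> s0[of 0] by simp
    then show ?case using ball_sup_bounds(2)[OF F s0, of N 0] by (simp add: K_def G_def)
  next
    case (Suc n)
    have "K n \<le> \<kappa> * sqrt 2 ^ n * s (Suc n) - ball_sup N F x (s (Suc n))"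
      unfolding K_def by (rule opt) (rule s0)
    moreover have "\<kappa> / 4 * (sqrt 2 ^ Suc n * s (Suc n)) \<le> \<kappa> * sqrt 2 ^ Suc n * s (Suc n) - \<kappa> * sqrt 2 ^ n * s (Suc n)"
    proof -
      define c where "c = \<kappa> * sqrt 2 ^ n * s (Suc n)"
      have "0 \<le> c" using \<kappa> s0[of "Suc n"] by (simp add: c_def)
      then have "0 \<le> c * (3/4 * sqrt 2 - 1)" using sqrt2_ge by (intro mult_nonneg_nonneg) auto
      then show ?thesis by (simp add: c_def algebra_simps)
    qed
    ultimately show ?case using Suc.IH by (simp add: K_def algebra_simps)
  qed
  have "K n \<le> 0" for n
    using opt[of 0 n] ball_sup_bounds(1)[OF F, of 0 N] by (simp add: K_def)
  then have bound: "\<kappa> / 4 * (\<Sum>k\<le>n. sqrt 2 ^ k * s k) \<le> G" for n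
    using low[of n] by (smt (verit))
  have "(\<Sum>n<M. sqrt 2 ^ n * s n) \<le> (\<Sum>k\<le>M. sqrt 2 ^ k * s k)"
    using s0 by (intro sum_mono2) auto
  also have "\<dots> \<le> 4 * G / \<kappa>" using bound[of M] \<kappa> by (simp add: field_simps)
  finally show ?thesis by (simp add: G_def)
qed

section \<open>Nets and separated sets\<close>

text \<open>
  \<open>has_nets d \<beta> M F V\<close> is the discrete form of a bound on \<open>\<gamma>\<^sub>\<alpha>\<close> with \<open>\<beta> = 2 powr \<alpha>\<close>; the nets
  are the images of the maps \<open>\<pi> n\<close>. A horizon \<open>M\<close> suffices because the nets may be taken equal
  to \<open>F\<close> as soon as \<open>card F \<le> 2 ^ 2 ^ M\<close>.
\<close>

definition has_nets :: "('a \<Rightarrow> 'a \<Rightarrow> real) \<Rightarrow> real \<Rightarrow> nat \<Rightarrow> 'a set \<Rightarrow> real \<Rightarrow> bool" where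
  "has_nets d \<beta> M F V \<longleftrightarrow> (\<exists>\<pi>. (\<forall>n<M. \<pi> n ` F \<subseteq> F \<and> card (\<pi> n ` F) \<le> 2 ^ 2 ^ n) \<and>
     (\<forall>x\<in>F. (\<Sum>n<M. \<beta> ^ n * d x (\<pi> n x)) \<le> V))"

lemma ln2_bounds: "1/2 \<le> ln (2::real)" "ln (2::real) < 1"
proof -
  have "ln (exp (1/2)) \<le> ln (2::real)" using exp_half_le2 by (subst ln_le_cancel_iff) auto
  then show "1/2 \<le> ln (2::real)" by simp
qed (rule ln_2_less_1)

lemma sqrt2_power_bounds:
  shows "sqrt 2 ^ n \<le> sqrt (ln (2 ^ 2 ^ Suc n))" "sqrt (ln (2 ^ 2 ^ Suc n)) \<le> 2 * sqrt 2 ^ n"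
proof -
  have eq: "sqrt 2 ^ n = sqrt (2 ^ n)" by (simp add: real_sqrt_power)
  have ln: "ln (2 ^ 2 ^ Suc n :: real) = 2 ^ n * (2 * ln 2)"
    by (subst ln_realpow) auto
  have "1 \<le> 2 * ln (2::real)" using ln2_bounds by simp
  then have "(2::real) ^ n * 1 \<le> 2 ^ n * (2 * ln 2)" by (intro mult_left_mono) auto
  then show "sqrt 2 ^ n \<le> sqrt (ln (2 ^ 2 ^ Suc n))" unfolding eq ln by simp
  have "2 * ln (2::real) \<le> 4" using ln2_bounds by simp
  then have "(2::real) ^ n * (2 * ln 2) \<le> 2 ^ n * 4" by (intro mult_left_mono) auto
  then have "sqrt (2 ^ n * (2 * ln 2)) \<le> sqrt (2 ^ n * 2\<^sup>2)" by (intro real_sqrt_le_mono) simp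
  also have "\<dots> = 2 * sqrt 2 ^ n" unfolding eq by (subst real_sqrt_mult) simp
  finally show "sqrt (ln (2 ^ 2 ^ Suc n)) \<le> 2 * sqrt 2 ^ n" unfolding ln .
qed

text \<open>
  Otherwise apply the growth condition to the balls of radius \<open>s x\<close> around the points of \<open>X\<close>. Their union
  lies in a ball of radius \<open>\<Delta> + \<sigma>\<close> around the point \<open>x\<close> that realizes the smallest supremum, so
  enlarging the radius from \<open>s x\<close> to \<open>\<Delta> + \<sigma>\<close> would raise the supremum by a multiple of
  \<open>\<rho> sqrt 2 ^ n\<close>; minimality of \<open>s x\<close> allows only \<open>\<kappa> sqrt 2 ^ n (\<Delta> + \<sigma>)\<close>, which is smaller
  for small \<open>\<kappa>\<close>.
\<close>

lemma no_large_separated_subset: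
  assumes F: "finite F" and A: "A \<subseteq> F" and \<kappa>: "0 < \<kappa>" and \<sigma>: "0 < \<sigma>" "6 * sud_const * \<sigma> \<le> \<rho>"
    and diam: "\<And>x y. x \<in> A \<Longrightarrow> y \<in> A \<Longrightarrow> dist_2 N x y \<le> \<Delta>"
    and s: "\<And>x. x \<in> A \<Longrightarrow> 0 \<le> s x \<and> s x \<le> \<sigma>"
    and opt: "\<And>x u. x \<in> A \<Longrightarrow> 0 \<le> u \<Longrightarrow> \<kappa> * sqrt 2 ^ n * s x - ball_sup N F x (s x)
        \<le> \<kappa> * sqrt 2 ^ n * u - ball_sup N F x u"
    and close: "\<And>x y i. x \<in> A \<Longrightarrow> y \<in> A \<Longrightarrow> i < N \<Longrightarrow> 2 * sqrt 2 ^ n * \<bar>x i - y i\<bar> \<le> \<rho>"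
    and small: "2 * sud_const * \<kappa> * (\<Delta> + \<sigma>) < \<rho>"
    and X: "X \<subseteq> A" "card X = 2 ^ 2 ^ Suc n"
    and sep: "\<And>x y. x \<in> X \<Longrightarrow> y \<in> X \<Longrightarrow> x \<noteq> y \<Longrightarrow> \<rho> \<le> dist_2 N x y"
  shows False
proof -
  have finA: "finite A" using A F finite_subset by blast
  have finX: "finite X" using X finA finite_subset by blast
  define r where "r = sqrt (2::real) ^ n"
  have r: "0 < r" by (simp add: r_def)
  define L where "L = sqrt (ln (real (card X)))"
  have L: "r \<le> L" "L \<le> 2 * r"
    unfolding L_def r_def X(2) using sqrt2_power_bounds[of n] by simp_all
  have \<rho>: "0 < \<rho>" using \<sigma> sud_const_ge by (smt (verit) mult_pos_pos)
  define H where "H x = {y \<in> F. dist_2 N x y \<le> s x}" for x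
  have "(2::nat) ^ 2 \<le> 2 ^ 2 ^ Suc n" by (intro power_increasing) auto
  then have card4: "4 \<le> card X" unfolding X(2) by simp
  have "\<exists>x\<in>X. avg N (sup_ip N (H x)) + \<rho> * sqrt (ln (card X)) / (2 * sud_const)
      \<le> avg N (sup_ip N (\<Union>x\<in>X. H x))"
  proof (rule growth[OF finX card4 \<rho> _ sep _ _ \<sigma>])
    show "sqrt (ln (card X)) * \<bar>x i - z i\<bar> \<le> \<rho>" if "x \<in> X" "z \<in> X" "i < N" for x z i
    proof -
      have "L * \<bar>x i - z i\<bar> \<le> 2 * r * \<bar>x i - z i\<bar>" using L by (intro mult_right_mono) auto
      also have "\<dots> \<le> \<rho>" unfolding r_def using close that X by blast
      finally show ?thesis by (simp add: L_def)
    qed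
    show "finite (H x) \<and> H x \<noteq> {}" if "x \<in> X" for x
      using that X A F s[of x] by (auto simp: H_def intro!: exI[of _ x])
    show "dist_2 N x h \<le> \<sigma>" if "x \<in> X" "h \<in> H x" for x h
      using that X s[of x] by (auto simp: H_def)
  qed
  then obtain x where x: "x \<in> X"
    and gr: "ball_sup N F x (s x) + \<rho> * L / (2 * sud_const) \<le> avg N (sup_ip N (\<Union>x\<in>X. H x))"
    unfolding H_def ball_sup_def L_def by blast
  have xA: "x \<in> A" using x X by auto
  have \<Delta>: "0 \<le> \<Delta>" using diam[OF xA xA] by simp
  have "(\<Union>x\<in>X. H x) \<subseteq> {y \<in> F. dist_2 N x y \<le> \<Delta> + \<sigma>}"
  proof
    fix y assume "y \<in> (\<Union>x\<in>X. H x)"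
    then obtain z where z: "z \<in> X" "y \<in> F" "dist_2 N z y \<le> s z" by (auto simp: H_def)
    have "dist_2 N x y \<le> dist_2 N x z + dist_2 N z y" by (rule dist_2_triangle)
    also have "\<dots> \<le> \<Delta> + \<sigma>" using z X xA diam[of x z] s[of z] by (intro add_mono) auto
    finally show "y \<in> {y \<in> F. dist_2 N x y \<le> \<Delta> + \<sigma>}" using z by simp
  qed
  moreover have "(\<Union>x\<in>X. H x) \<noteq> {}"
    using x X A s[of x] by (auto simp: H_def intro!: bexI[of _ x] exI[of _ x])
  ultimately have "avg N (sup_ip N (\<Union>x\<in>X. H x)) \<le> ball_sup N F x (\<Delta> + \<sigma>)"
    unfolding ball_sup_def using F by (intro avg_sup_ip_mono) auto
  moreover have "\<kappa> * r * s x - ball_sup N F x (s x) \<le> \<kappa> * r * (\<Delta> + \<sigma>) - ball_sup N F x (\<Delta> + \<sigma>)"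
    unfolding r_def using opt[OF xA] \<Delta> \<sigma> by simp
  moreover have "0 \<le> \<kappa> * r * s x" using \<kappa> r s[OF xA] by simp
  ultimately have "\<rho> * L / (2 * sud_const) \<le> \<kappa> * r * (\<Delta> + \<sigma>)" using gr by linarith
  moreover have "\<rho> * r / (2 * sud_const) \<le> \<rho> * L / (2 * sud_const)"
    using L \<rho> sud_const_ge by (intro divide_right_mono mult_left_mono) auto
  ultimately have "\<rho> * r \<le> (2 * sud_const * \<kappa> * (\<Delta> + \<sigma>)) * r"
    using sud_const_ge by (simp add: field_simps)
  with small r show False by (simp add: not_less[symmetric])
qed

lemma separated_net:
  fixes d :: "'a \<Rightarrow> 'a \<Rightarrow> real"
  assumes A: "finite A" and sym: "\<And>x y. d x y = d y x" and d0: "\<And>x. d x x < \<rho>"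
    and none: "\<And>X. X \<subseteq> A \<Longrightarrow> card X = m \<Longrightarrow> (\<And>x y. x \<in> X \<Longrightarrow> y \<in> X \<Longrightarrow> x \<noteq> y \<Longrightarrow> \<rho> \<le> d x y) \<Longrightarrow> False"
  shows "\<exists>P\<subseteq>A. card P \<le> m \<and> (\<forall>x\<in>A. \<exists>p\<in>P. d x p < \<rho>)"
proof -
  define Q where "Q P \<longleftrightarrow> P \<subseteq> A \<and> (\<forall>x\<in>P. \<forall>y\<in>P. x \<noteq> y \<longrightarrow> \<rho> \<le> d x y)" for P
  have fin: "finite {P. Q P}" using A by (rule finite_subset[rotated, OF finite_Pow_iff[THEN iffD2]]) (auto simp: Q_def)
  have "Q {}" by (simp add: Q_def)
  then obtain P where P: "Q P" "\<And>P'. Q P' \<Longrightarrow> P \<subseteq> P' \<Longrightarrow> P' = P"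
    using finite_has_maximal[OF fin] by blast
  have PA: "P \<subseteq> A" "finite P" using P(1) A finite_subset by (auto simp: Q_def)
  have "card P \<le> m"
  proof (rule ccontr)
    assume "\<not> card P \<le> m"
    then obtain X where "X \<subseteq> P" "card X = m" using PA obtain_subset_with_card_n[of m P] by auto
    moreover have "\<rho> \<le> d x y" if "x \<in> X" "y \<in> X" "x \<noteq> y" for x y
      using that P(1) \<open>X \<subseteq> P\<close> unfolding Q_def by blast
    ultimately show False using PA(1) by (intro none[of X]) auto
  qed
  moreover have "\<exists>p\<in>P. d x p < \<rho>" if "x \<in> A" for x
  proof (rule ccontr)
    assume "\<not> (\<exists>p\<in>P. d x p < \<rho>)"
    then have far: "\<rho> \<le> d x p" if "p \<in> P" for p using that by force
    then have "Q (insert x P)" using P(1) \<open>x \<in> A\<close> far sym unfolding Q_def by (metis insert_iff insert_subset)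
    then have "x \<in> P" using P(2)[of "insert x P"] by auto
    with far[of x] d0[of x] show False by simp
  qed
  ultimately show ?thesis using PA by blast
qed

text \<open>
  Rounds a quantity in \<open>{0..D}\<close> up to one of \<open>m + 1\<close> dyadic values, at the cost of a factor 2 and
  of an error \<open>D / 2 ^ m\<close>.
\<close>

lemma dyadic_level:
  fixes r D :: real
  assumes "r \<le> D" "0 \<le> r" "0 < D"
  shows "\<exists>k\<le>m. r \<le> D / 2 ^ k \<and> D / 2 ^ k \<le> 2 * r + D / 2 ^ (m::nat)"
proof -
  have "\<exists>k\<le>m. r \<le> D / 2 ^ k \<and> (k = m \<or> D / 2 ^ k \<le> 2 * r)"
  proof (induction m)
    case 0
    then show ?case using assms by auto
  next
    case (Suc m)
    then obtain k where k: "k \<le> m" "r \<le> D / 2 ^ k" "k = m \<or> D / 2 ^ k \<le> 2 * r" by blast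
    show ?case
    proof (cases "r \<le> D / 2 ^ Suc m")
      case False
      then have "D / 2 ^ m \<le> 2 * r" by (simp add: field_simps)
      then show ?thesis using k by (intro exI[of _ k]) auto
    qed auto
  qed
  then obtain k where k: "k \<le> m" "r \<le> D / 2 ^ k" "k = m \<or> D / 2 ^ k \<le> 2 * r" by blast
  have "0 \<le> D / 2 ^ m" using assms by simp
  with k(3) assms(2) have "D / 2 ^ k \<le> 2 * r + D / 2 ^ m" by (elim disjE) simp_all
  with k show ?thesis by blast
qed

lemma geometric_sum_half_le: "(\<Sum>n<M. (1 / 2 :: real) ^ n) \<le> 2"
  by (simp add: geometric_sum)

section \<open>Contraction of chaining functionals\<close>

text \<open>
  The sum of all losses in \<open>contraction_step\<close>: 20 from the first three trivial nets, and the rest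
  from the radii, the supremum-norm nets and the rounding.
\<close>

definition core_const :: real where "core_const = 44 + 14688 * sud_const\<^sup>2 + 72 * sud_const"

lemma net_cardinality_exponents: "2 ^ 2 ^ n * (2 ^ 2 ^ n * (2 * n + 1)) * 2 ^ 2 ^ Suc n \<le> (2::nat) ^ 2 ^ (n + 3)"
proof -
  have le: "2 * n + 1 \<le> (2::nat) ^ 2 ^ n"
  proof (induction n)
    case (Suc n)
    have "(2::nat) ^ 1 \<le> 2 ^ 2 ^ n" by (intro power_increasing) auto
    then have "2 * Suc n + 1 \<le> (2 ^ 2 ^ n) * (2::nat)" using Suc.IH by simp
    also have "\<dots> \<le> (2 ^ 2 ^ n) * (2 ^ 2 ^ n)" using \<open>2 ^ 1 \<le> 2 ^ 2 ^ n\<close> by (intro mult_left_mono) auto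
    also have "\<dots> = 2 ^ 2 ^ Suc n" by (simp add: power_add[symmetric] mult_2)
    finally show ?case .
  qed simp
  have "2 ^ 2 ^ n * (2 ^ 2 ^ n * (2 * n + 1)) * 2 ^ 2 ^ Suc n
      \<le> 2 ^ 2 ^ n * (2 ^ 2 ^ n * 2 ^ 2 ^ n) * (2::nat) ^ 2 ^ Suc n"
    using le by (intro mult_right_mono mult_left_mono) auto
  also have "\<dots> = 2 ^ (5 * 2 ^ n)" by (simp add: power_add[symmetric])
  also have "\<dots> \<le> 2 ^ 2 ^ (n + 3)" by (intro power_increasing) (auto simp: power_add)
  finally show ?thesis .
qed

text \<open>
  Group the points by the two nets \<open>\<pi>\<close>, \<open>\<tau>\<close> and by the dyadic level of \<open>q\<close>. On a group of level
  \<open>\<rho>\<close>, the diameter is at most \<open>24 \<rho>\<close>, the radii \<open>s\<close> are small compared with \<open>\<rho>\<close>, and so is the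
  supremum-norm diameter times \<open>sqrt 2 ^ n\<close>; hence the group has no \<open>\<rho>\<close>-separated set of
  \<open>2 ^ 2 ^ (n+1)\<close> points and is covered by that many balls of radius \<open>\<rho>\<close>. The cardinalities
  multiply, which shifts the index by 3. The weight \<open>1/12\<close> on the old net is what makes the
  iteration contract: \<open>2 sqrt 2 ^ 3 / 12 < 1/2\<close>.
\<close>

lemma refined_net:
  assumes F: "finite F" and \<kappa>: "\<kappa> = 1 / (51 * sud_const)"
    and \<pi>: "card (\<pi> ` F) \<le> 2 ^ 2 ^ n" and \<tau>: "card (\<tau> ` F) \<le> 2 ^ 2 ^ n"
    and s: "\<And>x. x \<in> F \<Longrightarrow> 0 \<le> s x"
    and opt: "\<And>x u. x \<in> F \<Longrightarrow> 0 \<le> u \<Longrightarrow> \<kappa> * sqrt 2 ^ n * s x - ball_sup N F x (s x)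
        \<le> \<kappa> * sqrt 2 ^ n * u - ball_sup N F x u"
    and q: "\<And>x. x \<in> F \<Longrightarrow> q x = dist_2 N x (\<pi> x) / 12 + 6 * sud_const * s x
        + 6 * sud_const * sqrt 2 ^ n * dist_inf N x (\<tau> x)"
    and D: "0 < D" "\<And>x. x \<in> F \<Longrightarrow> q x \<le> D"
  shows "\<exists>\<psi>. \<psi> ` F \<subseteq> F \<and> card (\<psi> ` F) \<le> 2 ^ 2 ^ (n + 3) \<and>
    (\<forall>x\<in>F. dist_2 N x (\<psi> x) \<le> 2 * q x + D / 4 ^ n)"
proof -
  have q0: "0 \<le> q x" if "x \<in> F" for x
    unfolding q[OF that] using s[OF that] sud_const_ge by (intro add_nonneg_nonneg) auto
  have "\<forall>x. \<exists>k. x \<in> F \<longrightarrow> k \<le> 2 * n \<and> q x \<le> D / 2 ^ k \<and> D / 2 ^ k \<le> 2 * q x + D / 2 ^ (2 * n)"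
    using dyadic_level[OF D(2) q0 D(1)] by blast
  then obtain lev where lev: "\<And>x. x \<in> F \<Longrightarrow> lev x \<le> 2 * n"
    "\<And>x. x \<in> F \<Longrightarrow> q x \<le> D / 2 ^ lev x"
    "\<And>x. x \<in> F \<Longrightarrow> D / 2 ^ lev x \<le> 2 * q x + D / 2 ^ (2 * n)"
    by metis
  define key where "key x = (\<pi> x, \<tau> x, lev x)" for x
  define A where "A g = {x \<in> F. key x = g}" for g
  have net: "\<exists>P\<subseteq>A g. card P \<le> 2 ^ 2 ^ Suc n \<and> (\<forall>x\<in>A g. \<exists>p\<in>P. dist_2 N x p < D / 2 ^ snd (snd g))" for g
  proof (rule separated_net)
    define \<rho> where "\<rho> = D / 2 ^ snd (snd g)"
    have \<rho>: "0 < \<rho>" using D by (simp add: \<rho>_def)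
    show "finite (A g)" using F by (simp add: A_def)
    show "dist_2 N x y = dist_2 N y x" for x y by (rule dist_2_commute)
    show "dist_2 N x x < D / 2 ^ snd (snd g)" for x using D by simp
    fix X assume X: "X \<subseteq> A g" "card X = 2 ^ 2 ^ Suc n"
      and sep: "\<And>x y. x \<in> X \<Longrightarrow> y \<in> X \<Longrightarrow> x \<noteq> y \<Longrightarrow> D / 2 ^ snd (snd g) \<le> dist_2 N x y"
    have AF: "x \<in> F" if "x \<in> A g" for x using that by (simp add: A_def)
    have qA: "q x \<le> \<rho>" if "x \<in> A g" for x
      using lev(2)[OF AF[OF that]] that by (auto simp: A_def key_def \<rho>_def)
    have parts: "dist_2 N x (fst g) \<le> 12 * \<rho>" "s x \<le> \<rho> / (6 * sud_const)"
      "2 * sqrt 2 ^ n * dist_inf N x (fst (snd g)) \<le> \<rho> / 2" if x: "x \<in> A g" for x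
    proof -
      have g: "fst g = \<pi> x" "fst (snd g) = \<tau> x" using x by (auto simp: A_def key_def)
      have nn: "0 \<le> dist_2 N x (\<pi> x) / 12" "0 \<le> 6 * sud_const * s x" "0 \<le> sqrt 2 ^ n * dist_inf N x (\<tau> x)"
        "0 \<le> 6 * sud_const * sqrt 2 ^ n * dist_inf N x (\<tau> x)"
        using s[OF AF[OF x]] sud_const_ge by auto
      have le: "dist_2 N x (\<pi> x) / 12 + 6 * sud_const * s x + 6 * sud_const * sqrt 2 ^ n * dist_inf N x (\<tau> x) \<le> \<rho>"
        using qA[OF x] q[OF AF[OF x]] by simp
      show "dist_2 N x (fst g) \<le> 12 * \<rho>" using le nn unfolding g by linarith
      have "6 * sud_const * s x \<le> \<rho>" using le nn by linarith
      then show "s x \<le> \<rho> / (6 * sud_const)" using sud_const_ge by (simp add: field_simps)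
      have "60 * (sqrt 2 ^ n * dist_inf N x (\<tau> x)) \<le> 6 * sud_const * (sqrt 2 ^ n * dist_inf N x (\<tau> x))"
        using nn(3) sud_const_ge by (intro mult_right_mono) auto
      also have "\<dots> = 6 * sud_const * sqrt 2 ^ n * dist_inf N x (\<tau> x)" by (simp only: mult.assoc)
      also have "\<dots> \<le> \<rho>" using le nn by linarith
      finally show "2 * sqrt 2 ^ n * dist_inf N x (fst (snd g)) \<le> \<rho> / 2"
        using nn(3) unfolding g by linarith
    qed
    show False
    proof (rule no_large_separated_subset[where A = "A g" and \<sigma> = "\<rho> / (6 * sud_const)" and \<rho> = \<rho>
          and \<Delta> = "24 * \<rho>" and \<kappa> = \<kappa> and s = s and F = F and N = N and X = X and n = n])
      show "0 < \<kappa>" using sud_const_ge by (simp add: \<kappa>)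
      show "0 < \<rho> / (6 * sud_const)" "6 * sud_const * (\<rho> / (6 * sud_const)) \<le> \<rho>" using \<rho> sud_const_ge by auto
      show "dist_2 N x y \<le> 24 * \<rho>" if "x \<in> A g" "y \<in> A g" for x y
        using parts(1)[OF that(1)] parts(1)[OF that(2)] dist_2_triangle[of N x y "fst g"]
          dist_2_commute[of N "fst g" y] by linarith
      show "2 * sqrt 2 ^ n * \<bar>x i - y i\<bar> \<le> \<rho>" if "x \<in> A g" "y \<in> A g" "i < N" for x y i
      proof -
        let ?t = "fst (snd g)"
        have "\<bar>x i - y i\<bar> \<le> dist_inf N x ?t + dist_inf N y ?t"
          using abs_le_dist_inf[OF that(3), of x ?t] abs_le_dist_inf[OF that(3), of y ?t] by linarith
        then have "2 * sqrt 2 ^ n * \<bar>x i - y i\<bar> \<le> 2 * sqrt 2 ^ n * (dist_inf N x ?t + dist_inf N y ?t)"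
          by (intro mult_left_mono) auto
        then show ?thesis using parts(3)[OF that(1)] parts(3)[OF that(2)] by (simp add: distrib_left)
      qed
      have e: "2 * sud_const * \<kappa> = 2 / 51" using sud_const_ge by (simp add: \<kappa>)
      have "\<rho> / (6 * sud_const) \<le> \<rho>" using \<rho> sud_const_ge by (simp add: field_simps)
      moreover have "2 / 51 * (24 * \<rho> + c) < \<rho>" if "c \<le> \<rho>" for c using that \<rho> by simp
      ultimately show "2 * sud_const * \<kappa> * (24 * \<rho> + \<rho> / (6 * sud_const)) < \<rho>" unfolding e by blast
    qed (use F AF s opt parts X sep \<rho>_def in auto)
  qed
  then obtain P where P: "\<And>g. P g \<subseteq> A g" "\<And>g. card (P g) \<le> 2 ^ 2 ^ Suc n"
    "\<And>g x. x \<in> A g \<Longrightarrow> \<exists>p\<in>P g. dist_2 N x p < D / 2 ^ snd (snd g)"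
    by metis
  have "\<forall>x\<in>F. \<exists>p. p \<in> P (key x) \<and> dist_2 N x p < D / 2 ^ lev x"
  proof
    fix x assume "x \<in> F"
    then have "x \<in> A (key x)" by (simp add: A_def)
    from P(3)[OF this] show "\<exists>p. p \<in> P (key x) \<and> dist_2 N x p < D / 2 ^ lev x"
      by (auto simp: key_def)
  qed
  then obtain \<psi> where \<psi>: "\<And>x. x \<in> F \<Longrightarrow> \<psi> x \<in> P (key x)"
    "\<And>x. x \<in> F \<Longrightarrow> dist_2 N x (\<psi> x) < D / 2 ^ lev x" by metis
  have "\<psi> ` F \<subseteq> (\<Union>g\<in>key ` F. P g)" using \<psi>(1) by auto
  moreover have finP: "finite (P g)" for g using P(1)[of g] F finite_subset[of "P g" F] by (auto simp: A_def)
  ultimately have "card (\<psi> ` F) \<le> card (\<Union>g\<in>key ` F. P g)" using F by (intro card_mono) auto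
  also have "\<dots> \<le> (\<Sum>g\<in>key ` F. card (P g))" using F by (intro card_UN_le) auto
  also have "\<dots> \<le> (\<Sum>g\<in>key ` F. 2 ^ 2 ^ Suc n)" by (intro sum_mono P(2))
  also have "\<dots> = card (key ` F) * 2 ^ 2 ^ Suc n" by simp
  also have "\<dots> \<le> (2 ^ 2 ^ n * (2 ^ 2 ^ n * (2 * n + 1))) * 2 ^ 2 ^ Suc n"
  proof (intro mult_right_mono)
    have "key ` F \<subseteq> \<pi> ` F \<times> (\<tau> ` F \<times> {..2 * n})" using lev(1) by (auto simp: key_def)
    then have "card (key ` F) \<le> card (\<pi> ` F \<times> (\<tau> ` F \<times> {..2 * n}))" using F by (intro card_mono) auto
    also have "\<dots> = card (\<pi> ` F) * (card (\<tau> ` F) * (2 * n + 1))" by (simp add: card_cartesian_product)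
    also have "\<dots> \<le> 2 ^ 2 ^ n * (2 ^ 2 ^ n * (2 * n + 1))" by (intro mult_mono \<pi> \<tau>) auto
    finally show "card (key ` F) \<le> 2 ^ 2 ^ n * (2 ^ 2 ^ n * (2 * n + 1))" .
  qed simp
  also have "\<dots> \<le> 2 ^ 2 ^ (n + 3)" by (rule net_cardinality_exponents)
  finally have "card (\<psi> ` F) \<le> 2 ^ 2 ^ (n + 3)" .
  moreover have "\<psi> ` F \<subseteq> F"
  proof (rule image_subsetI)
    fix x assume "x \<in> F"
    then have "\<psi> x \<in> A (key x)" using \<psi>(1) P(1) by blast
    then show "\<psi> x \<in> F" by (simp add: A_def)
  qed
  moreover have "dist_2 N x (\<psi> x) \<le> 2 * q x + D / 4 ^ n" if "x \<in> F" for x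
  proof -
    have "(2::real) ^ (2 * n) = 4 ^ n" by (simp add: power_mult)
    then show ?thesis using \<psi>(2)[OF that] lev(3)[OF that] by simp
  qed
  ultimately show ?thesis by blast
qed

text \<open>
  Inserting the old nets into \<open>refined_net\<close> and summing over all scales, the old bound \<open>V\<close> returns
  with the factor 1/2, the radii contribute a multiple of the Bernoulli supremum, and the
  supremum-norm nets contribute \<open>sqrt 2 ^ n * sqrt 2 ^ n = 2 ^ n\<close> times their distances, which is
  what \<open>S\<close> bounds.
\<close>

lemma contraction_step:
  assumes F: "finite F" "F \<noteq> {}" and S: "0 < S" "avg N (sup_ip N F) \<le> S"
    and inf: "has_nets (dist_inf N) 2 M F S"
    and V: "has_nets (dist_2 N) (sqrt 2) M F V"
  shows "has_nets (dist_2 N) (sqrt 2) M F (V / 2 + core_const * S)"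
proof -
  define r where "r = sqrt (2::real)"
  have r: "1 \<le> r" "r \<le> 3/2" "r * r = 2"
  proof -
    show "r \<le> 3/2" unfolding r_def by (rule real_le_lsqrt) (auto simp: power2_eq_square)
  qed (auto simp: r_def)
  have rn: "1 \<le> r ^ n" for n using r by (simp add: one_le_power)
  define \<kappa> where "\<kappa> = 1 / (51 * sud_const)"
  have \<kappa>: "0 < \<kappa>" using sud_const_ge by (simp add: \<kappa>_def)
  obtain \<tau> where \<tau>: "\<And>n. n < M \<Longrightarrow> card (\<tau> n ` F) \<le> 2 ^ 2 ^ n"
    "\<And>x. x \<in> F \<Longrightarrow> (\<Sum>n<M. 2 ^ n * dist_inf N x (\<tau> n x)) \<le> S"
    using inf unfolding has_nets_def by blast
  obtain \<pi> where \<pi>: "\<And>n. n < M \<Longrightarrow> \<pi> n ` F \<subseteq> F" "\<And>n. n < M \<Longrightarrow> card (\<pi> n ` F) \<le> 2 ^ 2 ^ n"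
    "\<And>x. x \<in> F \<Longrightarrow> (\<Sum>n<M. r ^ n * dist_2 N x (\<pi> n x)) \<le> V"
    using V unfolding has_nets_def r_def by blast
  have "\<exists>s\<ge>0. \<forall>u\<ge>0. \<kappa> * r ^ n * s - ball_sup N F x s \<le> \<kappa> * r ^ n * u - ball_sup N F x u"
    if "x \<in> F" for n x
    by (rule optimal_radius_exists[OF F(1) that]) (use \<kappa> r in simp)
  then have "\<forall>n x. \<exists>s. x \<in> F \<longrightarrow> 0 \<le> s \<and> (\<forall>u\<ge>0. \<kappa> * r ^ n * s - ball_sup N F x s \<le> \<kappa> * r ^ n * u - ball_sup N F x u)"
    by blast
  then obtain s where s: "\<And>n x. x \<in> F \<Longrightarrow> 0 \<le> s n x"
    "\<And>n x u. x \<in> F \<Longrightarrow> 0 \<le> u \<Longrightarrow> \<kappa> * r ^ n * s n x - ball_sup N F x (s n x) \<le> \<kappa> * r ^ n * u - ball_sup N F x u"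
    by metis
  have s_sum: "(\<Sum>n<m. r ^ n * s n x) \<le> 204 * sud_const * S" if "x \<in> F" for x m
  proof -
    have "(\<Sum>n<m. r ^ n * s n x) \<le> 4 * avg N (sup_ip N F) / \<kappa>"
      unfolding r_def by (rule sum_optimal_radii_le[OF F(1) that \<kappa> s(1)[OF that] s(2)[OF that, unfolded r_def]])
    also have "\<dots> \<le> 4 * S / \<kappa>" using S \<kappa> by (intro divide_right_mono) auto
    also have "\<dots> = 204 * sud_const * S" by (simp add: \<kappa>_def)
    finally show ?thesis .
  qed
  define q where "q n x = dist_2 N x (\<pi> n x) / 12 + 6 * sud_const * s n x
        + 6 * sud_const * r ^ n * dist_inf N x (\<tau> n x)" for n x
  define D where "D = (4 + 1224 * sud_const\<^sup>2 + 6 * sud_const) * S"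
  have D: "0 < D" unfolding D_def using S sud_const_ge by (intro mult_pos_pos add_pos_pos) auto
  have diam: "dist_2 N x y \<le> 4 * S" if "x \<in> F" "y \<in> F" for x y
    using dist_2_le_avg_sup_ip[OF F(1) that, of N] S by linarith
  have qD: "q n x \<le> D" if "n < M" "x \<in> F" for n x
  proof -
    have "dist_2 N x (\<pi> n x) / 12 \<le> 4 * S" using diam[OF that(2), of "\<pi> n x"] \<pi>(1)[OF that(1)] that S by auto
    moreover have "6 * sud_const * s n x \<le> 6 * sud_const * (204 * sud_const * S)"
    proof (intro mult_left_mono)
      have "1 * s n x \<le> r ^ n * s n x" using rn s(1)[OF that(2)] by (intro mult_right_mono) auto
      also have "\<dots> \<le> (\<Sum>k<Suc n. r ^ k * s k x)"
        using s(1)[OF that(2)] r by (intro member_le_sum) auto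
      finally show "s n x \<le> 204 * sud_const * S" using s_sum[OF that(2), of "Suc n"] by simp
    qed (use sud_const_ge in auto)
    moreover have "6 * sud_const * (r ^ n * dist_inf N x (\<tau> n x)) \<le> 6 * sud_const * S"
    proof (intro mult_left_mono)
      have "r ^ n * dist_inf N x (\<tau> n x) \<le> 2 ^ n * dist_inf N x (\<tau> n x)"
        using r by (intro mult_right_mono power_mono) auto
      also have "\<dots> \<le> (\<Sum>k<M. 2 ^ k * dist_inf N x (\<tau> k x))"
        using that by (intro member_le_sum) auto
      finally show "r ^ n * dist_inf N x (\<tau> n x) \<le> S" using \<tau>(2)[OF that(2)] by simp
    qed (use sud_const_ge in auto)
    ultimately show ?thesis by (simp add: q_def D_def power2_eq_square algebra_simps)
  qed
  have "\<exists>\<psi>. \<psi> ` F \<subseteq> F \<and> card (\<psi> ` F) \<le> 2 ^ 2 ^ (n + 3) \<and>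
      (\<forall>x\<in>F. dist_2 N x (\<psi> x) \<le> 2 * q n x + D / 4 ^ n)" if "n < M" for n
    by (rule refined_net[OF F(1) \<kappa>_def \<pi>(2)[OF that] \<tau>(1)[OF that] s(1) s(2)[unfolded r_def]
          q_def[unfolded r_def] D qD[OF that]])
  then obtain \<psi> where \<psi>: "\<And>n. n < M \<Longrightarrow> \<psi> n ` F \<subseteq> F"
    "\<And>n. n < M \<Longrightarrow> card (\<psi> n ` F) \<le> 2 ^ 2 ^ (n + 3)"
    "\<And>n x. n < M \<Longrightarrow> x \<in> F \<Longrightarrow> dist_2 N x (\<psi> n x) \<le> 2 * q n x + D / 4 ^ n"
    by metis
  obtain x0 where x0: "x0 \<in> F" using F by auto
  define \<pi>' where "\<pi>' n x = (if n < 3 then x0 else \<psi> (n - 3) x)" for n x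
  have "\<pi>' n ` F \<subseteq> F \<and> card (\<pi>' n ` F) \<le> 2 ^ 2 ^ n" if "n < M" for n
  proof (cases "n < 3")
    case True
    then have "\<pi>' n ` F = {x0}" using F(2) by (auto simp: \<pi>'_def)
    then show ?thesis using x0 by simp
  next
    case False
    then have "\<pi>' n ` F = \<psi> (n - 3) ` F" by (auto simp: \<pi>'_def)
    then show ?thesis using \<psi>(1,2)[of "n - 3"] that False by simp
  qed
  moreover have "(\<Sum>n<M. r ^ n * dist_2 N x (\<pi>' n x)) \<le> V / 2 + core_const * S" if x: "x \<in> F" for x
  proof -
    have "(\<Sum>n<M. r ^ n * dist_2 N x (\<pi>' n x)) \<le> (\<Sum>n<Suc (Suc (Suc M)). r ^ n * dist_2 N x (\<pi>' n x))"
      using r by (intro sum_mono2) auto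
    also have "\<dots> = (1 + r + r * r) * dist_2 N x x0 + (\<Sum>n<M. r ^ (n + 3) * dist_2 N x (\<psi> n x))"
      unfolding sum.lessThan_Suc_shift by (simp add: \<pi>'_def numeral_3_eq_3 algebra_simps)
    also have "(1 + r + r * r) * dist_2 N x x0 \<le> 5 * (4 * S)"
      using r diam[OF x x0] S by (intro mult_mono) auto
    also have "(\<Sum>n<M. r ^ (n + 3) * dist_2 N x (\<psi> n x)) \<le> (\<Sum>n<M. 3 * r ^ n * (2 * q n x + D / 4 ^ n))"
    proof (intro sum_mono mult_mono)
      fix n assume n: "n \<in> {..<M}"
      have "r ^ 3 = 2 * r" using r by (simp add: power3_eq_cube)
      then have "r ^ (n + 3) = (2 * r) * r ^ n" by (simp add: power_add)
      also have "\<dots> \<le> 3 * r ^ n" using r by (intro mult_right_mono) auto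
      finally show "r ^ (n + 3) \<le> 3 * r ^ n" .
      show "dist_2 N x (\<psi> n x) \<le> 2 * q n x + D / 4 ^ n" using \<psi>(3) n x by auto
    qed (use r in auto)
    also have "\<dots> = 6 * (\<Sum>n<M. r ^ n * q n x) + 3 * D * (\<Sum>n<M. (r / 4) ^ n)"
      by (simp add: sum_distrib_left sum.distrib[symmetric] power_divide algebra_simps)
    also have "(\<Sum>n<M. (r / 4) ^ n) \<le> 2"
    proof -
      have "(\<Sum>n<M. (r / 4) ^ n) \<le> (\<Sum>n<M. (1 / 2) ^ n)" using r by (intro sum_mono power_mono) auto
      also have "\<dots> \<le> 2" by (simp add: geometric_sum_half_le)
      finally show ?thesis .
    qed
    also have "(\<Sum>n<M. r ^ n * q n x) = (\<Sum>n<M. r ^ n * dist_2 N x (\<pi> n x)) / 12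
        + 6 * sud_const * (\<Sum>n<M. r ^ n * s n x) + 6 * sud_const * (\<Sum>n<M. 2 ^ n * dist_inf N x (\<tau> n x))"
    proof -
      have "r ^ n * r ^ n = 2 ^ n" for n using r(3) by (simp add: power_mult_distrib[symmetric])
      then have "r ^ n * q n x = r ^ n * dist_2 N x (\<pi> n x) / 12 + 6 * sud_const * (r ^ n * s n x)
        + 6 * sud_const * (2 ^ n * dist_inf N x (\<tau> n x))" for n
        by (simp add: q_def algebra_simps flip: \<open>\<And>n. r ^ n * r ^ n = 2 ^ n\<close>)
      then show ?thesis by (simp add: sum.distrib sum_distrib_left sum_divide_distrib)
    qed
    finally have "(\<Sum>n<M. r ^ n * dist_2 N x (\<pi>' n x)) \<le> 5 * (4 * S) + (6 * ((\<Sum>n<M. r ^ n * dist_2 N x (\<pi> n x)) / 12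
        + 6 * sud_const * (\<Sum>n<M. r ^ n * s n x) + 6 * sud_const * (\<Sum>n<M. 2 ^ n * dist_inf N x (\<tau> n x))) + 3 * D * 2)"
      using D by simp
    also have "\<dots> \<le> 5 * (4 * S) + (6 * (V / 12 + 6 * sud_const * (204 * sud_const * S) + 6 * sud_const * S) + 3 * D * 2)"
      using \<pi>(3)[OF x] s_sum[OF x, of M] \<tau>(2)[OF x] sud_const_ge
      by (intro add_left_mono add_right_mono mult_left_mono add_mono divide_right_mono) auto
    also have "\<dots> = V / 2 + core_const * S"
      by (simp add: D_def core_const_def power2_eq_square algebra_simps)
    finally show ?thesis .
  qed
  ultimately show ?thesis unfolding has_nets_def r_def by blast
qed


lemma has_nets_mono: "has_nets d \<beta> M F V \<Longrightarrow> V \<le> W \<Longrightarrow> has_nets d \<beta> M F W"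
  unfolding has_nets_def by (meson order_trans)

text \<open>
  Iterate the contraction, starting from the bound of the trivial one-point nets: \<open>V\<close> halves in every
  step, so finitely many steps bring it below the additive term.
\<close>

theorem nets_2_of_nets_inf:
  assumes F: "finite F" "F \<noteq> {}" and S: "0 < S" "avg N (sup_ip N F) \<le> S"
    and inf: "has_nets (dist_inf N) 2 M F S"
  shows "has_nets (dist_2 N) (sqrt 2) M F (3 * core_const * S)"
proof -
  define R where "R = core_const * S"
  have R: "0 < R" unfolding R_def core_const_def using S sud_const_ge by (intro mult_pos_pos add_pos_pos) auto
  define V where "V = (\<Sum>n<M. sqrt 2 ^ n * (4 * S))"
  obtain x0 where x0: "x0 \<in> F" using F by auto
  have start: "has_nets (dist_2 N) (sqrt 2) M F V"
    unfolding has_nets_def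
  proof (intro exI[of _ "\<lambda>_ _. x0"] conjI allI impI ballI)
    fix x assume "x \<in> F"
    then have "dist_2 N x x0 \<le> 4 * S" using dist_2_le_avg_sup_ip[OF F(1) _ x0, of x N] S by force
    then show "(\<Sum>n<M. sqrt 2 ^ n * dist_2 N x x0) \<le> V"
      unfolding V_def by (intro sum_mono mult_left_mono) auto
  qed (use x0 F in \<open>auto simp: image_constant_conv\<close>)
  have iter: "has_nets (dist_2 N) (sqrt 2) M F (V / 2 ^ k + 2 * R)" for k
  proof (induction k)
    case 0
    show ?case by (rule has_nets_mono[OF start]) (use R in simp)
  next
    case (Suc k)
    show ?case
      by (rule has_nets_mono[OF contraction_step[OF F S inf Suc.IH]]) (simp add: R_def field_simps)
  qed
  obtain k where "V / R < 2 ^ k" using real_arch_pow[of 2 "V / R"] by auto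
  then have "V / 2 ^ k \<le> R" using R by (simp add: field_simps)
  then have "V / 2 ^ k + 2 * R \<le> 3 * R" by linarith
  from has_nets_mono[OF iter this] show ?thesis unfolding R_def by (simp only: mult.assoc)
qed

section \<open>From a majorizing measure to nets\<close>

text \<open>
  Vitali's selection: treat the sets in the order of increasing \<open>R\<close> and keep those disjoint from
  all sets kept before.
\<close>

lemma disjoint_selection:
  fixes R :: "'a \<Rightarrow> real"
  assumes "finite F"
  shows "\<exists>P\<subseteq>F. (\<forall>p\<in>P. \<forall>q\<in>P. p \<noteq> q \<longrightarrow> B p \<inter> B q = {}) \<and>
    (\<forall>x\<in>F. \<exists>p\<in>P. R p \<le> R x \<and> (x = p \<or> B x \<inter> B p \<noteq> {}))"
  using assms
proof (induction F rule: finite_ranking_induct[where f = R])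
  case (insert x F)
  then obtain P where P: "P \<subseteq> F" "\<forall>p\<in>P. \<forall>q\<in>P. p \<noteq> q \<longrightarrow> B p \<inter> B q = {}"
    "\<forall>x\<in>F. \<exists>p\<in>P. R p \<le> R x \<and> (x = p \<or> B x \<inter> B p \<noteq> {})" by blast
  show ?case
  proof (cases "\<exists>p\<in>P. B x \<inter> B p \<noteq> {}")
    case True
    then have "\<exists>p\<in>P. R p \<le> R x \<and> (x = p \<or> B x \<inter> B p \<noteq> {})" using insert P(1) by blast
    then show ?thesis using P by (intro exI[of _ P]) auto
  next
    case False
    then show ?thesis using P by (intro exI[of _ "insert x P"]) (auto simp: Int_commute)
  qed
qed auto

lemma sum_geometric_le: "4/3 \<le> (\<beta>::real) \<Longrightarrow> (\<Sum>n\<le>m. \<beta> ^ n) \<le> 4 * \<beta> ^ m"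
proof (induction m)
  case (Suc m)
  have "4 * \<beta> ^ m \<le> 3 * \<beta> * \<beta> ^ m" using Suc.prems by (intro mult_right_mono) auto
  then show ?case using Suc.IH[OF Suc.prems] by simp
qed simp

text \<open>
  The geometric sum is dominated by its last term \<open>(2 powr \<alpha>) ^ m\<close>, and \<open>p < 2 ^ -2 ^ m\<close> means
  \<open>(ln (1/p)) powr \<alpha> > (2 powr \<alpha>) ^ m * (ln 2) powr \<alpha>\<close>.
\<close>

lemma sum_scales_le_log_inv_pow:
  assumes \<alpha>: "1/2 \<le> \<alpha>" "\<alpha> \<le> 1" and p: "0 \<le> p"
  shows "ennreal (\<Sum>n\<in>{n. n < M \<and> p < 1 / 2 ^ 2 ^ n}. (2 powr \<alpha>) ^ n / 8) \<le> log_inv_pow \<alpha> p"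
proof -
  let ?A = "{n. n < M \<and> p < 1 / 2 ^ 2 ^ n}"
  show ?thesis
  proof (cases "?A = {}")
    case True
    show ?thesis unfolding True by simp
  next
    case False
    define m where "m = Max ?A"
    define \<beta> where "\<beta> = 2 powr \<alpha>"
    have "2 powr (1/2) \<le> 2 powr \<alpha>" using \<alpha> by (intro powr_mono) auto
    with sqrt2_ge have \<beta>: "4/3 \<le> \<beta>" by (simp add: \<beta>_def powr_half_sqrt)
    have fin: "finite ?A" by (rule finite_subset[of _ "{..<M}"]) auto
    have m: "p < 1 / 2 ^ 2 ^ m" using Max_in[OF fin False] by (simp add: m_def)
    have "(\<Sum>n\<in>?A. \<beta> ^ n) \<le> (\<Sum>n\<in>{..m}. \<beta> ^ n)"
      using Max_ge[OF fin] \<beta> by (intro sum_mono2) (auto simp: m_def)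
    also have "\<dots> \<le> 4 * \<beta> ^ m"
      by (rule sum_geometric_le[OF \<beta>])
    finally have sum: "(\<Sum>n\<in>?A. \<beta> ^ n) \<le> 4 * \<beta> ^ m" .
    show ?thesis
    proof (cases "p = 0")
      case True
      then show ?thesis by (simp add: log_inv_pow_def)
    next
      case False
      then have p: "0 < p" using p by simp
      have "2 ^ m * ln 2 = ln (2 ^ 2 ^ m :: real)" by (subst ln_realpow) auto
      also have "\<dots> \<le> ln (1 / p)" using m p by (subst ln_le_cancel_iff) (auto simp: field_simps)
      finally have "(2 ^ m * ln 2) powr \<alpha> \<le> ln (1 / p) powr \<alpha>" using \<alpha> by (intro powr_mono2) auto
      moreover have "(2 ^ m * ln 2) powr \<alpha> = \<beta> ^ m * ln 2 powr \<alpha>"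
        by (simp add: powr_mult \<beta>_def powr_realpow[symmetric] powr_powr mult.commute)
      moreover have "ln (2::real) powr 1 \<le> ln 2 powr \<alpha>" using \<alpha> ln2_bounds by (intro powr_mono') auto
      then have "\<beta> ^ m * (1/2) \<le> \<beta> ^ m * ln 2 powr \<alpha>"
        using ln2_bounds(1) \<beta> by (intro mult_left_mono) auto
      ultimately have "4 * \<beta> ^ m / 8 \<le> ln (1 / p) powr \<alpha>" by linarith
      then have "ennreal ((\<Sum>n\<in>?A. \<beta> ^ n) / 8) \<le> ennreal (ln (1 / p) powr \<alpha>)"
        using sum by (intro ennreal_leI) linarith
      then show ?thesis using False by (simp add: \<beta>_def log_inv_pow_def sum_divide_distrib)
    qed
  qed
qed

lemma mcball_in_sets:
  assumes "Metric_space U d" "\<mu> \<in> prob_measures_on U d" 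
  shows "Metric_space.mcball U d x r \<in> sets \<mu>"
proof -
  interpret Metric_space U d by fact
  have "openin mtopology (U - mcball x r)"
    using closedin_mcball[of x r] by (simp add: closedin_def)
  then have "U - (U - mcball x r) \<in> sigma_sets U {V. openin mtopology V}"
    by (intro sigma_sets.Compl sigma_sets.Basic) simp
  moreover have "U - (U - mcball x r) = mcball x r" by (auto simp: mcball_def)
  ultimately show ?thesis using assms(2) by (simp add: prob_measures_on_def)
qed

text \<open>
  \<open>\<rho> n x\<close> is the radius at which the ball around \<open>x\<close> reaches mass \<open>2 ^ -2 ^ n\<close>; integrating
  the previous lemma bounds its weighted sum. Balls of slightly larger radius \<open>R n x\<close> have that mass,
  so a disjoint family of them has at most \<open>2 ^ 2 ^ n\<close> members, and selecting them by increasing radius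
  leaves every \<open>x\<close> within \<open>2 R n x\<close> of a chosen centre. The excess \<open>S / 4 ^ n\<close> of \<open>R n x\<close>
  over \<open>\<rho> n x\<close> spares the question whether the infimum is attained.
\<close>

lemma has_nets_of_measure:
  assumes met: "Metric_space U d" and F: "finite F" "F \<subseteq> U"
    and \<mu>: "\<mu> \<in> prob_measures_on U d" and \<alpha>: "1/2 \<le> \<alpha>" "\<alpha> \<le> 1" and S: "0 < S"
    and int: "\<And>x. x \<in> F \<Longrightarrow> (\<integral>\<^sup>+\<epsilon>\<in>{0<..}. log_inv_pow \<alpha> (measure \<mu> (Metric_space.mcball U d x \<epsilon>)) \<partial>lborel) \<le> ennreal S"
  shows "has_nets d (2 powr \<alpha>) M F (20 * S)"
proof -
  interpret Metric_space U d by fact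
  interpret \<mu>: prob_space \<mu> using \<mu> by (simp add: prob_measures_on_def)
  note [measurable] = mcball_in_sets[OF met \<mu>]
  define \<beta> where "\<beta> = 2 powr \<alpha>"
  have \<beta>: "1 \<le> \<beta>" "\<beta> \<le> 2"
    using \<alpha> powr_mono[of \<alpha> 1 2] by (auto simp: \<beta>_def ge_one_powr_ge_zero)
  define E where "E n x = {\<epsilon>. 0 < \<epsilon> \<and> measure \<mu> (mcball x \<epsilon>) < 1 / 2 ^ 2 ^ n}" for n x
  have mono: "measure \<mu> (mcball x \<epsilon>) \<le> measure \<mu> (mcball x \<delta>)" if "\<epsilon> \<le> \<delta>" for x \<epsilon> \<delta>
  proof (rule \<mu>.finite_measure_mono)
    show "mcball x \<epsilon> \<subseteq> mcball x \<delta>" using that by (auto simp: mcball_def)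
  qed (rule mcball_in_sets[OF met \<mu>])
  have "is_interval (E n x)" for n x
    unfolding is_interval_1 E_def using mono by (auto intro: le_less_trans)
  then have Em [measurable]: "E n x \<in> sets borel" for n x by (rule real_interval_borel_measurable)
  have sumE: "(\<Sum>n<M. ennreal (\<beta> ^ n / 8) * emeasure lborel (E n x)) \<le> ennreal S" if x: "x \<in> F" for x
  proof -
    have "(\<Sum>n<M. ennreal (\<beta> ^ n / 8) * emeasure lborel (E n x))
        = (\<integral>\<^sup>+\<epsilon>. (\<Sum>n<M. ennreal (\<beta> ^ n / 8) * indicator (E n x) \<epsilon>) \<partial>lborel)"
      by (subst nn_integral_sum) (auto simp: nn_integral_cmult_indicator)
    also have "\<dots> \<le> (\<integral>\<^sup>+\<epsilon>\<in>{0<..}. log_inv_pow \<alpha> (measure \<mu> (mcball x \<epsilon>)) \<partial>lborel)"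
    proof (rule nn_integral_mono)
      fix \<epsilon> :: real
      show "(\<Sum>n<M. ennreal (\<beta> ^ n / 8) * indicator (E n x) \<epsilon>)
          \<le> log_inv_pow \<alpha> (measure \<mu> (mcball x \<epsilon>)) * indicator {0<..} \<epsilon>"
      proof (cases "0 < \<epsilon>")
        case True
        define p where "p = measure \<mu> (mcball x \<epsilon>)"
        have "(\<Sum>n<M. ennreal (\<beta> ^ n / 8) * indicator (E n x) \<epsilon>)
            = (\<Sum>n\<in>{..<M}. if p < 1 / 2 ^ 2 ^ n then ennreal (\<beta> ^ n / 8) else 0)"
          using True by (intro sum.cong) (auto simp: E_def p_def)
        also have "\<dots> = (\<Sum>n\<in>{n. n < M \<and> p < 1 / 2 ^ 2 ^ n}. ennreal (\<beta> ^ n / 8))"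
          by (subst sum.inter_filter[symmetric]) (auto intro!: sum.cong)
        also have "\<dots> = ennreal (\<Sum>n\<in>{n. n < M \<and> p < 1 / 2 ^ 2 ^ n}. \<beta> ^ n / 8)"
          using \<beta> by (intro sum_ennreal) auto
        also have "\<dots> \<le> log_inv_pow \<alpha> p"
          unfolding \<beta>_def by (rule sum_scales_le_log_inv_pow[OF \<alpha>]) (simp add: p_def)
        finally show ?thesis using True by (simp add: p_def)
      qed (auto simp: E_def)
    qed
    also have "\<dots> \<le> ennreal S" by (rule int[OF x])
    finally show ?thesis .
  qed
  define \<rho> where "\<rho> n x = measure lborel (E n x)" for n x
  have emE: "emeasure lborel (E n x) = ennreal (\<rho> n x)" if "x \<in> F" "n < M" for n x
  proof -
    have "ennreal (\<beta> ^ n / 8) * emeasure lborel (E n x) \<le> (\<Sum>n<M. ennreal (\<beta> ^ n / 8) * emeasure lborel (E n x))"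
      using that by (intro member_le_sum) auto
    also have "\<dots> < \<infinity>" using sumE[OF that(1)] by (simp add: le_less_trans)
    finally have "emeasure lborel (E n x) \<noteq> \<infinity>"
      using \<beta> by (auto simp: ennreal_mult_eq_top_iff)
    then show ?thesis unfolding \<rho>_def by (intro emeasure_eq_ennreal_measure) auto
  qed
  have sum\<rho>: "(\<Sum>n<M. \<beta> ^ n * \<rho> n x) \<le> 8 * S" if "x \<in> F" for x
  proof -
    have "ennreal (\<Sum>n<M. \<beta> ^ n / 8 * \<rho> n x) = (\<Sum>n<M. ennreal (\<beta> ^ n / 8 * \<rho> n x))"
      using \<beta> by (intro sum_ennreal[symmetric]) (auto simp: \<rho>_def)
    also have "\<dots> = (\<Sum>n<M. ennreal (\<beta> ^ n / 8) * emeasure lborel (E n x))"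
    proof (rule sum.cong)
      fix n assume "n \<in> {..<M}"
      then show "ennreal (\<beta> ^ n / 8 * \<rho> n x) = ennreal (\<beta> ^ n / 8) * emeasure lborel (E n x)"
        using \<beta> that emE[of x n] by (subst ennreal_mult) (auto simp: \<rho>_def)
    qed simp
    also have "\<dots> \<le> ennreal S" by (rule sumE[OF that])
    finally have "(\<Sum>n<M. \<beta> ^ n / 8 * \<rho> n x) \<le> S" using S by (simp add: ennreal_le_iff)
    then show ?thesis by (simp add: sum_divide_distrib[symmetric])
  qed
  define R where "R n x = \<rho> n x + S / 4 ^ n" for n x
  have R: "1 / 2 ^ 2 ^ n \<le> measure \<mu> (mcball x (R n x))" "0 < R n x" if "x \<in> F" "n < M" for n x
  proof -
    show R0: "0 < R n x" using S by (simp add: R_def \<rho>_def add_nonneg_pos)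
    show "1 / 2 ^ 2 ^ n \<le> measure \<mu> (mcball x (R n x))"
    proof (rule ccontr)
      assume "\<not> ?thesis"
      then have lt: "measure \<mu> (mcball x (R n x)) < 1 / 2 ^ 2 ^ n" by simp
      have "{0<..R n x} \<subseteq> E n x"
      proof
        fix z assume "z \<in> {0<..R n x}"
        then show "z \<in> E n x" using mono[of z "R n x" x] lt by (simp add: E_def)
      qed
      then have "emeasure lborel {0<..R n x} \<le> emeasure lborel (E n x)" by (intro emeasure_mono) auto
      then have "ennreal (R n x) \<le> ennreal (\<rho> n x)" using R0 emE[OF that] by simp
      then show False using S by (simp add: R_def \<rho>_def ennreal_le_iff)
    qed
  qed
  have "\<exists>\<pi>. n < M \<longrightarrow> \<pi> ` F \<subseteq> F \<and> card (\<pi> ` F) \<le> 2 ^ 2 ^ n \<and> (\<forall>x\<in>F. d x (\<pi> x) \<le> 2 * R n x)" for n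
  proof (cases "n < M")
    case n: True
    define B where "B x = mcball x (R n x)" for x
    obtain P where P: "P \<subseteq> F" "\<forall>p\<in>P. \<forall>q\<in>P. p \<noteq> q \<longrightarrow> B p \<inter> B q = {}"
      "\<forall>x\<in>F. \<exists>p\<in>P. R n p \<le> R n x \<and> (x = p \<or> B x \<inter> B p \<noteq> {})"
      using disjoint_selection[OF F(1), of B "R n"] by blast
    have finP: "finite P" using P(1) F finite_subset by blast
    have "card P * (1 / 2 ^ 2 ^ n) \<le> (\<Sum>p\<in>P. measure \<mu> (B p))"
      using sum_mono[of P "\<lambda>_. 1 / 2 ^ 2 ^ n" "\<lambda>p. measure \<mu> (B p)"] R(1)[OF _ n] P(1) by (auto simp: B_def)
    also have "\<dots> = measure \<mu> (\<Union>p\<in>P. B p)"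
      using P(2) by (intro \<mu>.finite_measure_finite_Union[symmetric] finP)
        (auto simp: B_def disjoint_family_on_def)
    also have "\<dots> \<le> 1" by (rule \<mu>.prob_le_1)
    finally have "real (card P) \<le> 2 ^ 2 ^ n" by (simp add: field_simps)
    then have cardP: "card P \<le> 2 ^ 2 ^ n" by (metis of_nat_le_iff of_nat_numeral of_nat_power)
    obtain \<pi> where \<pi>: "\<And>x. x \<in> F \<Longrightarrow> \<pi> x \<in> P \<and> R n (\<pi> x) \<le> R n x \<and> (x = \<pi> x \<or> B x \<inter> B (\<pi> x) \<noteq> {})"
      using P(3) by metis
    have "d x (\<pi> x) \<le> 2 * R n x" if x: "x \<in> F" for x
    proof (cases "x = \<pi> x")
      case True
      then show ?thesis using R(2)[OF x n] F x by (metis less_imp_le mdist_zero mult_nonneg_nonneg subsetD zero_le_numeral)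
    next
      case False
      then obtain z where z: "z \<in> B x" "z \<in> B (\<pi> x)" using \<pi>[OF x] by blast
      then have "d x z \<le> R n x" "d (\<pi> x) z \<le> R n (\<pi> x)" "x \<in> U" "\<pi> x \<in> U" "z \<in> U"
        by (auto simp: B_def)
      then show ?thesis using triangle[of x z "\<pi> x"] commute[of z "\<pi> x"] \<pi>[OF x] by linarith
    qed
    moreover have "\<pi> ` F \<subseteq> P" using \<pi> by auto
    then have "card (\<pi> ` F) \<le> 2 ^ 2 ^ n" using card_mono[OF finP] cardP order_trans by blast
    ultimately show ?thesis using \<open>\<pi> ` F \<subseteq> P\<close> P(1) by blast
  qed auto
  then obtain \<pi> where \<pi>: "\<And>n. n < M \<Longrightarrow> \<pi> n ` F \<subseteq> F" "\<And>n. n < M \<Longrightarrow> card (\<pi> n ` F) \<le> 2 ^ 2 ^ n"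
    "\<And>n x. n < M \<Longrightarrow> x \<in> F \<Longrightarrow> d x (\<pi> n x) \<le> 2 * R n x" by metis
  have "(\<Sum>n<M. \<beta> ^ n * d x (\<pi> n x)) \<le> 20 * S" if x: "x \<in> F" for x
  proof -
    have "(\<Sum>n<M. \<beta> ^ n * d x (\<pi> n x)) \<le> (\<Sum>n<M. \<beta> ^ n * (2 * R n x))"
      using \<pi>(3) x \<beta> by (intro sum_mono mult_left_mono) auto
    also have "\<dots> = 2 * (\<Sum>n<M. \<beta> ^ n * \<rho> n x) + 2 * S * (\<Sum>n<M. (\<beta> / 4) ^ n)"
      by (simp add: R_def sum_distrib_left sum.distrib[symmetric] power_divide algebra_simps)
    also have "\<dots> \<le> 2 * (8 * S) + 2 * S * (\<Sum>n<M. (1 / 2) ^ n)"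
      using sum\<rho>[OF x] S \<beta> by (intro add_mono mult_left_mono sum_mono power_mono) auto
    also have "\<dots> \<le> 2 * (8 * S) + 2 * S * 2"
      using S by (intro add_mono mult_left_mono geometric_sum_half_le) auto
    finally show ?thesis by simp
  qed
  then show ?thesis unfolding has_nets_def \<beta>_def using \<pi> by blast
qed


section \<open>From nets to a majorizing measure\<close>

text \<open>
  On a finite metric space every set is Borel, so any point weights define an admissible measure.
\<close>

lemma finite_metric_openin:
  assumes "Metric_space U d" "finite U"
  shows "{V. openin (Metric_space.mtopology U d) V} = Pow U"
proof -
  interpret Metric_space U d by fact
  have closed: "closedin mtopology A" if "A \<subseteq> U" for A
  proof -
    have "closedin mtopology (\<Union>x\<in>A. mcball x 0)"
      using that assms(2) finite_subset by (intro closedin_Union) auto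
    moreover have "mcball x 0 = {x}" if "x \<in> A" for x
    proof -
      have "x \<in> U" using that \<open>A \<subseteq> U\<close> by blast
      moreover have "y = x" if "y \<in> U" "d x y \<le> 0" for y
        using zero[OF \<open>x \<in> U\<close> that(1)] nonneg[of x y] that(2) by simp
      ultimately show ?thesis by (auto simp: mcball_def)
    qed
    then have "(\<Union>x\<in>A. mcball x 0) = A" by simp
    ultimately show ?thesis by simp
  qed
  have "openin mtopology V" if "V \<subseteq> U" for V
    using closed[of "U - V"] that by (simp add: closedin_def double_diff)
  then show ?thesis using openin_subset[of mtopology] by auto
qed

text \<open>
  Give the \<open>n\<close>-th net total mass \<open>2 ^ -(n+1)\<close>, equally distributed, and put the leftover mass at an
  arbitrary point. A ball around \<open>x\<close> reaching the \<open>n\<close>-th net has mass at least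
  \<open>2 ^ -2 ^ (n+3)\<close>. For a radius \<open>\<epsilon> < S\<close> let \<open>n\<close> be the first net reached; then the integrand
  is of order \<open>(2 powr \<alpha>) ^ n\<close>, and if \<open>n > 0\<close> the net before was not reached, so the set of
  such radii has length at most \<open>d x (v (n-1) x)\<close>. From the diameter on, the ball has full mass and the
  integrand vanishes.
\<close>

lemma gamma_fun_le_of_nets:
  assumes met: "Metric_space U d" and U: "finite U" "U \<noteq> {}" and \<alpha>: "1/2 \<le> \<alpha>" "\<alpha> \<le> 1"
    and V: "\<And>n. n \<le> M \<Longrightarrow> V n \<subseteq> U \<and> card (V n) \<le> 2 ^ 2 ^ (n + 2)"
    and v: "\<And>n x. n \<le> M \<Longrightarrow> x \<in> U \<Longrightarrow> v n x \<in> V n" "\<And>x. x \<in> U \<Longrightarrow> v M x = x"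
    and diam: "\<And>x y. x \<in> U \<Longrightarrow> y \<in> U \<Longrightarrow> d x y \<le> S"
    and sum: "\<And>x. x \<in> U \<Longrightarrow> (\<Sum>n<M. (2 powr \<alpha>) ^ n * d x (v n x)) \<le> S"
  shows "gamma_fun \<alpha> U d \<le> ennreal (24 * S)"
proof -
  interpret Metric_space U d by fact
  define \<beta> where "\<beta> = 2 powr \<alpha>"
  have \<beta>: "1 \<le> \<beta>" "\<beta> \<le> 2"
    using \<alpha> powr_mono[of \<alpha> 1 2] by (auto simp: \<beta>_def ge_one_powr_ge_zero)
  obtain x0 where x0: "x0 \<in> U" using U by auto
  have S: "0 \<le> S" using diam[OF x0 x0] x0 by simp
  define w where "w n x = (if x \<in> V n then (1/2) ^ Suc n / card (V n) else 0)" for n x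
  define f where "f x = (\<Sum>n\<le>M. w n x) + (if x = x0 then (1/2) ^ Suc M else 0)" for x :: 'a
  have w0: "0 \<le> w n x" for n x by (simp add: w_def)
  have f0: "0 \<le> f x" for x unfolding f_def using w0 by (intro add_nonneg_nonneg sum_nonneg) auto
  have w_sum: "(\<Sum>x\<in>U. w n x) = (1/2) ^ Suc n" if n: "n \<le> M" for n
  proof -
    have fin: "finite (V n)" using V[OF n] U finite_subset by blast
    have ne: "V n \<noteq> {}" using v(1)[OF n x0] by auto
    have "(\<Sum>x\<in>U. w n x) = (\<Sum>x\<in>V n. (1/2) ^ Suc n / card (V n))"
      unfolding w_def using V[OF n] U by (simp add: sum.inter_restrict[symmetric] Int_absorb1)
    then show ?thesis using fin ne by simp
  qed
  have "(\<Sum>x\<in>U. f x) = (\<Sum>n\<le>M. (1/2) ^ Suc n) + (1/2) ^ Suc M"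
    unfolding f_def sum.distrib
    by (subst sum.swap) (use x0 U in \<open>simp add: w_sum del: power_Suc\<close>)
  also have "\<dots> = 1" by (induction M) auto
  finally have f1: "(\<Sum>x\<in>U. f x) = 1" .
  define \<mu> where "\<mu> = point_measure U (\<lambda>x. ennreal (f x))"
  have em: "emeasure \<mu> A = ennreal (\<Sum>x\<in>A. f x)" if "A \<subseteq> U" for A
    unfolding \<mu>_def using that U f0 by (subst emeasure_point_measure_finite) auto
  then have meas: "measure \<mu> A = (\<Sum>x\<in>A. f x)" if "A \<subseteq> U" for A
    using that f0 by (simp add: measure_def sum_nonneg)
  have prob: "\<mu> \<in> prob_measures_on U d"
    unfolding prob_measures_on_def
  proof (intro CollectI conjI)
    have sp: "space \<mu> = U" by (simp add: \<mu>_def space_point_measure)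
    then show "space \<mu> = U" .
    show "prob_space \<mu>" by (rule prob_spaceI) (simp add: sp em f1)
    show "sets \<mu> = sigma_sets U {V. openin mtopology V}"
      unfolding finite_metric_openin[OF met U(1)]
      by (simp add: \<mu>_def sets_point_measure sigma_algebra.sigma_sets_eq[OF sigma_algebra_Pow])
  qed
  have ball_mass: "1 / 2 ^ 2 ^ (n + 3) \<le> measure \<mu> (mcball x \<epsilon>)"
    if n: "n \<le> M" and x: "x \<in> U" and \<epsilon>: "d x (v n x) \<le> \<epsilon>" for n x \<epsilon>
  proof -
    have vU: "v n x \<in> U" "v n x \<in> V n" using v(1)[OF n x] V[OF n] by auto
    have fin: "finite (V n)" using V[OF n] U finite_subset by blast
    have c: "0 < card (V n)" using vU fin by (auto simp: card_gt_0_iff)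
    have "n + 1 \<le> 2 ^ (n + 2)"
      using less_exp[of "n + 2"] by linarith
    then have "2 ^ (n + 1) * 2 ^ 2 ^ (n + 2) \<le> (2::real) ^ 2 ^ (n + 2) * 2 ^ 2 ^ (n + 2)"
      by (intro mult_right_mono power_increasing) auto
    also have "\<dots> = 2 ^ 2 ^ (n + 3)" by (simp add: power_add[symmetric] eval_nat_numeral)
    finally have le: "2 ^ (n + 1) * 2 ^ 2 ^ (n + 2) \<le> (2::real) ^ 2 ^ (n + 3)" .
    have "2 ^ (n + 1) * real (card (V n)) \<le> 2 ^ (n + 1) * 2 ^ 2 ^ (n + 2)"
      using V[OF n] by (intro mult_left_mono) (metis of_nat_le_iff of_nat_numeral of_nat_power, simp)
    then have "2 ^ (n + 1) * real (card (V n)) \<le> 2 ^ 2 ^ (n + 3)" using le by (rule order_trans)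
    then have "1 / 2 ^ 2 ^ (n + 3) \<le> 1 / (2 ^ (n + 1) * real (card (V n)))"
      by (rule divide_left_mono) (use c in auto)
    also have "\<dots> = w n (v n x)" using vU by (simp add: w_def power_divide)
    also have "\<dots> \<le> (\<Sum>k\<le>M. w k (v n x))" using w0 n by (intro member_le_sum) auto
    also have "\<dots> \<le> f (v n x)" by (simp add: f_def)
    also have "\<dots> \<le> (\<Sum>y\<in>mcball x \<epsilon>. f y)"
      using f0 U x vU \<epsilon> by (intro member_le_sum) (auto simp: mcball_def)
    also have "\<dots> = measure \<mu> (mcball x \<epsilon>)" by (subst meas) (auto simp: mcball_def)
    finally show ?thesis .
  qed
  have log_le: "log_inv_pow \<alpha> p \<le> ennreal (8 * \<beta> ^ n)" if p: "1 / 2 ^ 2 ^ (n + 3) \<le> p" "p \<le> 1" for p n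
  proof -
    have p0: "0 < p" by (rule less_le_trans[OF _ p(1)]) simp
    have "ln (1 / p) \<le> ln (2 ^ 2 ^ (n + 3))"
      using p p0 by (subst ln_le_cancel_iff) (auto simp: field_simps)
    also have "\<dots> = 2 ^ (n + 3) * ln 2" by (subst ln_realpow) auto
    also have "\<dots> \<le> 2 ^ (n + 3)" using ln2_bounds by simp
    finally have "ln (1 / p) powr \<alpha> \<le> (2 ^ (n + 3)) powr \<alpha>"
      using p p0 \<alpha> by (intro powr_mono2) auto
    also have "\<dots> = \<beta> ^ (n + 3)"
      by (simp add: \<beta>_def powr_realpow[symmetric] powr_powr mult.commute)
    also have "\<dots> \<le> \<beta> ^ n * 2 ^ 3" unfolding power_add using \<beta> by (intro mult_left_mono power_mono) auto
    finally show ?thesis using p0 by (auto simp: log_inv_pow_def intro!: ennreal_leI)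
  qed
  have "(\<integral>\<^sup>+\<epsilon>\<in>{0<..}. log_inv_pow \<alpha> (measure \<mu> (mcball x \<epsilon>)) \<partial>lborel) \<le> ennreal (24 * S)"
    if x: "x \<in> U" for x
  proof -
    define g where "g \<epsilon> = ennreal 8 * indicator {0<..<S} \<epsilon>
        + (\<Sum>n<M. ennreal (8 * \<beta> ^ Suc n) * indicator {0<..<d x (v n x)} \<epsilon>)" for \<epsilon> :: real
    have term_le: "ennreal (8 * \<beta> ^ Suc n) * indicator {0<..<d x (v n x)} \<epsilon> \<le> g \<epsilon>" if "n < M" for n \<epsilon>
    proof -
      have "ennreal (8 * \<beta> ^ Suc n) * indicator {0<..<d x (v n x)} \<epsilon>
        \<le> (\<Sum>n<M. ennreal (8 * \<beta> ^ Suc n) * indicator {0<..<d x (v n x)} \<epsilon>)"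
        using that by (intro member_le_sum) auto
      also have "\<dots> \<le> g \<epsilon>" unfolding g_def by (rule add_increasing) auto
      finally show ?thesis .
    qed
    have pt: "log_inv_pow \<alpha> (measure \<mu> (mcball x \<epsilon>)) * indicator {0<..} \<epsilon> \<le> g \<epsilon>" for \<epsilon>
    proof (cases "0 < \<epsilon>")
      case \<epsilon>: True
      have p1: "measure \<mu> (mcball x \<epsilon>) \<le> 1"
        using prob by (auto simp: prob_measures_on_def intro: prob_space.prob_le_1)
      show ?thesis
      proof (cases "S \<le> \<epsilon>")
        case True
        then have "mcball x \<epsilon> = U" using x diam[OF x] by (force simp: mcball_def)
        then have "measure \<mu> (mcball x \<epsilon>) = 1" by (simp add: meas f1)
        then show ?thesis by (simp add: log_inv_pow_def)
      next
        case False
        define n where "n = (LEAST n. d x (v n x) \<le> \<epsilon>)"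
        have ex: "d x (v M x) \<le> \<epsilon>" using v(2)[OF x] x \<epsilon> by simp
        have n: "d x (v n x) \<le> \<epsilon>" "n \<le> M"
          unfolding n_def using ex by (auto intro: LeastI Least_le)
        have le: "log_inv_pow \<alpha> (measure \<mu> (mcball x \<epsilon>)) \<le> ennreal (8 * \<beta> ^ n)"
          by (rule log_le[OF ball_mass[OF n(2) x n(1)] p1])
        show ?thesis
        proof (cases n)
          case 0
          have "ennreal 8 \<le> g \<epsilon>" unfolding g_def using False \<epsilon> by simp
          then show ?thesis using le 0 \<epsilon> by simp
        next
          case (Suc k)
          then have "\<epsilon> < d x (v k x)" using not_less_Least[of k "\<lambda>n. d x (v n x) \<le> \<epsilon>"] by (simp add: n_def)
          then have "ennreal (8 * \<beta> ^ n) \<le> g \<epsilon>" using term_le[of k \<epsilon>] Suc n(2) \<epsilon> by simp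
          then show ?thesis using le \<epsilon> by simp
        qed
      qed
    qed simp
    have "(\<integral>\<^sup>+\<epsilon>\<in>{0<..}. log_inv_pow \<alpha> (measure \<mu> (mcball x \<epsilon>)) \<partial>lborel) \<le> (\<integral>\<^sup>+\<epsilon>. g \<epsilon> \<partial>lborel)"
      by (intro nn_integral_mono pt)
    also have "\<dots> = (\<integral>\<^sup>+\<epsilon>. ennreal 8 * indicator {0<..<S} \<epsilon> \<partial>lborel)
        + (\<integral>\<^sup>+\<epsilon>. (\<Sum>n<M. ennreal (8 * \<beta> ^ Suc n) * indicator {0<..<d x (v n x)} \<epsilon>) \<partial>lborel)"
      unfolding g_def by (rule nn_integral_add) measurable
    also have "(\<integral>\<^sup>+\<epsilon>. (\<Sum>n<M. ennreal (8 * \<beta> ^ Suc n) * indicator {0<..<d x (v n x)} \<epsilon>) \<partial>lborel)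
        = (\<Sum>n<M. \<integral>\<^sup>+\<epsilon>. ennreal (8 * \<beta> ^ Suc n) * indicator {0<..<d x (v n x)} \<epsilon> \<partial>lborel)"
      by (rule nn_integral_sum) measurable
    also have "(\<integral>\<^sup>+\<epsilon>. ennreal 8 * indicator {0<..<S} \<epsilon> \<partial>lborel) = ennreal 8 * ennreal S"
      using S by (subst nn_integral_cmult_indicator) simp_all
    also have "(\<Sum>n<M. \<integral>\<^sup>+\<epsilon>. ennreal (8 * \<beta> ^ Suc n) * indicator {0<..<d x (v n x)} \<epsilon> \<partial>lborel)
        = (\<Sum>n<M. ennreal (8 * \<beta> ^ Suc n) * ennreal (d x (v n x)))"
      by (intro sum.cong refl, subst nn_integral_cmult_indicator) simp_all
    also have "ennreal 8 * ennreal S + (\<Sum>n<M. ennreal (8 * \<beta> ^ Suc n) * ennreal (d x (v n x)))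
        = ennreal (8 * S + (\<Sum>n<M. 8 * \<beta> ^ Suc n * d x (v n x)))"
    proof -
      have "(\<Sum>n<M. ennreal (8 * \<beta> ^ Suc n) * ennreal (d x (v n x))) = ennreal (\<Sum>n<M. 8 * \<beta> ^ Suc n * d x (v n x))"
        using \<beta> by (subst sum_ennreal[symmetric]) (auto simp: ennreal_mult)
      moreover have "0 \<le> (\<Sum>n<M. 8 * \<beta> ^ Suc n * d x (v n x))" using \<beta> by (intro sum_nonneg) auto
      moreover have "ennreal 8 * ennreal S = ennreal (8 * S)" using S by (subst ennreal_mult) simp_all
      ultimately show ?thesis using S by (simp only: ennreal_plus mult_nonneg_nonneg zero_le_numeral)
    qed
    also have "\<dots> \<le> ennreal (24 * S)"
    proof (rule ennreal_leI)
      have "(\<Sum>n<M. 8 * \<beta> ^ Suc n * d x (v n x)) = 8 * \<beta> * (\<Sum>n<M. \<beta> ^ n * d x (v n x))"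
        by (simp add: sum_distrib_left mult_ac)
      also have "\<dots> \<le> 8 * 2 * S"
        using sum[OF x] \<beta> by (intro mult_mono sum_nonneg) (auto simp: \<beta>_def)
      finally show "8 * S + (\<Sum>n<M. 8 * \<beta> ^ Suc n * d x (v n x)) \<le> 24 * S" by simp
    qed
    finally show ?thesis .
  qed
  then have "(SUP x\<in>U. \<integral>\<^sup>+\<epsilon>\<in>{0<..}. log_inv_pow \<alpha> (measure \<mu> (mcball x \<epsilon>)) \<partial>lborel) \<le> ennreal (24 * S)"
    by (rule SUP_least)
  then show ?thesis unfolding gamma_fun_def by (rule INF_lower2[OF prob])
qed


lemma gamma_fun_le_of_has_nets:
  assumes met: "Metric_space U d" and U: "finite U" "U \<noteq> {}" and \<alpha>: "1/2 \<le> \<alpha>" "\<alpha> \<le> 1"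
    and nets: "has_nets d (2 powr \<alpha>) M U S" and card: "card U \<le> 2 ^ 2 ^ M"
    and diam: "\<And>x y. x \<in> U \<Longrightarrow> y \<in> U \<Longrightarrow> d x y \<le> S"
  shows "gamma_fun \<alpha> U d \<le> ennreal (24 * S)"
proof -
  obtain \<pi> where \<pi>: "\<And>n. n < M \<Longrightarrow> \<pi> n ` U \<subseteq> U \<and> card (\<pi> n ` U) \<le> 2 ^ 2 ^ n"
    "\<And>x. x \<in> U \<Longrightarrow> (\<Sum>n<M. (2 powr \<alpha>) ^ n * d x (\<pi> n x)) \<le> S"
    using nets unfolding has_nets_def by blast
  define v where "v n x = (if n < M then \<pi> n x else x)" for n x
  show ?thesis
  proof (rule gamma_fun_le_of_nets[OF met U \<alpha>, where v = v and M = M and V = "\<lambda>n. v n ` U"])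
    fix n assume n: "n \<le> M"
    have "v n ` U \<subseteq> U \<and> card (v n ` U) \<le> 2 ^ 2 ^ n"
      using \<pi>(1)[of n] card n by (cases "n < M") (auto simp: v_def)
    moreover have "(2::nat) ^ 2 ^ n \<le> 2 ^ 2 ^ (n + 2)" by (intro power_increasing) auto
    ultimately show "v n ` U \<subseteq> U \<and> card (v n ` U) \<le> 2 ^ 2 ^ (n + 2)" using order_trans by blast
  qed (use \<pi>(2) diam in \<open>auto simp: v_def\<close>)
qed

section \<open>Splitting the links of a chain by size\<close>

lemma dist_inf_le_dist_2: "dist_inf N s t \<le> dist_2 N s t"
proof (rule dist_inf_le)
  fix i assume "i < N"
  then show "\<bar>s i - t i\<bar> \<le> dist_2 N s t"
    unfolding dist_2_def L2_set_def by (intro real_le_rsqrt) (auto intro!: member_le_sum)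
qed simp

lemma dist_inf_triangle: "dist_inf N x z \<le> dist_inf N x y + dist_inf N y z"
proof (rule dist_inf_le)
  fix i assume "i < N"
  then show "\<bar>x i - z i\<bar> \<le> dist_inf N x y + dist_inf N y z"
    using abs_le_dist_inf[of i N x y] abs_le_dist_inf[of i N y z] by linarith
qed simp

text \<open>
  The coordinates of a link at level \<open>k\<close> that are small enough to be kept; they are cut at
  \<open>sqrt 2 ^ -k\<close> times the Euclidean norm.
\<close>

definition flat_part :: "nat \<Rightarrow> nat \<Rightarrow> (nat \<Rightarrow> real) \<Rightarrow> nat \<Rightarrow> real" where
  "flat_part N k v = (\<lambda>i. if sqrt 2 ^ k * \<bar>v i\<bar> \<le> sqrt (sq_norm N v) then v i else 0)"

text \<open>
  For the last bound: a removed coordinate satisfies \<open>\<bar>v i\<bar> \<le> sqrt 2 ^ k (v i)\<^sup>2 / \<parallel>v\<parallel>\<close>.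
\<close>

lemma flat_part_props:
  shows "sqrt (sq_norm N (flat_part N k v)) \<le> sqrt (sq_norm N v)"
    and "sqrt 2 ^ k * \<bar>flat_part N k v i\<bar> \<le> sqrt (sq_norm N v)"
    and "(\<Sum>i<N. \<bar>v i - flat_part N k v i\<bar>) \<le> sqrt 2 ^ k * sqrt (sq_norm N v)"
proof -
  show "sqrt (sq_norm N (flat_part N k v)) \<le> sqrt (sq_norm N v)"
    unfolding sq_norm_def flat_part_def by (intro real_sqrt_le_mono sum_mono) auto
  show "sqrt 2 ^ k * \<bar>flat_part N k v i\<bar> \<le> sqrt (sq_norm N v)"
    by (auto simp: flat_part_def)
  define s where "s = sqrt (sq_norm N v)"
  have s0: "0 \<le> s" and s2: "s * s = sq_norm N v" by (simp_all add: s_def)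
  show "(\<Sum>i<N. \<bar>v i - flat_part N k v i\<bar>) \<le> sqrt 2 ^ k * sqrt (sq_norm N v)"
  proof (cases "s = 0")
    case True
    then have "sq_norm N v = 0" by (simp add: s_def)
    then have "v i = 0" if "i < N" for i using that
      unfolding sq_norm_def by (subst (asm) sum_nonneg_eq_0_iff) auto
    then have "(\<Sum>i<N. \<bar>v i - flat_part N k v i\<bar>) = 0"
      by (intro sum.neutral) (auto simp: flat_part_def)
    then show ?thesis by simp
  next
    case False
    then have s: "0 < s" using s0 by simp
    have "\<bar>v i - flat_part N k v i\<bar> \<le> sqrt 2 ^ k / s * (v i)\<^sup>2" for i
    proof (cases "sqrt 2 ^ k * \<bar>v i\<bar> \<le> s")
      case True
      then have "\<bar>v i - flat_part N k v i\<bar> = 0" by (simp add: flat_part_def s_def)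
      then show ?thesis using s by simp
    next
      case False
      then have "s * \<bar>v i\<bar> \<le> (sqrt 2 ^ k * \<bar>v i\<bar>) * \<bar>v i\<bar>" by (intro mult_right_mono) auto
      also have "\<dots> = sqrt 2 ^ k * (v i)\<^sup>2" by (simp add: power2_eq_square mult.assoc)
      finally have "\<bar>v i\<bar> \<le> sqrt 2 ^ k / s * (v i)\<^sup>2" using s by (simp add: field_simps)
      then show ?thesis using False by (simp add: flat_part_def s_def)
    qed
    then have "(\<Sum>i<N. \<bar>v i - flat_part N k v i\<bar>) \<le> (\<Sum>i<N. sqrt 2 ^ k / s * (v i)\<^sup>2)"
      by (rule sum_mono)
    also have "\<dots> = sqrt 2 ^ k / s * (s * s)" by (simp add: s2 sq_norm_def sum_distrib_left)
    also have "\<dots> = sqrt 2 ^ k * s" using s by simp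
    finally show ?thesis by (simp add: s_def)
  qed
qed

text \<open>
  Exchange the sums; the geometric sum over \<open>n \<le> k\<close> is dominated by its last term. This is why
  distances to the \<open>n\<close>-th partial chain, which are tails of the chain, cost at most four times as much as the links.
\<close>

lemma sum_weighted_tails_le:
  fixes e :: "nat \<Rightarrow> real"
  assumes \<beta>: "4/3 \<le> \<beta>" and e: "\<And>k. 0 \<le> e k" and m: "m \<le> M"
  shows "(\<Sum>n<M. \<beta> ^ n * (\<Sum>k\<in>{n..<m}. e k)) \<le> 4 * (\<Sum>k<M. \<beta> ^ k * e k)"
proof -
  have "(\<Sum>n<M. \<beta> ^ n * (\<Sum>k\<in>{n..<m}. e k)) = (\<Sum>n<M. \<Sum>k<m. if n \<le> k then \<beta> ^ n * e k else 0)"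
  proof (rule sum.cong)
    fix n
    have "(\<Sum>k\<in>{n..<m}. \<beta> ^ n * e k) = (\<Sum>k<m. if n \<le> k then \<beta> ^ n * e k else 0)"
      by (subst sum.inter_filter[symmetric]) (auto intro!: sum.cong)
    then show "\<beta> ^ n * (\<Sum>k\<in>{n..<m}. e k) = (\<Sum>k<m. if n \<le> k then \<beta> ^ n * e k else 0)"
      by (simp add: sum_distrib_left)
  qed simp
  also have "\<dots> = (\<Sum>k<m. \<Sum>n<M. if n \<le> k then \<beta> ^ n * e k else 0)" by (rule sum.swap)
  also have "\<dots> \<le> (\<Sum>k<m. 4 * (\<beta> ^ k * e k))"
  proof (rule sum_mono)
    fix k assume "k \<in> {..<m}"
    then have "(\<Sum>n<M. if n \<le> k then \<beta> ^ n * e k else 0) = (\<Sum>n\<le>k. \<beta> ^ n * e k)"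
      using m by (subst sum.inter_filter[symmetric]) (auto intro!: sum.cong)
    also have "\<dots> = (\<Sum>n\<le>k. \<beta> ^ n) * e k" by (simp add: sum_distrib_right)
    also have "\<dots> \<le> 4 * \<beta> ^ k * e k" using \<beta> e by (intro mult_right_mono sum_geometric_le) auto
    finally show "(\<Sum>n<M. if n \<le> k then \<beta> ^ n * e k else 0) \<le> 4 * (\<beta> ^ k * e k)" by simp
  qed
  also have "\<dots> \<le> (\<Sum>k<M. 4 * (\<beta> ^ k * e k))"
    using m \<beta> e by (intro sum_mono2) auto
  finally show ?thesis by (simp add: sum_distrib_left)
qed


text \<open>
  \<open>w n x\<close> is the chain of \<open>x\<close> followed up to level \<open>n\<close> with every link replaced by its flat part. The
  set \<open>W\<close> contains all partial chains: the \<open>n\<close>-th net consists of the partial chains of length at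
  most \<open>n\<close>, and the distance of \<open>w m x\<close> to it is bounded by a tail of the chain of that same
  \<open>x\<close>. There are few such points because \<open>w n x\<close> is determined by
  \<open>\<pi> 0 x, \<dots>, \<pi> n x\<close>, and \<open>2 ^ 2 ^ 0 * \<dots> * 2 ^ 2 ^ n \<le> 2 ^ 2 ^ (n+1)\<close>. Keeping the partial
  chains in the set, rather than only the full ones, avoids choosing representatives whose own tails
  would be uncontrolled.
\<close>

lemma truncated_chains:
  assumes F: "finite F" "F \<noteq> {}" "F \<subseteq> RN N" and card: "card F \<le> 2 ^ 2 ^ M"
    and diam: "\<And>x y. x \<in> F \<Longrightarrow> y \<in> F \<Longrightarrow> dist_2 N x y \<le> S"
    and nets: "has_nets (dist_2 N) (sqrt 2) M F S"
  shows "\<exists>W\<subseteq>RN N. (\<forall>x\<in>F. \<exists>w\<in>W. (\<Sum>i<N. \<bar>x i - w i\<bar>) \<le> 2 * S) \<and>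
    gamma_fun (1/2) W (dist_2 N) \<le> ennreal (192 * S) \<and> gamma_fun 1 W (dist_inf N) \<le> ennreal (192 * S)"
proof -
  define r where "r = sqrt (2::real)"
  have r: "4/3 \<le> r" "r * r = 2" unfolding r_def using sqrt2_ge by auto
  have r1: "1 \<le> r ^ n" for n using r by (simp add: one_le_power)
  obtain \<pi>0 where \<pi>0: "\<And>n. n < M \<Longrightarrow> \<pi>0 n ` F \<subseteq> F \<and> card (\<pi>0 n ` F) \<le> 2 ^ 2 ^ n"
    "\<And>x. x \<in> F \<Longrightarrow> (\<Sum>n<M. r ^ n * dist_2 N x (\<pi>0 n x)) \<le> S"
    using nets unfolding has_nets_def r_def by blast
  define \<pi> where "\<pi> n x = (if n < M then \<pi>0 n x else x)" for n x
  have \<pi>: "\<pi> n ` F \<subseteq> F" "n \<le> M \<Longrightarrow> card (\<pi> n ` F) \<le> 2 ^ 2 ^ n" for n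
    using \<pi>0(1)[of n] card by (cases "n < M"; auto simp: \<pi>_def)+
  have \<pi>F: "\<pi> n x \<in> F" if "x \<in> F" for n x using \<pi>(1)[of n] that by blast
  obtain x0 where x0: "x0 \<in> F" using F by auto
  have S: "0 \<le> S" using diam[OF x0 x0] by simp
  define a where "a k x = dist_2 N (\<pi> (Suc k) x) (\<pi> k x)" for k x
  have a0: "0 \<le> a k x" for k x by (simp add: a_def)
  have a_sum: "(\<Sum>k<M. r ^ k * a k x) \<le> 2 * S" if x: "x \<in> F" for x
  proof -
    define D where "D k = dist_2 N x (\<pi> k x)" for k
    have D0: "0 \<le> D k" for k by (simp add: D_def)
    have DS: "(\<Sum>k<M. r ^ k * D k) \<le> S" using \<pi>0(2)[OF x] by (simp add: D_def \<pi>_def)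
    have "(\<Sum>k<M. r ^ k * a k x) \<le> (\<Sum>k<M. r ^ k * D k + r ^ Suc k * D (Suc k))"
    proof (rule sum_mono)
      fix k
      have "a k x \<le> D (Suc k) + D k"
        using dist_2_triangle[of N "\<pi> (Suc k) x" "\<pi> k x" x] unfolding a_def D_def
        by (simp add: dist_2_commute)
      then have "r ^ k * a k x \<le> r ^ k * (D (Suc k) + D k)" using r by (intro mult_left_mono) auto
      also have "r ^ k * D (Suc k) \<le> r ^ Suc k * D (Suc k)"
        using r D0 by (intro mult_right_mono power_increasing) auto
      ultimately show "r ^ k * a k x \<le> r ^ k * D k + r ^ Suc k * D (Suc k)"
        by (simp add: distrib_left)
    qed
    also have "\<dots> = (\<Sum>k<M. r ^ k * D k) + (\<Sum>k<M. r ^ Suc k * D (Suc k))" by (rule sum.distrib)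
    also have "(\<Sum>k<M. r ^ Suc k * D (Suc k)) \<le> (\<Sum>k<Suc M. r ^ k * D k)"
      unfolding sum.lessThan_Suc_shift[of _ M] using D0 by simp
    also have "(\<Sum>k<Suc M. r ^ k * D k) = (\<Sum>k<M. r ^ k * D k)" by (simp add: D_def \<pi>_def)
    finally show ?thesis using DS by simp
  qed
  define v where "v k x = (\<lambda>i. \<pi> (Suc k) x i - \<pi> k x i)" for k x
  have av: "sqrt (sq_norm N (v k x)) = a k x" for k x by (simp add: a_def v_def dist_2_eq_sqrt)
  define w where "w n x = rec_nat (\<pi> 0 x) (\<lambda>k y i. y i + flat_part N k (v k x) i) n" for n x
  have w_0: "w 0 x = \<pi> 0 x" and w_Suc: "w (Suc k) x = (\<lambda>i. w k x i + flat_part N k (v k x) i)" for k x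
    by (simp_all add: w_def)
  have wRN: "w n x \<in> RN N" if x: "x \<in> F" for n x
  proof (induction n)
    case 0
    show ?case using \<pi>F[OF x] F by (auto simp: w_0)
  next
    case (Suc n)
    have "\<pi> k x \<in> RN N" for k using \<pi>F[OF x] F by auto
    then show ?case using Suc by (auto simp: w_Suc RN_def flat_part_def v_def)
  qed
  have approx: "(\<Sum>i<N. \<bar>\<pi> n x i - w n x i\<bar>) \<le> (\<Sum>k<n. r ^ k * a k x)" for n x
  proof (induction n)
    case (Suc n)
    have "\<bar>\<pi> (Suc n) x i - w (Suc n) x i\<bar> \<le> \<bar>\<pi> n x i - w n x i\<bar> + \<bar>v n x i - flat_part N n (v n x) i\<bar>" for i
      by (simp add: w_Suc v_def)
    then have "(\<Sum>i<N. \<bar>\<pi> (Suc n) x i - w (Suc n) x i\<bar>)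
        \<le> (\<Sum>i<N. \<bar>\<pi> n x i - w n x i\<bar>) + (\<Sum>i<N. \<bar>v n x i - flat_part N n (v n x) i\<bar>)"
      unfolding sum.distrib[symmetric] by (rule sum_mono)
    then show ?case using Suc flat_part_props(3)[where v = "v n x" and k = n and N = N]
      by (simp add: av r_def)
  qed (simp add: w_0)
  have step2: "dist_2 N (w (Suc k) x) (w k x) \<le> a k x" for k x
    using flat_part_props(1)[where k = k and v = "v k x" and N = N] by (simp add: dist_2_eq_sqrt w_Suc av)
  have stepi: "dist_inf N (w (Suc k) x) (w k x) \<le> a k x / r ^ k" for k x
  proof (rule dist_inf_le)
    show "0 \<le> a k x / r ^ k" using a0 r by simp
    show "\<bar>w (Suc k) x i - w k x i\<bar> \<le> a k x / r ^ k" for i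
      using flat_part_props(2)[where k = k and v = "v k x" and N = N and i = i] r by (simp add: w_Suc av r_def field_simps)
  qed
  have chain: "d (w m x) (w n x) \<le> (\<Sum>k\<in>{n..<m}. e k)" if "n \<le> m" and
    step: "\<And>k. d (w (Suc k) x) (w k x) \<le> e k" and tri: "\<And>x y z. d x z \<le> d x y + d y z"
    and d0: "\<And>x. d x x = 0" for d :: "_ \<Rightarrow> _ \<Rightarrow> real" and e m n x
    using \<open>n \<le> m\<close>
  proof (induction m rule: dec_induct)
    case (step m)
    then show ?case using tri[of "w (Suc m) x" "w n x" "w m x"] that(2)[of m] by simp
  qed (simp add: d0)
  have card_w: "card (w n ` F) \<le> 2 ^ 2 ^ Suc n" if "n \<le> M" for n
  proof -
    have "card ((\<lambda>x. (w n x, \<pi> n x)) ` F) \<le> 2 ^ 2 ^ Suc n" using that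
    proof (induction n)
      case 0
      have "card ((\<lambda>x. (w 0 x, \<pi> 0 x)) ` F) = card ((\<lambda>y. (y, y)) ` \<pi> 0 ` F)"
        by (simp add: w_0 image_image)
      also have "\<dots> \<le> card (\<pi> 0 ` F)" using F by (intro card_image_le) auto
      also have "\<dots> \<le> 2 ^ 2 ^ 0" by (rule \<pi>(2)) simp
      finally show ?case by simp
    next
      case (Suc n)
      have "(\<lambda>x. (w (Suc n) x, \<pi> (Suc n) x)) ` F
        = (\<lambda>((y, p), p'). ((\<lambda>i. y i + flat_part N n (\<lambda>i. p' i - p i) i), p')) ` (\<lambda>x. ((w n x, \<pi> n x), \<pi> (Suc n) x)) ` F"
        by (simp add: image_image w_Suc v_def)
      then have "card ((\<lambda>x. (w (Suc n) x, \<pi> (Suc n) x)) ` F) \<le> card ((\<lambda>x. ((w n x, \<pi> n x), \<pi> (Suc n) x)) ` F)"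
        using F by (simp add: card_image_le)
      also have "\<dots> \<le> card ((\<lambda>x. (w n x, \<pi> n x)) ` F \<times> \<pi> (Suc n) ` F)"
        using F by (intro card_mono) auto
      also have "\<dots> \<le> 2 ^ 2 ^ Suc n * 2 ^ 2 ^ Suc n"
        unfolding card_cartesian_product using Suc \<pi>(2)[of "Suc n"] by (intro mult_mono) auto
      also have "\<dots> = 2 ^ 2 ^ Suc (Suc n)" by (simp add: power_add[symmetric])
      finally show ?case .
    qed
    moreover have "w n ` F = fst ` (\<lambda>x. (w n x, \<pi> n x)) ` F" by (simp add: image_image)
    then have "card (w n ` F) \<le> card ((\<lambda>x. (w n x, \<pi> n x)) ` F)"
      using F by (simp add: card_image_le)
    ultimately show ?thesis by linarith
  qed
  define V where "V n = (\<Union>k\<le>n. w k ` F)" for n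
  define W where "W = V M"
  have W: "finite W" "W \<noteq> {}" "W \<subseteq> RN N"
    using F wRN by (auto simp: W_def V_def)
  have V: "V n \<subseteq> W \<and> card (V n) \<le> 2 ^ 2 ^ (n + 2)" if n: "n \<le> M" for n
  proof
    show "V n \<subseteq> W" unfolding W_def V_def by (rule UN_mono) (use n in auto)
    have "card (V n) \<le> (\<Sum>k\<le>n. card (w k ` F))" unfolding V_def by (rule card_UN_le) simp
    also have "\<dots> \<le> (\<Sum>k\<le>n. 2 ^ 2 ^ Suc n)"
    proof (rule sum_mono)
      fix k assume k: "k \<in> {..n}"
      have "card (w k ` F) \<le> 2 ^ 2 ^ Suc k" using card_w k n by simp
      also have "\<dots> \<le> 2 ^ 2 ^ Suc n" using k by (intro power_increasing) auto
      finally show "card (w k ` F) \<le> 2 ^ 2 ^ Suc n" .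
    qed
    also have "\<dots> = (n + 1) * 2 ^ 2 ^ Suc n" by simp
    also have "\<dots> \<le> 2 ^ 2 ^ Suc n * 2 ^ 2 ^ Suc n"
    proof (intro mult_right_mono)
      have "n + 1 \<le> 2 ^ Suc n" using less_exp[of "Suc n"] by linarith
      also have "\<dots> \<le> 2 ^ 2 ^ Suc n" using less_exp[of "2 ^ Suc n"] by linarith
      finally show "n + 1 \<le> 2 ^ 2 ^ Suc n" .
    qed simp
    also have "\<dots> = 2 ^ 2 ^ (n + 2)" by (simp add: power_add[symmetric])
    finally show "card (V n) \<le> 2 ^ 2 ^ (n + 2)" .
  qed
  have "\<forall>y\<in>W. \<exists>m x. m \<le> M \<and> x \<in> F \<and> y = w m x" by (auto simp: W_def V_def)
  then obtain lv ba where yx: "\<And>y. y \<in> W \<Longrightarrow> lv y \<le> M \<and> ba y \<in> F \<and> y = w (lv y) (ba y)" by metis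
  have lvM: "lv y \<le> M" and baF: "ba y \<in> F" and yeq: "w (lv y) (ba y) = y" if "y \<in> W" for y
    using yx[OF that] by auto
  define sel where "sel n y = w (min n (lv y)) (ba y)" for n y
  have sel: "sel n y \<in> V n" if "y \<in> W" for n y
    using lvM[OF that] baF[OF that] by (auto simp: sel_def V_def)
  have selM: "sel M y = y" if "y \<in> W" for y
    using lvM[OF that] yeq[OF that] by (simp add: sel_def min_absorb2)
  \<comment> \<open>Used for \<open>d\<^sub>2\<close> with \<open>e = a\<close> and for \<open>d\<^sub>\<infinity>\<close> with \<open>e k x = a k x / r ^ k\<close>; in
    both cases the weighted link \<open>(2 powr \<alpha>) ^ k * e k x\<close> is the same number.\<close>
  have bound: "gamma_fun \<alpha> W d \<le> ennreal (24 * (8 * S))"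
    if met: "Metric_space (RN N) d" and \<alpha>: "1/2 \<le> \<alpha>" "\<alpha> \<le> 1"
      and e: "\<And>k x. x \<in> F \<Longrightarrow> d (w (Suc k) x) (w k x) \<le> e k x" "\<And>k x. 0 \<le> e k x"
      and es: "\<And>k x. (2 powr \<alpha>) ^ k * e k x = r ^ k * a k x"
      and tri: "\<And>x y z. d x z \<le> d x y + d y z" and d0: "\<And>x. d x x = 0"
      and dd: "\<And>x y. d x y \<le> dist_2 N x y" for \<alpha> d e
  proof (rule gamma_fun_le_of_nets[where M = M and V = V and v = sel])
    show "Metric_space W d" using met W(3) by (rule Metric_space.subspace)
    have \<beta>: "4/3 \<le> 2 powr \<alpha>"
      using powr_mono[of "1/2" \<alpha> 2] sqrt2_ge \<alpha> by (simp add: powr_half_sqrt)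
    show "(\<Sum>n<M. (2 powr \<alpha>) ^ n * d y (sel n y)) \<le> 8 * S" if y: "y \<in> W" for y
    proof -
      define m x where "m = lv y" and "x = ba y"
      have mx: "m \<le> M" "x \<in> F" "w m x = y"
        using lvM[OF y] baF[OF y] yeq[OF y] by (simp_all add: m_def x_def)
      have "d y (sel n y) \<le> (\<Sum>k\<in>{n..<m}. e k x)" for n
      proof (cases "n \<le> m")
        case True
        then have "sel n y = w n x" by (simp add: sel_def m_def x_def)
        then show ?thesis using chain[of n m d x "\<lambda>k. e k x", OF True e(1)[OF mx(2)] tri d0] mx by simp
      next
        case False
        then have "sel n y = y" using yeq[OF y] by (simp add: sel_def m_def min_absorb2)
        then show ?thesis using False by (simp add: d0)
      qed
      then have "(\<Sum>n<M. (2 powr \<alpha>) ^ n * d y (sel n y)) \<le> (\<Sum>n<M. (2 powr \<alpha>) ^ n * (\<Sum>k\<in>{n..<m}. e k x))"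
        by (intro sum_mono mult_left_mono) auto
      also have "\<dots> \<le> 4 * (\<Sum>k<M. (2 powr \<alpha>) ^ k * e k x)"
        by (rule sum_weighted_tails_le[OF \<beta> e(2) mx(1)])
      also have "\<dots> \<le> 8 * S" using a_sum[OF mx(2)] by (simp add: es)
      finally show ?thesis .
    qed
    show "d y z \<le> 8 * S" if y: "y \<in> W" and z: "z \<in> W" for y z
    proof -
      have base: "dist_2 N y (w 0 (ba y)) \<le> 2 * S" if y: "y \<in> W" for y
      proof -
        have "dist_2 N (w (lv y) (ba y)) (w 0 (ba y)) \<le> (\<Sum>k\<in>{0..<lv y}. a k (ba y))"
          by (rule chain[of 0 "lv y" "dist_2 N" "ba y" "\<lambda>k. a k (ba y)"]) (auto simp: step2 dist_2_triangle)
        also have "\<dots> \<le> (\<Sum>k<M. a k (ba y))"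
          using lvM[OF y] a0 by (intro sum_mono2) auto
        also have "\<dots> \<le> (\<Sum>k<M. r ^ k * a k (ba y))"
        proof (rule sum_mono)
          fix k
          show "a k (ba y) \<le> r ^ k * a k (ba y)"
            using mult_right_mono[OF r1[of k] a0[of k "ba y"]] by simp
        qed
        also have "\<dots> \<le> 2 * S" by (rule a_sum[OF baF[OF y]])
        finally show ?thesis unfolding yeq[OF y] .
      qed
      have "d y z \<le> dist_2 N y z" by (rule dd)
      also have "\<dots> \<le> dist_2 N y (w 0 (ba y)) + dist_2 N (w 0 (ba y)) z" by (rule dist_2_triangle)
      also have "dist_2 N (w 0 (ba y)) z \<le> dist_2 N (w 0 (ba y)) (w 0 (ba z)) + dist_2 N (w 0 (ba z)) z"
        by (rule dist_2_triangle)
      also have "dist_2 N (w 0 (ba y)) (w 0 (ba z)) \<le> S"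
        unfolding w_0 by (intro diam \<pi>F baF y z)
      finally show ?thesis using base[OF y] base[OF z] S by (simp add: dist_2_commute)
    qed
  qed (use W \<alpha> V sel selM in auto)
  have "gamma_fun (1/2) W (dist_2 N) \<le> ennreal (24 * (8 * S))"
    by (rule bound[where e = a])
      (use Metric_space_dist_2 step2 a0 dist_2_triangle in \<open>auto simp: r_def powr_half_sqrt\<close>)
  moreover have "gamma_fun 1 W (dist_inf N) \<le> ennreal (24 * (8 * S))"
  proof (rule bound[where e = "\<lambda>k x. a k x / r ^ k"])
    have "(2::real) ^ k = r ^ k * r ^ k" for k by (simp add: r(2)[symmetric] power_mult_distrib)
    then show "(2 powr 1) ^ k * (a k x / r ^ k) = r ^ k * a k x" for k x using r by simp
  qed (use Metric_space_dist_inf stepi a0 r dist_inf_triangle dist_inf_le_dist_2 in auto)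
  moreover have "\<exists>w\<in>W. (\<Sum>i<N. \<bar>x i - w i\<bar>) \<le> 2 * S" if x: "x \<in> F" for x
  proof
    show "w M x \<in> W" using x by (auto simp: W_def V_def)
    show "(\<Sum>i<N. \<bar>x i - w M x i\<bar>) \<le> 2 * S"
      using approx[of M x] a_sum[OF x] by (simp add: \<pi>_def)
  qed
  ultimately show ?thesis using W(3) by (intro exI[of _ W]) auto
qed

section \<open>Reduction to finite sets\<close>

lemma real_bern:
  assumes "T \<noteq> {}" "bern N T \<noteq> \<infinity>"
  shows "bern N T = ereal (real_of_ereal (bern N T))" "0 \<le> real_of_ereal (bern N T)"
  using assms bern_nonneg[OF assms(1), of N]
  by (auto simp: ereal_real real_of_ereal_pos)

text \<open>
  Hence a set with finite \<open>b\<close> is bounded.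
\<close>

lemma coord_diff_le_bern:
  assumes B: "bern N T = ereal B" and st: "s \<in> T" "t \<in> T" and i: "i < N"
  shows "\<bar>s i - t i\<bar> \<le> 2 * B"
proof -
  have "\<bar>s i - t i\<bar> \<le> avg N (\<lambda>\<epsilon>. \<bar>ip N \<epsilon> (\<lambda>i. s i - t i)\<bar>)"
    by (rule abs_coord_le_avg_abs_ip[OF i, of "\<lambda>i. s i - t i"])
  also have "\<dots> \<le> 2 * avg N (sup_ip N {s, t})" by (rule avg_abs_ip_le) auto
  also have "\<dots> \<le> 2 * B"
    using avg_sup_ip_le_bern[of "{s, t}" T N] st B by simp
  finally show ?thesis .
qed

lemma mem_plus_B1I:
  assumes "u \<in> U" "U \<subseteq> RN N" "t \<in> RN N" and le: "(\<Sum>i<N. \<bar>t i - u i\<bar>) \<le> r" and r: "0 < r"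
  shows "t \<in> plus_B1 N U r"
proof -
  define v where "v = (\<lambda>i. (t i - u i) / r)"
  have "(\<Sum>i<N. \<bar>v i\<bar>) = (\<Sum>i<N. \<bar>t i - u i\<bar>) / r"
    using r by (simp add: v_def sum_divide_distrib)
  also have "\<dots> \<le> 1" using le r by simp
  finally have "v \<in> B1 N" using assms by (auto simp: B1_def RN_def v_def)
  moreover have "t = (\<lambda>i. u i + r * v i)" using r by (simp add: v_def)
  ultimately show ?thesis using assms(1) unfolding plus_B1_def by blast
qed

lemma subset_plus_B1: "U \<subseteq> plus_B1 N U r"
proof
  fix u assume "u \<in> U"
  moreover have "(\<lambda>_. 0) \<in> B1 N" by (simp add: B1_def RN_def)
  ultimately show "u \<in> plus_B1 N U r"
    unfolding plus_B1_def by (intro CollectI exI[of _ u] exI[of _ "\<lambda>_. 0"]) simp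
qed

lemma mem_plus_B1D:
  assumes "t \<in> plus_B1 N U r" "0 \<le> r"
  shows "\<exists>u\<in>U. (\<Sum>i<N. \<bar>t i - u i\<bar>) \<le> r"
proof -
  obtain u v where uv: "u \<in> U" "v \<in> B1 N" "t = (\<lambda>i. u i + r * v i)"
    using assms(1) unfolding plus_B1_def by blast
  have "(\<Sum>i<N. \<bar>t i - u i\<bar>) = r * (\<Sum>i<N. \<bar>v i\<bar>)"
    using assms(2) by (simp add: uv(3) abs_mult sum_distrib_left)
  also have "\<dots> \<le> r * 1" using uv(2) assms(2) by (intro mult_left_mono) (auto simp: B1_def)
  finally show ?thesis using uv(1) by auto
qed

text \<open>
  One representative from each nonempty cell of a cubic grid of mesh \<open>B / (N + 1)\<close>.
\<close>

lemma finite_l1_net: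
  assumes T: "T \<subseteq> RN N" "T \<noteq> {}" and bounded: "\<And>s t i. s \<in> T \<Longrightarrow> t \<in> T \<Longrightarrow> i < N \<Longrightarrow> \<bar>s i - t i\<bar> \<le> L"
    and B: "0 < B"
  shows "\<exists>F\<subseteq>T. finite F \<and> F \<noteq> {} \<and> (\<forall>t\<in>T. \<exists>f\<in>F. (\<Sum>i<N. \<bar>t i - f i\<bar>) \<le> B)"
proof -
  define \<delta> where "\<delta> = B / (N + 1)"
  have \<delta>: "0 < \<delta>" using B by (simp add: \<delta>_def)
  obtain t0 where t0: "t0 \<in> T" using T by auto
  define cell where "cell t = (\<lambda>i\<in>{..<N}. \<lfloor>(t i - t0 i) / \<delta>\<rfloor>)" for t
  have "cell ` T \<subseteq> (\<Pi>\<^sub>E i\<in>{..<N}. {\<lfloor>- L / \<delta>\<rfloor>..\<lfloor>L / \<delta>\<rfloor>})"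
  proof (intro image_subsetI PiE_I)
    fix t i assume t: "t \<in> T" and i: "i \<in> {..<N}"
    have "- L \<le> t i - t0 i" "t i - t0 i \<le> L" using bounded[OF t t0, of i] i by auto
    then have "- L / \<delta> \<le> (t i - t0 i) / \<delta>" "(t i - t0 i) / \<delta> \<le> L / \<delta>"
      using \<delta> by (intro divide_right_mono; simp)+
    then show "cell t i \<in> {\<lfloor>- L / \<delta>\<rfloor>..\<lfloor>L / \<delta>\<rfloor>}"
      using i by (simp add: cell_def floor_mono)
  qed (auto simp: cell_def)
  then have fin: "finite (cell ` T)" by (rule finite_subset) (intro finite_PiE; simp)
  define pick where "pick c = (SOME t. t \<in> T \<and> cell t = c)" for c
  have pick: "pick (cell t) \<in> T \<and> cell (pick (cell t)) = cell t" if "t \<in> T" for t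
    unfolding pick_def by (rule someI[of _ t]) (use that in simp)
  define F where "F = pick ` cell ` T"
  have "F \<subseteq> T" using pick by (auto simp: F_def)
  moreover have "finite F" "F \<noteq> {}" using fin T by (auto simp: F_def)
  moreover have "\<exists>f\<in>F. (\<Sum>i<N. \<bar>t i - f i\<bar>) \<le> B" if t: "t \<in> T" for t
  proof
    define f where "f = pick (cell t)"
    show "f \<in> F" using t by (simp add: f_def F_def)
    have "\<bar>t i - f i\<bar> \<le> \<delta>" if i: "i < N" for i
    proof -
      have "cell f i = cell t i" using pick[OF t] by (simp add: f_def)
      then have "\<lfloor>(f i - t0 i) / \<delta>\<rfloor> = \<lfloor>(t i - t0 i) / \<delta>\<rfloor>" using i by (simp add: cell_def)
      then have "\<bar>(f i - t0 i) / \<delta> - (t i - t0 i) / \<delta>\<bar> < 1" by linarith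
      then have "\<bar>f i - t i\<bar> / \<delta> < 1" using \<delta> by (simp add: diff_divide_distrib[symmetric])
      then show ?thesis using \<delta> by (simp add: field_simps abs_minus_commute)
    qed
    then have "(\<Sum>i<N. \<bar>t i - f i\<bar>) \<le> (\<Sum>i<N. \<delta>)" by (intro sum_mono) auto
    also have "\<dots> \<le> B" using B by (simp add: \<delta>_def field_simps)
    finally show "(\<Sum>i<N. \<bar>t i - f i\<bar>) \<le> B" .
  qed
  ultimately show ?thesis by blast
qed

text \<open>
  The common shape of the three statements, with the condition on \<open>U\<close> at level \<open>r = K b(T)\<close> as the
  parameter \<open>Q N U r\<close>.
\<close>

definition decomposable :: "(nat \<Rightarrow> (nat \<Rightarrow> real) set \<Rightarrow> real \<Rightarrow> bool) \<Rightarrow> real \<Rightarrow> bool" where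
  "decomposable Q K \<longleftrightarrow> K > 0 \<and> (\<forall>N T. T \<subseteq> RN N \<and> T \<noteq> {} \<and> bern N T \<noteq> \<infinity> \<longrightarrow>
     (\<exists>U. U \<subseteq> RN N \<and> T \<subseteq> plus_B1 N U (K * real_of_ereal (bern N T)) \<and> Q N U (K * real_of_ereal (bern N T))))"

lemma ip_le_add_l1_dist:
  assumes "e \<in> signs N"
  shows "ip N e u \<le> ip N e t + (\<Sum>i<N. \<bar>t i - u i\<bar>)"
proof -
  have "ip N e u - ip N e t = (\<Sum>i<N. e i * (u i - t i))"
    by (simp add: ip_def sum_subtractf right_diff_distrib)
  also have "\<dots> \<le> (\<Sum>i<N. \<bar>t i - u i\<bar>)"
  proof (rule sum_mono)
    fix i assume "i \<in> {..<N}"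
    then have "e i = 1 \<or> e i = -1" using assms by (auto simp: signs_iff)
    then show "e i * (u i - t i) \<le> \<bar>t i - u i\<bar>" by auto
  qed
  finally show ?thesis by simp
qed

text \<open>
  Apply the hypothesis to a finite net \<open>F\<close> of \<open>T\<close>, whose Bernoulli supremum \<open>b\<close> is at most \<open>B\<close>, and
  keep for each \<open>f \<in> F\<close> only one point \<open>g f\<close> of \<open>U\<close>. The bound on \<open>\<gamma>\<close> passes to the finite set
  in the form of nets, which unlike the measure may be taken inside it. The factor 2 in
  \<open>2 * K * B\<close> makes room for a measure that nearly attains the infimum.
\<close>

lemma finite_decomposition:
  assumes dec: "decomposable (\<lambda>N U r. gamma_fun \<alpha> U (d N) \<le> ennreal r) K"
    and met: "Metric_space (RN N) (d N)" and \<alpha>: "1/2 \<le> \<alpha>" "\<alpha> \<le> 1"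
    and T: "T \<subseteq> RN N" "T \<noteq> {}" and B: "0 < B" "bern N T = ereal B"
  shows "\<exists>U. U \<subseteq> RN N \<and> finite U \<and> U \<noteq> {} \<and> (\<forall>t\<in>T. \<exists>u\<in>U. (\<Sum>i<N. \<bar>t i - u i\<bar>) \<le> (K + 1) * B) \<and>
    avg N (sup_ip N U) \<le> (K + 1) * B \<and> (\<forall>M. has_nets (d N) (2 powr \<alpha>) M U (40 * (K + 1) * B))"
proof -
  have K: "0 < K" using dec by (simp add: decomposable_def)
  obtain F where F: "F \<subseteq> T" "finite F" "F \<noteq> {}"
    and Fnet: "\<And>t. t \<in> T \<Longrightarrow> \<exists>f\<in>F. (\<Sum>i<N. \<bar>t i - f i\<bar>) \<le> B"
  proof -
    have "\<exists>F\<subseteq>T. finite F \<and> F \<noteq> {} \<and> (\<forall>t\<in>T. \<exists>f\<in>F. (\<Sum>i<N. \<bar>t i - f i\<bar>) \<le> B)"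
      by (rule finite_l1_net[where L = "2 * B"]) (use T B(1) coord_diff_le_bern[OF B(2)] in auto)
    then show ?thesis using that by blast
  qed
  have le: "bern N F \<le> ereal B" using bern_mono[OF F(1), of N] B(2) by simp
  then have fin: "bern N F \<noteq> \<infinity>" by auto
  define b where "b = real_of_ereal (bern N F)"
  have b: "bern N F = ereal b" "0 \<le> b" using real_bern[OF F(3) fin] by (simp_all add: b_def)
  have bB: "b \<le> B" using le b by simp
  have "F \<subseteq> RN N \<and> F \<noteq> {} \<and> bern N F \<noteq> \<infinity>" using F T fin by auto
  then obtain U where U: "U \<subseteq> RN N" "F \<subseteq> plus_B1 N U (K * b)" "gamma_fun \<alpha> U (d N) \<le> ennreal (K * b)"
    using dec unfolding decomposable_def b_def by blast
  have "\<forall>f\<in>F. \<exists>u. u \<in> U \<and> (\<Sum>i<N. \<bar>f i - u i\<bar>) \<le> K * b"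
    using mem_plus_B1D[of _ N U "K * b"] U(2) K b(2) by (meson mult_nonneg_nonneg less_imp_le subsetD)
  then obtain g where g: "\<And>f. f \<in> F \<Longrightarrow> g f \<in> U" "\<And>f. f \<in> F \<Longrightarrow> (\<Sum>i<N. \<bar>f i - g f i\<bar>) \<le> K * b"
    by metis
  have KbB: "K * b \<le> K * B" using K bB by simp
  define U' where "U' = g ` F"
  have U': "finite U'" "U' \<noteq> {}" "U' \<subseteq> U" using F g(1) by (auto simp: U'_def)
  have near: "\<exists>u\<in>U'. (\<Sum>i<N. \<bar>t i - u i\<bar>) \<le> (K + 1) * B" if t: "t \<in> T" for t
  proof -
    obtain f where f: "f \<in> F" "(\<Sum>i<N. \<bar>t i - f i\<bar>) \<le> B" using Fnet[OF t] by blast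
    have "(\<Sum>i<N. \<bar>t i - g f i\<bar>) \<le> (\<Sum>i<N. \<bar>t i - f i\<bar> + \<bar>f i - g f i\<bar>)"
      by (intro sum_mono) auto
    also have "\<dots> \<le> B + K * B" using f g(2)[OF f(1)] KbB by (simp add: sum.distrib)
    finally show ?thesis using f(1) by (auto simp: U'_def algebra_simps)
  qed
  have "avg N (sup_ip N U') \<le> avg N (\<lambda>\<epsilon>. sup_ip N F \<epsilon> + K * b)"
  proof (rule avg_mono)
    fix \<epsilon> assume e: "\<epsilon> \<in> signs N"
    show "sup_ip N U' \<epsilon> \<le> sup_ip N F \<epsilon> + K * b"
    proof (rule sup_ip_le[OF U'(1,2)])
      fix u assume "u \<in> U'"
      then obtain f where f: "f \<in> F" "u = g f" by (auto simp: U'_def)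
      show "ip N \<epsilon> u \<le> sup_ip N F \<epsilon> + K * b"
        using ip_le_add_l1_dist[OF e, of u f] g(2)[OF f(1)] sup_ip_ge[OF F(2) f(1), of N \<epsilon>] f(2) by simp
    qed
  qed
  also have "\<dots> \<le> b + K * b"
    using avg_sup_ip_le_bern[OF F(2,3) subset_refl, of N] b(1) by (simp add: avg_add)
  also have "\<dots> \<le> (K + 1) * B" using bB KbB by (simp add: algebra_simps)
  finally have avgU: "avg N (sup_ip N U') \<le> (K + 1) * B" .
  have metU: "Metric_space U (d N)" using met U(1) by (rule Metric_space.subspace)
  have "K * b < 2 * K * B" using KbB mult_pos_pos[OF K B(1)] by simp
  moreover have "0 < 2 * K * B" using K B(1) by simp
  ultimately have "ennreal (K * b) < ennreal (2 * K * B)" by (simp only: ennreal_lessI)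
  with U(3) have "gamma_fun \<alpha> U (d N) < ennreal (2 * K * B)" by (rule order_le_less_trans)
  then obtain \<mu> where \<mu>: "\<mu> \<in> prob_measures_on U (d N)"
    "(SUP x\<in>U. \<integral>\<^sup>+\<epsilon>\<in>{0<..}. log_inv_pow \<alpha> (measure \<mu> (Metric_space.mcball U (d N) x \<epsilon>)) \<partial>lborel) < ennreal (2 * K * B)"
    unfolding gamma_fun_def by (auto simp: INF_less_iff)
  have "has_nets (d N) (2 powr \<alpha>) M U' (20 * (2 * K * B))" for M
  proof (rule has_nets_of_measure[OF metU U'(1,3) \<mu>(1) \<alpha>])
    show "0 < 2 * K * B" using K B by simp
    fix x assume "x \<in> U'"
    then show "(\<integral>\<^sup>+\<epsilon>\<in>{0<..}. log_inv_pow \<alpha> (measure \<mu> (Metric_space.mcball U (d N) x \<epsilon>)) \<partial>lborel) \<le> ennreal (2 * K * B)"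
      using U'(3) by (intro order_trans[OF SUP_upper less_imp_le[OF \<mu>(2)]]) auto
  qed
  then have "has_nets (d N) (2 powr \<alpha>) M U' (40 * (K + 1) * B)" for M
    by (rule has_nets_mono) (use K B in \<open>simp add: algebra_simps\<close>)
  then show ?thesis using U' U(1) near avgU by (intro exI[of _ U']) auto
qed

text \<open>
  If \<open>b(T) = 0\<close> there is no room for approximations, but then \<open>T\<close> is a single point and serves as its
  own \<open>U\<close>.
\<close>

lemma gamma_fun_eq_0_of_bern_eq_0:
  assumes T: "T \<subseteq> RN N" "T \<noteq> {}" and B: "bern N T = ereal 0"
    and met: "Metric_space (RN N) d" and \<alpha>: "1/2 \<le> \<alpha>" "\<alpha> \<le> 1"
  shows "gamma_fun \<alpha> T d \<le> ennreal 0"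
proof -
  obtain t where t: "t \<in> T" using T by auto
  have single: "s = t" if s: "s \<in> T" for s
  proof
    fix i
    show "s i = t i"
    proof (cases "i < N")
      case True
      then show ?thesis using coord_diff_le_bern[OF B s t] by simp
    next
      case False
      moreover have "s \<in> RN N" "t \<in> RN N" using s t T by auto
      ultimately show ?thesis by (simp add: RN_def)
    qed
  qed
  then have Tt: "T = {t}" using t by blast
  have metT: "Metric_space T d" using met T(1) by (rule Metric_space.subspace)
  have dt: "d t t = 0" using Metric_space.mdist_zero[OF metT t] .
  have "gamma_fun \<alpha> T d \<le> ennreal (24 * 0)"
    by (rule gamma_fun_le_of_nets[OF metT _ T(2) \<alpha>, where M = 0 and V = "\<lambda>_. T" and v = "\<lambda>_ x. x"])
      (auto simp: Tt dt)
  then show "gamma_fun \<alpha> T d \<le> ennreal 0" by simp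
qed

lemma decomposableI:
  assumes K: "0 < K"
    and zero: "\<And>N T. T \<subseteq> RN N \<Longrightarrow> T \<noteq> {} \<Longrightarrow> bern N T = ereal 0 \<Longrightarrow> Q N T 0"
    and pos: "\<And>N T B. T \<subseteq> RN N \<Longrightarrow> T \<noteq> {} \<Longrightarrow> 0 < B \<Longrightarrow> bern N T = ereal B \<Longrightarrow>
      \<exists>U\<subseteq>RN N. (\<forall>t\<in>T. \<exists>u\<in>U. (\<Sum>i<N. \<bar>t i - u i\<bar>) \<le> K * B) \<and> Q N U (K * B)"
  shows "decomposable Q K"
  unfolding decomposable_def
proof (intro conjI allI impI K)
  fix N T assume T: "T \<subseteq> RN N \<and> T \<noteq> {} \<and> bern N T \<noteq> \<infinity>"
  define B where "B = real_of_ereal (bern N T)"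
  have B: "bern N T = ereal B" "0 \<le> B" using T real_bern[of T N] by (auto simp: B_def)
  have "\<exists>U\<subseteq>RN N. T \<subseteq> plus_B1 N U (K * B) \<and> Q N U (K * B)"
  proof (cases "B = 0")
    case True
    then have "Q N T 0" using zero[of T N] T B(1) by simp
    then show ?thesis using T True subset_plus_B1[of T N 0] by (intro exI[of _ T]) simp
  next
    case False
    then have Bpos: "0 < B" using B(2) by simp
    obtain U where U: "U \<subseteq> RN N" "\<And>t. t \<in> T \<Longrightarrow> \<exists>u\<in>U. (\<Sum>i<N. \<bar>t i - u i\<bar>) \<le> K * B" "Q N U (K * B)"
      using pos[OF _ _ Bpos B(1)] T by blast
    have "T \<subseteq> plus_B1 N U (K * B)"
    proof
      fix t assume t: "t \<in> T"
      obtain u where "u \<in> U" "(\<Sum>i<N. \<bar>t i - u i\<bar>) \<le> K * B" using U(2)[OF t] by blast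
      then show "t \<in> plus_B1 N U (K * B)" using mem_plus_B1I[of u U N t "K * B"] U(1) t T K Bpos by auto
    qed
    then show ?thesis using U by blast
  qed
  then show "\<exists>U. U \<subseteq> RN N \<and> T \<subseteq> plus_B1 N U (K * real_of_ereal (bern N T)) \<and>
      Q N U (K * real_of_ereal (bern N T))" unfolding B_def by blast
qed

section \<open>Equivalence of the decompositions\<close>

definition both_gammas :: "nat \<Rightarrow> (nat \<Rightarrow> real) set \<Rightarrow> real \<Rightarrow> bool" where
  "both_gammas N U r \<longleftrightarrow> gamma_fun (1/2) U (dist_2 N) \<le> ennreal r \<and> gamma_fun 1 U (dist_inf N) \<le> ennreal r"

lemma both_gammas_singleton:
  "T \<subseteq> RN N \<Longrightarrow> T \<noteq> {} \<Longrightarrow> bern N T = ereal 0 \<Longrightarrow> both_gammas N T 0"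
  unfolding both_gammas_def
  using gamma_fun_eq_0_of_bern_eq_0[OF _ _ _ Metric_space_dist_2, of T N "1/2"]
    gamma_fun_eq_0_of_bern_eq_0[OF _ _ _ Metric_space_dist_inf, of T N 1] by simp

lemma exists_power_card: "\<exists>M. card U \<le> 2 ^ 2 ^ M"
proof -
  have "card U < 2 ^ card U" by (rule less_exp)
  also have "(2::nat) ^ card U < 2 ^ 2 ^ card U" by (rule less_exp)
  finally show ?thesis using less_imp_le by blast
qed

text \<open>
  The finite set \<open>F\<close> obtained from the hypothesis is replaced by its truncated chains \<open>W\<close>; the second
  approximation error adds to the first.
\<close>

lemma decomposable_both_of_l2:
  assumes dec: "decomposable (\<lambda>N U r. gamma_fun (1/2) U (dist_2 N) \<le> ennreal r) K"
  shows "decomposable both_gammas (7680 * (K + 1))"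
proof (rule decomposableI)
  have K: "0 < K" using dec by (simp add: decomposable_def)
  then show "0 < 7680 * (K + 1)" by simp
  fix N T B assume T: "T \<subseteq> RN N" "T \<noteq> {}" and B: "0 < B" "bern N T = ereal B"
  define S where "S = 40 * (K + 1) * B"
  have S: "0 < S" "(K + 1) * B \<le> S" "4 * ((K + 1) * B) \<le> S"
    using K B(1) by (simp_all add: S_def)
  obtain F where F: "F \<subseteq> RN N" "finite F" "F \<noteq> {}"
    "\<And>t. t \<in> T \<Longrightarrow> \<exists>u\<in>F. (\<Sum>i<N. \<bar>t i - u i\<bar>) \<le> (K + 1) * B"
    "avg N (sup_ip N F) \<le> (K + 1) * B" "\<And>M. has_nets (dist_2 N) (2 powr (1/2)) M F S"
    using finite_decomposition[OF dec Metric_space_dist_2 _ _ T B] unfolding S_def by auto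
  obtain M where M: "card F \<le> 2 ^ 2 ^ M" using exists_power_card by blast
  have diam: "dist_2 N x y \<le> S" if "x \<in> F" "y \<in> F" for x y
    using dist_2_le_avg_sup_ip[OF F(2) that, of N] F(5) S by linarith
  have nets: "has_nets (dist_2 N) (sqrt 2) M F S" using F(6)[of M] by (simp add: powr_half_sqrt)
  obtain W where W: "W \<subseteq> RN N" "\<And>x. x \<in> F \<Longrightarrow> \<exists>w\<in>W. (\<Sum>i<N. \<bar>x i - w i\<bar>) \<le> 2 * S"
    "gamma_fun (1/2) W (dist_2 N) \<le> ennreal (192 * S)" "gamma_fun 1 W (dist_inf N) \<le> ennreal (192 * S)"
    using truncated_chains[OF F(2,3,1) M diam nets] by blast
  have const: "192 * S = 7680 * (K + 1) * B" by (simp add: S_def)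
  show "\<exists>U\<subseteq>RN N. (\<forall>t\<in>T. \<exists>u\<in>U. (\<Sum>i<N. \<bar>t i - u i\<bar>) \<le> 7680 * (K + 1) * B) \<and>
      both_gammas N U (7680 * (K + 1) * B)"
  proof (intro exI[of _ W] conjI ballI)
    show "both_gammas N W (7680 * (K + 1) * B)" using W(3,4) by (simp add: both_gammas_def const)
    fix t assume "t \<in> T"
    then obtain u where u: "u \<in> F" "(\<Sum>i<N. \<bar>t i - u i\<bar>) \<le> (K + 1) * B" using F(4) by blast
    obtain w where w: "w \<in> W" "(\<Sum>i<N. \<bar>u i - w i\<bar>) \<le> 2 * S" using W(2)[OF u(1)] by blast
    have "(\<Sum>i<N. \<bar>t i - w i\<bar>) \<le> (\<Sum>i<N. \<bar>t i - u i\<bar> + \<bar>u i - w i\<bar>)" by (intro sum_mono) auto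
    also have "\<dots> \<le> S + 2 * S" using u(2) w(2) S by (simp add: sum.distrib)
    also have "\<dots> \<le> 7680 * (K + 1) * B" using S(1) unfolding const[symmetric] by simp
    finally show "\<exists>u\<in>W. (\<Sum>i<N. \<bar>t i - u i\<bar>) \<le> 7680 * (K + 1) * B" using w(1) by blast
  qed (rule W(1))
qed (rule both_gammas_singleton)

text \<open>
  Here the finite set \<open>F\<close> itself serves as \<open>U\<close>: it carries both kinds of nets.
\<close>

lemma decomposable_both_of_inf:
  assumes dec: "decomposable (\<lambda>N U r. gamma_fun 1 U (dist_inf N) \<le> ennreal r) K"
  shows "decomposable both_gammas (2880 * core_const * (K + 1))"
proof (rule decomposableI)
  have core: "1 \<le> core_const" unfolding core_const_def using sud_const_ge by simp
  have K: "0 < K" using dec by (simp add: decomposable_def)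
  then show "0 < 2880 * core_const * (K + 1)" using core by simp
  fix N T B assume T: "T \<subseteq> RN N" "T \<noteq> {}" and B: "0 < B" "bern N T = ereal B"
  define S where "S = 40 * (K + 1) * B"
  have S: "0 < S" "(K + 1) * B \<le> S" "4 * ((K + 1) * B) \<le> S"
    using K B(1) by (simp_all add: S_def)
  obtain F where F: "F \<subseteq> RN N" "finite F" "F \<noteq> {}"
    "\<And>t. t \<in> T \<Longrightarrow> \<exists>u\<in>F. (\<Sum>i<N. \<bar>t i - u i\<bar>) \<le> (K + 1) * B"
    "avg N (sup_ip N F) \<le> (K + 1) * B" "\<And>M. has_nets (dist_inf N) (2 powr 1) M F S"
    using finite_decomposition[OF dec Metric_space_dist_inf _ _ T B] unfolding S_def by auto
  obtain M where M: "card F \<le> 2 ^ 2 ^ M" using exists_power_card by blast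
  have diam: "dist_2 N x y \<le> S" if "x \<in> F" "y \<in> F" for x y
    using dist_2_le_avg_sup_ip[OF F(2) that, of N] F(5) S by linarith
  define S' where "S' = 3 * core_const * S"
  have S': "S \<le> S'" using mult_right_mono[of 1 "3 * core_const" S] core S(1) by (simp add: S'_def)
  have nets: "has_nets (dist_2 N) (sqrt 2) M F S'"
    unfolding S'_def using F(5) F(6)[of M] S by (intro nets_2_of_nets_inf[OF F(2,3) S(1)]) auto
  have const: "24 * S' = 2880 * core_const * (K + 1) * B" by (simp add: S_def S'_def)
  have g2: "gamma_fun (1/2) F (dist_2 N) \<le> ennreal (24 * S')"
  proof (rule gamma_fun_le_of_has_nets[OF _ F(2,3) _ _ _ M])
    show "Metric_space F (dist_2 N)" using Metric_space_dist_2 F(1) by (rule Metric_space.subspace)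
    show "has_nets (dist_2 N) (2 powr (1/2)) M F S'" using nets by (simp add: powr_half_sqrt)
    show "dist_2 N x y \<le> S'" if "x \<in> F" "y \<in> F" for x y using diam[OF that] S' by linarith
  qed auto
  have "gamma_fun 1 F (dist_inf N) \<le> ennreal (24 * S)"
  proof (rule gamma_fun_le_of_has_nets[OF _ F(2,3) _ _ F(6) M])
    show "Metric_space F (dist_inf N)" using Metric_space_dist_inf F(1) by (rule Metric_space.subspace)
    show "dist_inf N x y \<le> S" if "x \<in> F" "y \<in> F" for x y
      using diam[OF that] dist_inf_le_dist_2[of N x y] by linarith
  qed auto
  also have "\<dots> \<le> ennreal (24 * S')" using S' by (intro ennreal_leI) simp
  finally have gi: "gamma_fun 1 F (dist_inf N) \<le> ennreal (24 * S')" .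
  show "\<exists>U\<subseteq>RN N. (\<forall>t\<in>T. \<exists>u\<in>U. (\<Sum>i<N. \<bar>t i - u i\<bar>) \<le> 2880 * core_const * (K + 1) * B) \<and>
      both_gammas N U (2880 * core_const * (K + 1) * B)"
  proof (intro exI[of _ F] conjI ballI)
    show "both_gammas N F (2880 * core_const * (K + 1) * B)"
      using g2 gi by (simp add: both_gammas_def const)
    fix t assume "t \<in> T"
    then obtain u where u: "u \<in> F" "(\<Sum>i<N. \<bar>t i - u i\<bar>) \<le> (K + 1) * B" using F(4) by blast
    have "(\<Sum>i<N. \<bar>t i - u i\<bar>) \<le> 24 * S'" using u(2) S S' by linarith
    then show "\<exists>u\<in>F. (\<Sum>i<N. \<bar>t i - u i\<bar>) \<le> 2880 * core_const * (K + 1) * B"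
      using u(1) unfolding const by blast
  qed (rule F(1))
qed (rule both_gammas_singleton)

lemma decomposable_mono:
  "decomposable Q K \<Longrightarrow> (\<And>N U r. Q N U r \<Longrightarrow> R N U r) \<Longrightarrow> decomposable R K"
  unfolding decomposable_def by meson

theorem theorem4p2:
  shows
    "let a = (\<exists>K::real. K > 0 \<and> (\<forall>(N::nat) T. T \<subseteq> RN N \<and> T \<noteq> {} \<and> bern N T \<noteq> \<infinity> \<longrightarrow>
          (\<exists>U. U \<subseteq> RN N \<and> T \<subseteq> plus_B1 N U (K * real_of_ereal (bern N T)) \<and>
            gamma_fun (1/2) U (dist_2 N) \<le> ennreal (K * real_of_ereal (bern N T)))));
         b = (\<exists>K::real. K > 0 \<and> (\<forall>(N::nat) T. T \<subseteq> RN N \<and> T \<noteq> {} \<and> bern N T \<noteq> \<infinity> \<longrightarrow>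
          (\<exists>U. U \<subseteq> RN N \<and> T \<subseteq> plus_B1 N U (K * real_of_ereal (bern N T)) \<and>
            gamma_fun (1/2) U (dist_2 N) \<le> ennreal (K * real_of_ereal (bern N T)) \<and>
            gamma_fun 1 U (dist_inf N) \<le> ennreal (K * real_of_ereal (bern N T)))));
         c = (\<exists>K::real. K > 0 \<and> (\<forall>(N::nat) T. T \<subseteq> RN N \<and> T \<noteq> {} \<and> bern N T \<noteq> \<infinity> \<longrightarrow>
          (\<exists>U. U \<subseteq> RN N \<and> T \<subseteq> plus_B1 N U (K * real_of_ereal (bern N T)) \<and>
            gamma_fun 1 U (dist_inf N) \<le> ennreal (K * real_of_ereal (bern N T)))))
     in (a \<longleftrightarrow> b) \<and> (b \<longleftrightarrow> c)"
proof -
  let ?l2 = "\<lambda>N U r. gamma_fun (1/2) U (dist_2 N) \<le> ennreal r"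
  let ?inf = "\<lambda>N U r. gamma_fun 1 U (dist_inf N) \<le> ennreal r"
  have "(\<exists>K. decomposable ?l2 K) \<longleftrightarrow> (\<exists>K. decomposable both_gammas K)"
    using decomposable_both_of_l2 decomposable_mono[of both_gammas _ ?l2]
    by (auto simp: both_gammas_def)
  moreover have "(\<exists>K. decomposable both_gammas K) \<longleftrightarrow> (\<exists>K. decomposable ?inf K)"
    using decomposable_both_of_inf decomposable_mono[of both_gammas _ ?inf]
    by (auto simp: both_gammas_def)
  ultimately show ?thesis
    unfolding Let_def decomposable_def both_gammas_def by blast
qed

end
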